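(* There is a universal constant $C>0$ such that for all integers $d\ge 1$, $L\ge 2$ and $1\le k\le \tfrac12 L^d$, the mixing time $\tau_{\mathrm{mix}}$ of the exclusion process on $G=\mathbf{Z}^d/L\mathbf{Z}^d$ with $k$ black balls satisfies $$\tau_{\mathrm{mix}}\le C\left[\,d\,(\log d)\,L^2+(\log d)\,L^2\log k\,\right],$$ where $\log d$ is read as $1$ when $d=1$.
   Context: Exclusion process on a finite connected graph $G=(V,E)$ with $k\le |V|/2$ black balls: a configuration places one ball at each vertex, $k$ of the balls being black and the remaining $|V|-k$ white, with balls of the same color indistinguishable. It is the continuous-time Markov process in which, independently for each edge $e$ at rate 1, the balls at the two endpoints of $e$ are switched. Let $K^t$ be its transition kernel at time $t$, $\mathcal{C}$ the set of configurations (with $k$ black balls), and $\mathcal{U}$ the uniform distribution on $\mathcal{C}$. For probability distributions, $\|\mu-\nu\|=\max_{Q\subset\mathcal{C}}(\mu(Q)-\nu(Q))$ is total variation distance. The mixing time is $\tau_{\mathrm{mix}}=\inf\{t:\|K^t(x,\cdot)-\mathcal{U}\|\le \tfrac14\text{ for all }x\in\mathcal{C}\}$. $\mathbf{Z}^d/L\mathbf{Z}^d$ denotes the $d$-dimensional discrete torus with nearest-neighbor edges and $L^d$ vertices (for $L=2$ it is the hypercube $\{0,1\}^d$ with simple edges). *)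

theory Defs
  imports "HOL-Probability.Probability"
begin

text \<open>A graph is given by its vertex set \<open>V\<close> and its set \<open>E\<close> of edges, each edge being a
  two-element subset of \<open>V\<close>. A configuration is identified with the set of vertices that
  carry a black ball.\<close>

definition configurations :: "'v set \<Rightarrow> nat \<Rightarrow> 'v set set" where
  "configurations V k = {A. A \<subseteq> V \<and> card A = k}"

text \<open>Switching the balls at the two endpoints of an edge has an effect only if the endpoints
  carry different colours; the lemma below gives the description by a transposition.\<close>

definition switch :: "'v set \<Rightarrow> 'v set \<Rightarrow> 'v set" where
  "switch e A = (if e \<subseteq> A \<or> e \<inter> A = {} then A else (A - e) \<union> (e - A))"

lemma switch_eq_transpose: "switch {u, v} A = Transposition.transpose u v ` A"
  by (auto simp: switch_def Transposition.transpose_def image_iff split: if_splits)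

definition generator :: "'v set set \<Rightarrow> ('v set \<Rightarrow> real) \<Rightarrow> ('v set \<Rightarrow> real)" where
  "generator E f A = (\<Sum>e\<in>E. f (switch e A) - f A)"

text \<open>The transition kernel at time \<open>t\<close> of the continuous-time Markov process in which every
  edge is switched independently at rate 1 is the exponential of \<open>t\<close> times the generator,
  applied to the indicator function of the target configuration. For finite \<open>E\<close> the series
  converges, and it solves Kolmogorov's backward equation, as shown below.\<close>

definition transition_kernel :: "'v set set \<Rightarrow> real \<Rightarrow> 'v set \<Rightarrow> 'v set \<Rightarrow> real" where
  "transition_kernel E t A B = (\<Sum>n. t ^ n / fact n * (generator E ^^ n) (indicator {B}) A)"

lemma abs_generator_funpow_le:
  assumes "\<And>A. \<bar>f A\<bar> \<le> 1"
  shows "\<bar>(generator E ^^ n) f A\<bar> \<le> (2 * real (card E)) ^ n"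
proof (induction n arbitrary: A)
  case 0
  then show ?case using assms by simp
next
  case (Suc n)
  let ?g = "(generator E ^^ n) f" and ?b = "(2 * real (card E)) ^ n"
  have "\<bar>\<Sum>e\<in>E. ?g (switch e A) - ?g A\<bar> \<le> (\<Sum>e\<in>E. \<bar>?g (switch e A) - ?g A\<bar>)"
    by (rule sum_abs)
  also have "\<dots> \<le> (\<Sum>e\<in>E. 2 * ?b)"
  proof (rule sum_mono)
    fix e
    show "\<bar>?g (switch e A) - ?g A\<bar> \<le> 2 * ?b"
      using Suc[of "switch e A"] Suc[of A] by linarith
  qed
  finally have "\<bar>generator E ?g A\<bar> \<le> (\<Sum>e\<in>E. 2 * ?b)"
    by (simp only: generator_def)
  then show ?case by (simp add: mult.assoc mult.left_commute)
qed

lemma summable_transition_kernel: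
  "summable (\<lambda>n. t ^ n / fact n * (generator E ^^ n) (indicator {B}) A)"
proof (rule summable_comparison_test')
  show "summable (\<lambda>n. inverse (fact n) * (\<bar>t\<bar> * (2 * real (card E))) ^ n)"
    by (rule summable_exp)
  fix n :: nat
  have "\<bar>(generator E ^^ n) (indicator {B}) A\<bar> \<le> (2 * real (card E)) ^ n"
    by (rule abs_generator_funpow_le) (simp add: indicator_def)
  then have "\<bar>t\<bar> ^ n / fact n * \<bar>(generator E ^^ n) (indicator {B}) A\<bar>
      \<le> \<bar>t\<bar> ^ n / fact n * (2 * real (card E)) ^ n"
    by (intro mult_left_mono) auto
  then show "norm (t ^ n / fact n * (generator E ^^ n) (indicator {B}) A)
      \<le> inverse (fact n) * (\<bar>t\<bar> * (2 * real (card E))) ^ n"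
    by (simp add: abs_mult power_abs power_mult_distrib divide_simps)
qed

lemma transition_kernel_0: "transition_kernel E 0 A B = of_bool (A = B)"
proof -
  have "(\<lambda>n. (generator E ^^ n) (indicator {B}) A / fact n * 0 ^ n)
      sums ((generator E ^^ 0) (indicator {B}) A / fact 0)"
    by (rule powser_sums_zero)
  then show ?thesis
    by (auto simp: transition_kernel_def sums_iff mult.commute indicator_def)
qed

lemma transition_kernel_backward_equation:
  "((\<lambda>t. transition_kernel E t A B) has_real_derivative
     generator E (\<lambda>A'. transition_kernel E t A' B) A) (at t)"
proof -
  let ?g = "\<lambda>n. (generator E ^^ n) (indicator {B})"
  let ?c = "\<lambda>n. ?g n A / fact n"
  have "summable (\<lambda>n. ?c n * s ^ n)" for s
    using summable_transition_kernel[of s E B A] by (simp add: mult.commute)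
  then have deriv: "((\<lambda>s. \<Sum>n. ?c n * s ^ n) has_real_derivative (\<Sum>n. diffs ?c n * t ^ n)) (at t)"
    by (intro termdiffs_strong_converges_everywhere)
  have "(\<lambda>n. \<Sum>e\<in>E. t ^ n / fact n * ?g n (switch e A) - t ^ n / fact n * ?g n A)
      sums (\<Sum>e\<in>E. transition_kernel E t (switch e A) B - transition_kernel E t A B)"
    unfolding transition_kernel_def
    by (intro sums_sum sums_diff summable_sums summable_transition_kernel)
  moreover have "(\<Sum>e\<in>E. t ^ n / fact n * ?g n (switch e A) - t ^ n / fact n * ?g n A)
      = diffs ?c n * t ^ n" for n
  proof -
    have "diffs ?c n = ?g (Suc n) A / fact n"
      by (simp add: diffs_def del: of_nat_Suc)
    also have "?g (Suc n) A = (\<Sum>e\<in>E. ?g n (switch e A) - ?g n A)"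
      by (simp add: generator_def[of E "?g n" A])
    finally have "diffs ?c n * t ^ n
        = t ^ n / fact n * (\<Sum>e\<in>E. ?g n (switch e A) - ?g n A)"
      by simp
    then show ?thesis
      by (simp only: sum_distrib_left right_diff_distrib)
  qed
  ultimately have "(\<Sum>n. diffs ?c n * t ^ n) = generator E (\<lambda>A'. transition_kernel E t A' B) A"
    by (simp add: sums_iff generator_def)
  with deriv show ?thesis
    by (simp add: transition_kernel_def mult.commute)
qed

text \<open>Probability distributions on the finite set \<open>S\<close> are given by their mass functions.\<close>

definition tv_distance :: "'c set \<Rightarrow> ('c \<Rightarrow> real) \<Rightarrow> ('c \<Rightarrow> real) \<Rightarrow> real" where
  "tv_distance S \<mu> \<nu> = Max ((\<lambda>Q. sum \<mu> Q - sum \<nu> Q) ` Pow S)"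

text \<open>Extended real values are used so that the infimum of the empty set is infinite.\<close>

definition mixing_time :: "'v set \<Rightarrow> 'v set set \<Rightarrow> nat \<Rightarrow> ereal" where
  "mixing_time V E k = Inf (ereal ` {t. 0 \<le> t \<and> (\<forall>A\<in>configurations V k.
     tv_distance (configurations V k) (transition_kernel E t A)
       (pmf (pmf_of_set (configurations V k))) \<le> 1 / 4)})"

definition torus_vertices :: "nat \<Rightarrow> nat \<Rightarrow> (nat \<Rightarrow> nat) set" where
  "torus_vertices d L = {..<d} \<rightarrow>\<^sub>E {..<L}"

text \<open>For \<open>L = 2\<close> the two steps in a given direction lead to the same neighbour; as edges are
  sets, this gives one edge, so the torus is the hypercube with simple edges.\<close>

definition torus_edges :: "nat \<Rightarrow> nat \<Rightarrow> (nat \<Rightarrow> nat) set set" where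
  "torus_edges d L = {{x, x(i := (x i + 1) mod L)} | x i. x \<in> torus_vertices d L \<and> i < d}"

definition log_dim :: "nat \<Rightarrow> real" where
  "log_dim d = (if d = 1 then 1 else ln (real d))"

end

theory Submission
  imports Defs
begin

text \<open>The black balls are revealed one after the other: if \<open>Z\<close> is the set of the first \<open>j\<close> of them, the
  total variation distance is at most the sum over \<open>j\<close> of the mean distance of the law of the next
  ball given \<open>Z\<close> to the uniform law on the complement of \<open>Z\<close>. The mean of the sum of squares of
  this conditional law is denoted \<open>\<Psi>\<close>. As in Morris's chameleon process, the interchange process is
  run for a time \<open>T\<close> and then, within one unit of time, a vertex and its neighbour are matched when the
  edge between them is used before any other edge touching it. Averaging over matched pairs reveals
  nothing about \<open>Z\<close> and decreases \<open>\<Psi>\<close> by a Dirichlet form whose weights are the probabilities that two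
  particles are adjacent at time \<open>T\<close>.

  Liggett's comparison with independent walks bounds these weights by the heat kernel of the torus.
  If the kernel is at most \<open>\<eta> \<le> 1 / (4 * k)\<close>, then \<open>Z\<close> covers little of the weight and
  \<open>\<Psi>\<close> drops to order \<open>\<eta>\<close>; letting \<open>T\<close> grow geometrically up to \<open>L\<^sup>2\<close> costs \<open>O((d + log k) * L\<^sup>2)\<close> in
  total and brings \<open>\<Psi>\<close> within a factor \<open>exp (O(d))\<close> of its minimum. At times of order \<open>L\<^sup>2 * log d\<close> the
  weights are also bounded from below, because the exclusion process with two particles has spectral
  gap of at least a constant times the inverse of that time, so \<open>O(d + log k)\<close> further rounds are enough.\<close>

section \<open>The heat semigroup of a finite family of involutions\<close>

text \<open>\<open>\<Psi>\<close> starts at 1 and its minimum is of order \<open>1 / L ^ d\<close>,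
  so with rounds of length \<open>L\<^sup>2 * log d\<close> alone about \<open>d * log L\<close> of
  them would be spent; the shorter local rounds exist to remove this factor \<open>log L\<close>.
  The \<open>log d\<close> has its origin in the product structure: to bring a product of
  \<open>d\<close> cycle kernels within a factor 3/2 of uniform, each of them is brought within
  \<open>1 + 1 / (3 * d)\<close>. The \<open>log k\<close> pays for the sum over the balls, each of
  which may contribute only \<open>1 / (4 * k)\<close>.

  Switching an edge at rate 1 amounts to ringing it at rate 2 and switching with probability 1/2. If
  both ends of a ringing edge avoid \<open>Z\<close>, leaving the coin unrevealed averages the law
  of the next ball over the two ends; the whole decrease of \<open>\<Psi>\<close> comes from this. A
  conditional law depends nonlinearly on the joint law, hence does not evolve by the semigroup.
  Therefore \<open>\<Psi>\<close> is treated as a supremum of linear functionals, and the semigroup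
  is moved onto their test functions.\<close>

definition lazy_step :: "'e set \<Rightarrow> ('e \<Rightarrow> 's \<Rightarrow> 's) \<Rightarrow> ('s \<Rightarrow> real) \<Rightarrow> 's \<Rightarrow> real" where
  "lazy_step E act f s = (\<Sum>e\<in>E. f s + f (act e s)) / (2 * real (card E))"

text \<open>Uniformization: a Poisson mixture of powers of \<open>lazy_step\<close>, whose generator
  is \<open>gen\<close>. For \<open>t \<ge> 0\<close> the weights are nonnegative, so positivity and
  every inequality proved for a fixed number of updates pass to continuous time by
  summation.\<close>

definition heat :: "'e set \<Rightarrow> ('e \<Rightarrow> 's \<Rightarrow> 's) \<Rightarrow> real \<Rightarrow> ('s \<Rightarrow> real) \<Rightarrow> 's \<Rightarrow> real" where
  "heat E act t f s =
     (\<Sum>M. exp (- (2 * real (card E) * t)) * ((2 * real (card E) * t) ^ M / fact M) * (lazy_step E act ^^ M) f s)"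

definition gen :: "'e set \<Rightarrow> ('e \<Rightarrow> 's \<Rightarrow> 's) \<Rightarrow> ('s \<Rightarrow> real) \<Rightarrow> 's \<Rightarrow> real" where
  "gen E act f s = (\<Sum>e\<in>E. f (act e s) - f s)"

definition dirichlet :: "'e set \<Rightarrow> ('e \<Rightarrow> 's \<Rightarrow> 's) \<Rightarrow> 's set \<Rightarrow> ('s \<Rightarrow> real) \<Rightarrow> real" where
  "dirichlet E act S f = (\<Sum>s\<in>S. \<Sum>e\<in>E. (f (act e s) - f s)\<^sup>2) / 2"

lemma generator_eq_gen: "generator E = gen E switch"
  by (intro ext) (simp add: generator_def gen_def)

lemma poisson_sums: "(\<lambda>M. exp (- x) * (x ^ M / fact M) * c ^ M) sums exp (- x + x * c)"
  for x c :: real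
proof -
  have "(\<lambda>M. exp (- x) * ((x * c) ^ M /\<^sub>R fact M)) sums (exp (- x) * exp (x * c))"
    by (intro sums_mult exp_converges)
  then show ?thesis
    by (simp add: exp_add[symmetric] power_mult_distrib divide_inverse mult_ac)
qed

lemma le_initial_value:
  fixes f f' :: "real \<Rightarrow> real"
  assumes "\<And>x. 0 \<le> x \<Longrightarrow> (f has_real_derivative f' x) (at x)" "\<And>x. 0 \<le> x \<Longrightarrow> f' x \<le> 0" "0 \<le> t"
  shows "f t \<le> f 0"
proof (rule DERIV_nonpos_imp_nonincreasing[OF assms(3)])
  fix x assume "0 \<le> x" "x \<le> t"
  with assms(1,2)[of x] show "\<exists>y. (f has_real_derivative y) (at x) \<and> y \<le> 0" by (intro exI conjI)
qed

text \<open>Instantiated for single vertices, for configurations of a fixed size, and for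
  configurations with one marked vertex outside. Since each \<open>act e\<close> is an involution of
  \<open>S\<close>, the counting measure is reversible.\<close>

locale involutive_action =
  fixes E :: "'e set" and act :: "'e \<Rightarrow> 's \<Rightarrow> 's" and S :: "'s set"
  assumes finite_E: "finite E" and E_nonempty: "E \<noteq> {}" and finite_S: "finite S"
    and act_closed: "e \<in> E \<Longrightarrow> s \<in> S \<Longrightarrow> act e s \<in> S"
    and act_act: "e \<in> E \<Longrightarrow> s \<in> S \<Longrightarrow> act e (act e s) = s"
begin

abbreviation "B \<equiv> lazy_step E act"
abbreviation "P \<equiv> heat E act"
abbreviation "G \<equiv> gen E act"
abbreviation "Dir \<equiv> dirichlet E act S"

lemma card_E_pos: "real (card E) > 0"
  using finite_E E_nonempty by (simp add: card_gt_0_iff)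

lemma sum_act: "e \<in> E \<Longrightarrow> (\<Sum>s\<in>S. f (act e s)) = (\<Sum>s\<in>S. f s)"
  by (rule sum.reindex_bij_witness[where i = "act e" and j = "act e"])
     (auto simp: act_closed act_act)

section \<open>Positivity, linearity and convergence of the semigroup\<close>

lemma lazy_step_const: "B (\<lambda>_. c) s = c"
  using card_E_pos by (simp add: lazy_step_def)

lemma funpow_lazy_step_const: "(B ^^ M) (\<lambda>_. c) s = c"
proof (induction M arbitrary: s)
  case (Suc M)
  have "(B ^^ M) (\<lambda>_. c) = (\<lambda>_. c)" using Suc by blast
  then show ?case using lazy_step_const by simp
qed simp

lemma lazy_step_mono:
  assumes "\<And>s. s \<in> S \<Longrightarrow> f s \<le> g s" "s \<in> S"
  shows "B f s \<le> B g s"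
  unfolding lazy_step_def using assms
  by (intro divide_right_mono sum_mono add_mono) (auto simp: act_closed)

lemma funpow_lazy_step_mono:
  assumes "\<And>s. s \<in> S \<Longrightarrow> f s \<le> g s" "s \<in> S"
  shows "(B ^^ M) f s \<le> (B ^^ M) g s"
  using assms(2)
proof (induction M arbitrary: s)
  case 0 then show ?case using assms(1) by simp
next
  case (Suc M)
  then show ?case by (auto intro: lazy_step_mono)
qed

lemma funpow_lazy_step_cong:
  assumes "\<And>s. s \<in> S \<Longrightarrow> f s = g s" "s \<in> S"
  shows "(B ^^ M) f s = (B ^^ M) g s"
  using assms by (intro antisym funpow_lazy_step_mono) auto

lemma heat_cong:
  assumes "\<And>s. s \<in> S \<Longrightarrow> f s = g s" "s \<in> S"
  shows "P t f s = P t g s"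
proof -
  have "(B ^^ M) f s = (B ^^ M) g s" for M
    using assms by (intro funpow_lazy_step_cong) auto
  then show ?thesis
    unfolding heat_def by simp
qed

lemma lazy_step_sum: "B (\<lambda>s. \<Sum>i\<in>I. c i * f i s) s = (\<Sum>i\<in>I. c i * B (f i) s)"
proof -
  have "(\<Sum>e\<in>E. (\<Sum>i\<in>I. c i * f i s) + (\<Sum>i\<in>I. c i * f i (act e s)))
      = (\<Sum>i\<in>I. c i * (\<Sum>e\<in>E. f i s + f i (act e s)))"
    by (subst sum_distrib_left, subst sum.swap) (simp add: sum.distrib[symmetric] distrib_left)
  then show ?thesis
    by (simp add: lazy_step_def) (simp add: sum_divide_distrib[symmetric] del: times_divide_eq_right add: times_divide_eq_right[symmetric] sum_distrib_left)
qed

lemma funpow_lazy_step_sum: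
  "(B ^^ M) (\<lambda>s. \<Sum>i\<in>I. c i * f i s) s = (\<Sum>i\<in>I. c i * (B ^^ M) (f i) s)"
proof (induction M arbitrary: s)
  case (Suc M)
  have "(B ^^ M) (\<lambda>s. \<Sum>i\<in>I. c i * f i s) = (\<lambda>s. \<Sum>i\<in>I. c i * (B ^^ M) (f i) s)"
    using Suc by blast
  then show ?case by (simp add: lazy_step_sum)
qed simp

lemma bounded_on_S: obtains c where "\<And>s. s \<in> S \<Longrightarrow> \<bar>f s\<bar> \<le> (c::real)" "c \<ge> 0"
proof (rule that[of "\<Sum>s\<in>S. \<bar>f s\<bar>"])
  show "\<bar>f s\<bar> \<le> (\<Sum>s\<in>S. \<bar>f s\<bar>)" if "s \<in> S" for s
    using that finite_S by (intro member_le_sum) auto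
qed (simp add: sum_nonneg)

lemma funpow_lazy_step_bound:
  assumes "\<And>s. s \<in> S \<Longrightarrow> \<bar>f s\<bar> \<le> c" "s \<in> S"
  shows "\<bar>(B ^^ M) f s\<bar> \<le> c"
proof -
  have "(B ^^ M) f s \<le> (B ^^ M) (\<lambda>_. c) s" "(B ^^ M) (\<lambda>_. - c) s \<le> (B ^^ M) f s"
    using assms by (auto intro!: funpow_lazy_step_mono simp: abs_le_iff minus_le_iff)
  then show ?thesis by (simp add: funpow_lazy_step_const abs_le_iff)
qed

lemma summable_lazy_step_exp:
  fixes x :: real
  assumes "s \<in> S"
  shows "summable (\<lambda>M. x ^ M / fact M * (B ^^ M) f s)"
proof -
  obtain c where c: "\<And>s. s \<in> S \<Longrightarrow> \<bar>f s\<bar> \<le> c" "c \<ge> 0"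
    using bounded_on_S by blast
  show ?thesis
  proof (rule summable_comparison_test')
    show "summable (\<lambda>M. inverse (fact M) * \<bar>x\<bar> ^ M * c)"
      by (intro summable_mult2 summable_exp)
    show "norm (x ^ M / fact M * (B ^^ M) f s) \<le> inverse (fact M) * \<bar>x\<bar> ^ M * c" for M
    proof -
      have "\<bar>x\<bar> ^ M / fact M * \<bar>(B ^^ M) f s\<bar> \<le> \<bar>x\<bar> ^ M / fact M * c"
        using funpow_lazy_step_bound[of f c s M] c assms by (intro mult_left_mono) auto
      then show ?thesis
        by (simp add: abs_mult power_abs divide_inverse mult_ac)
    qed
  qed
qed

lemma summable_heat:
  fixes x :: real
  assumes "s \<in> S"
  shows "summable (\<lambda>M. exp (- x) * (x ^ M / fact M) * (B ^^ M) f s)"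
  using summable_mult[OF summable_lazy_step_exp[OF assms, of x f], of "exp (-x)"]
  by (simp add: mult.assoc)

lemma heat_0 [simp]: "P 0 f s = f s"
proof -
  have "(\<lambda>M. (B ^^ M) f s / fact M * 0 ^ M) sums ((B ^^ 0) f s / fact 0)"
    by (rule powser_sums_zero)
  then show ?thesis
    by (auto simp: heat_def sums_iff mult.commute)
qed

lemma heat_const [simp]: "P t (\<lambda>_. c) s = c"
proof -
  have "(\<lambda>M. exp (- (2 * real (card E) * t)) * ((2 * real (card E) * t) ^ M / fact M) * 1 ^ M * c) sums (1 * c)"
    using poisson_sums[of "2 * real (card E) * t" 1] by (intro sums_mult2) simp
  then show ?thesis
    by (simp add: heat_def funpow_lazy_step_const sums_iff)
qed

lemma heat_mono:
  assumes "\<And>s. s \<in> S \<Longrightarrow> f s \<le> g s" "s \<in> S" "t \<ge> 0"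
  shows "P t f s \<le> P t g s"
  unfolding heat_def using assms
  by (intro suminf_le mult_left_mono funpow_lazy_step_mono summable_heat) auto

lemma heat_nonneg:
  assumes "\<And>s. s \<in> S \<Longrightarrow> 0 \<le> f s" "s \<in> S" "t \<ge> 0"
  shows "0 \<le> P t f s"
  using heat_mono[of "\<lambda>_. 0" f s t] assms by simp

lemma heat_sum:
  assumes "s \<in> S"
  shows "P t (\<lambda>s. \<Sum>i\<in>I. c i * f i s) s = (\<Sum>i\<in>I. c i * P t (f i) s)"
proof -
  let ?x = "2 * real (card E) * t"
  let ?w = "\<lambda>M. exp (- ?x) * (?x ^ M / fact M)"
  have "(\<lambda>M. \<Sum>i\<in>I. c i * ((?w M) * (B ^^ M) (f i) s))
      sums (\<Sum>i\<in>I. c i * P t (f i) s)"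
    unfolding heat_def by (intro sums_sum sums_mult summable_sums summable_heat assms)
  moreover have "(\<Sum>i\<in>I. c i * ((?w M) * (B ^^ M) (f i) s))
      = (?w M) * (B ^^ M) (\<lambda>s. \<Sum>i\<in>I. c i * f i s) s" for M
    unfolding funpow_lazy_step_sum sum_distrib_left by (intro sum.cong) auto
  ultimately show ?thesis
    by (simp add: heat_def sums_iff)
qed

lemma heat_diff:
  assumes "s \<in> S"
  shows "P t (\<lambda>s. f s - g s) s = P t f s - P t g s"
  using heat_sum[OF assms, of t "\<lambda>b. if b then 1 else -1" "\<lambda>b. if b then f else g" "{True, False}"]
  by simp

lemma heat_cmult:
  assumes "s \<in> S"
  shows "P t (\<lambda>s. c * f s) s = c * P t f s"
  using heat_sum[OF assms, of t "\<lambda>_. c" "\<lambda>_. f" "{()}"] by simp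

lemma gen_lazy_step: "G f s = 2 * real (card E) * (B f s - f s)"
  using card_E_pos by (simp add: gen_def lazy_step_def sum.distrib sum_subtractf field_simps)

text \<open>Factoring out \<open>exp (- (l * t))\<close> leaves an everywhere convergent power
  series in \<open>t\<close>. Its termwise derivative applies one more lazy step, and the product
  rule then gives \<open>l * (B - 1)\<close>, which is the generator.\<close>

lemma heat_has_derivative:
  assumes "s \<in> S"
  shows "((\<lambda>t. P t f s) has_real_derivative G (P t f) s) (at t)"
proof -
  define l where "l = 2 * real (card E)"
  let ?T = "\<lambda>M s. l ^ M / fact M * (B ^^ M) f s * t ^ M"
  let ?a = "\<lambda>M. l ^ M / fact M * (B ^^ M) f s"
  have summ: "summable (\<lambda>M. (x * l) ^ M / fact M * (B ^^ M) f s')" if "s' \<in> S" for x s'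
    using summable_lazy_step_exp[OF that] .
  have P_eq: "P t f s' = exp (- (l * t)) * (\<Sum>M. l ^ M / fact M * (B ^^ M) f s' * t ^ M)"
    if "s' \<in> S" for t s'
    unfolding heat_def l_def[symmetric]
    using summ[OF that, of t] 
    by (subst suminf_mult[symmetric]) (simp_all add: power_mult_distrib mult_ac)
  have "summable (\<lambda>M. ?a M * x ^ M)" for x
    using summ[OF assms, of x] by (simp add: power_mult_distrib mult_ac)
  then have d: "((\<lambda>t. \<Sum>M. ?a M * t ^ M) has_real_derivative (\<Sum>M. diffs ?a M * t ^ M)) (at t)"
    by (intro termdiffs_strong_converges_everywhere)
  have "diffs ?a M * t ^ M = l * (l ^ M / fact M * (B ^^ Suc M) f s * t ^ M)" for M
    by (simp add: diffs_def del: of_nat_Suc)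
  moreover have "(\<lambda>M. l ^ M / fact M * (B ^^ Suc M) f s * t ^ M) sums (exp (l * t) * B (P t f) s)"
  proof -
    have "(\<lambda>M. \<Sum>e\<in>E. (?T M s) + (?T M (act e s)))
      sums (\<Sum>e\<in>E. (\<Sum>M. (?T M s)) + (\<Sum>M. (?T M (act e s))))"
      using summ[OF assms, of t] summ[OF act_closed[OF _ assms], of _ t]
      by (intro sums_sum sums_add summable_sums) (simp_all add: power_mult_distrib mult_ac)
    also have "(\<Sum>e\<in>E. (\<Sum>M. (?T M s)) + (\<Sum>M. (?T M (act e s))))
      = (\<Sum>e\<in>E. exp (l * t) * (P t f s + P t f (act e s)))"
      using assms act_closed[OF _ assms]
      by (intro sum.cong refl) (simp add: P_eq distrib_left mult.assoc[symmetric] exp_add[symmetric])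
    finally have "(\<lambda>M. (\<Sum>e\<in>E. (?T M s) + (?T M (act e s))) / l)
        sums ((\<Sum>e\<in>E. exp (l * t) * (P t f s + P t f (act e s))) / l)"
      by (rule sums_divide)
    moreover have "(\<Sum>e\<in>E. (?T M s) + (?T M (act e s))) / l
       = l ^ M / fact M * (B ^^ Suc M) f s * t ^ M" for M
    proof -
      have "(\<Sum>e\<in>E. (?T M s) + (?T M (act e s)))
         = l ^ M / fact M * t ^ M * (\<Sum>e\<in>E. (B ^^ M) f s + (B ^^ M) f (act e s))"
        unfolding sum_distrib_left by (intro sum.cong) (auto simp: algebra_simps)
      then show ?thesis
        by (simp add: lazy_step_def[of E act "(B ^^ M) f"] l_def[symmetric])
    qed
    moreover have "(\<Sum>e\<in>E. exp (l * t) * (P t f s + P t f (act e s))) / l = exp (l * t) * B (P t f) s"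
      by (simp add: lazy_step_def[of E act "P t f"] l_def[symmetric] sum_distrib_left)
    ultimately show ?thesis by simp
  qed
  ultimately have "(\<Sum>M. diffs ?a M * t ^ M) = l * (exp (l * t) * B (P t f) s)"
    using sums_mult[of _ _ l] by (simp only: sums_iff)
  with d have d': "((\<lambda>t. \<Sum>M. ?a M * t ^ M) has_real_derivative l * (exp (l * t) * B (P t f) s)) (at t)"
    by simp
  have "((\<lambda>t. exp (- (l * t)) * (\<Sum>M. ?a M * t ^ M)) has_real_derivative
     (- l * exp (- (l * t))) * (\<Sum>M. ?a M * t ^ M) + (l * (exp (l * t) * B (P t f) s)) * exp (- (l * t))) (at t)"
    by (rule DERIV_mult[OF _ d']) (auto intro!: derivative_eq_intros)
  moreover have "(- l * exp (- (l * t))) * (\<Sum>M. ?a M * t ^ M) + (l * (exp (l * t) * B (P t f) s)) * exp (- (l * t))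
      = G (P t f) s"
    unfolding gen_lazy_step l_def[symmetric] P_eq[OF assms, of t]
    by (simp add: algebra_simps exp_minus)
  ultimately show ?thesis
    by (simp add: P_eq[OF assms])
qed

section \<open>Summation by parts, comparison and uniqueness\<close>

lemma sum_mult_gen:
  "(\<Sum>s\<in>S. f s * G g s) = - (\<Sum>s\<in>S. \<Sum>e\<in>E. (f (act e s) - f s) * (g (act e s) - g s)) / 2"
proof -
  have "(\<Sum>s\<in>S. f (act e s) * g s) = (\<Sum>s\<in>S. f s * g (act e s))" if "e \<in> E" for e
    using sum_act[OF that, of "\<lambda>s. f s * g (act e s)"] that by (simp add: act_act)
  moreover have "(\<Sum>s\<in>S. f (act e s) * g (act e s)) = (\<Sum>s\<in>S. f s * g s)" if "e \<in> E" for e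
    using sum_act[OF that, of "\<lambda>s. f s * g s"] .
  ultimately have *: "(\<Sum>s\<in>S. (f (act e s) - f s) * (g (act e s) - g s)) = - 2 * (\<Sum>s\<in>S. f s * (g (act e s) - g s))"
    if "e \<in> E" for e
    using that by (simp add: algebra_simps sum.distrib sum_subtractf)
  have "(\<Sum>s\<in>S. \<Sum>e\<in>E. (f (act e s) - f s) * (g (act e s) - g s))
     = (\<Sum>e\<in>E. - 2 * (\<Sum>s\<in>S. f s * (g (act e s) - g s)))"
    by (subst sum.swap) (intro sum.cong refl *)
  also have "\<dots> = - 2 * (\<Sum>s\<in>S. f s * G g s)"
    by (subst sum_distrib_left[symmetric], subst sum.swap) (simp add: gen_def sum_distrib_left)
  finally show ?thesis by simp
qed

lemma sum_mult_gen_self: "(\<Sum>s\<in>S. f s * G f s) = - Dir f"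
  by (simp add: sum_mult_gen dirichlet_def power2_eq_square)

text \<open>The energy of the negative part cannot grow, since \<open>min x 0\<close> is nondecreasing in \<open>x\<close>.\<close>

lemma maximum_principle:
  assumes der: "\<And>t s. t \<ge> 0 \<Longrightarrow> s \<in> S \<Longrightarrow> ((\<lambda>t. z t s) has_real_derivative z' t s) (at t)"
    and super: "\<And>t s. t \<ge> 0 \<Longrightarrow> s \<in> S \<Longrightarrow> G (z t) s \<le> z' t s"
    and init: "\<And>s. s \<in> S \<Longrightarrow> 0 \<le> z 0 s"
    and "t \<ge> 0" "s \<in> S"
  shows "0 \<le> z t s"
proof -
  define m :: "real \<Rightarrow> real" where "m x = min x 0" for x
  \<comment> \<open>The energy uses the square because \<open>min x 0\<close> itself has no
    derivative at 0, while its square does.\<close>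
  have dm: "((\<lambda>x. (m x)\<^sup>2) has_real_derivative 2 * m x) (at x)" for x
  proof -
    consider "x < 0" | "x > 0" | "x = 0" by linarith
    then show ?thesis
    proof cases
      case 1
      have "((\<lambda>x. x\<^sup>2) has_real_derivative 2 * m x) (at x)"
        using 1 by (auto intro!: derivative_eq_intros simp: m_def)
      then show ?thesis
        by (rule has_field_derivative_transform_within_open[of _ _ _ "{..<0}"]) (use 1 in \<open>auto simp: m_def\<close>)
    next
      case 2
      have "((\<lambda>x. 0) has_real_derivative 2 * m x) (at x)"
        using 2 by (auto intro!: derivative_eq_intros simp: m_def)
      then show ?thesis
        by (rule has_field_derivative_transform_within_open[of _ _ _ "{0<..}"]) (use 2 in \<open>auto simp: m_def\<close>)
    next
      case 3
      have "((\<lambda>h. (m (0 + h))\<^sup>2 / h) \<longlongrightarrow> 0) (at 0)"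
      proof (rule Lim_null_comparison)
        show "\<forall>\<^sub>F h in at 0. norm ((m (0 + h))\<^sup>2 / h) \<le> \<bar>h\<bar>"
        proof (intro always_eventually allI)
          show "norm ((m (0 + h))\<^sup>2 / h) \<le> \<bar>h\<bar>" for h
            unfolding m_def by (cases "h \<le> 0") (auto simp: power2_eq_square abs_mult)
        qed
        show "((\<lambda>h::real. \<bar>h\<bar>) \<longlongrightarrow> 0) (at 0)"
          using tendsto_rabs[OF tendsto_ident_at, of "0::real" UNIV] by simp
      qed
      then show ?thesis
        unfolding 3 DERIV_def by (simp add: m_def)
    qed
  qed
  define y where "y t = (\<Sum>s\<in>S. (m (z t s))\<^sup>2)" for t
  have dy: "(y has_real_derivative (\<Sum>s\<in>S. 2 * m (z t s) * z' t s)) (at t)" if "t \<ge> 0" for t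
    unfolding y_def[abs_def]
  proof (rule DERIV_sum)
    show "((\<lambda>t. (m (z t s))\<^sup>2) has_real_derivative 2 * m (z t s) * z' t s) (at t)" if "s \<in> S" for s
      using DERIV_chain2[OF dm der[OF \<open>t \<ge> 0\<close> that]] .
  qed
  have dy_le: "(\<Sum>s\<in>S. 2 * m (z t s) * z' t s) \<le> 0" if "t \<ge> 0" for t
  proof -
    have "(\<Sum>s\<in>S. 2 * m (z t s) * z' t s) \<le> (\<Sum>s\<in>S. 2 * (m (z t s) * G (z t) s))"
    proof (rule sum_mono)
      fix s assume "s \<in> S"
      then have "m (z t s) * z' t s \<le> m (z t s) * G (z t) s"
        using super[OF that] by (intro mult_left_mono_neg) (auto simp: m_def)
      then show "2 * m (z t s) * z' t s \<le> 2 * (m (z t s) * G (z t) s)" by simp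
    qed
    also have "\<dots> = - (\<Sum>s\<in>S. \<Sum>e\<in>E. (m (z t (act e s)) - m (z t s)) * (z t (act e s) - z t s))"
      using sum_mult_gen[of "\<lambda>s. m (z t s)" "z t"] by (simp add: sum_distrib_left[symmetric])
    also have "\<dots> \<le> 0"
    proof -
      have "0 \<le> (m a - m b) * (a - b)" for a b
        unfolding m_def
        by (cases "a \<le> b"; cases "a \<le> 0"; cases "b \<le> 0")
           (auto simp: mult_nonneg_nonneg mult_nonpos_nonpos mult_nonpos_nonneg)
      then show ?thesis by (simp add: sum_nonneg)
    qed
    finally show ?thesis .
  qed
  have "y t \<le> y 0"
    by (rule le_initial_value[OF dy dy_le \<open>t \<ge> 0\<close>])
  also have "y 0 = 0"
    using init by (simp add: y_def m_def)
  finally have "(m (z t s))\<^sup>2 \<le> 0"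
    using member_le_sum[of s S "\<lambda>s. (m (z t s))\<^sup>2"] finite_S assms(5) unfolding y_def
    by (meson order_trans zero_le_power2)
  then show ?thesis by (simp add: m_def)
qed

lemma heat_le_supersolution:
  assumes "\<And>t s. t \<ge> 0 \<Longrightarrow> s \<in> S \<Longrightarrow> ((\<lambda>t. v t s) has_real_derivative v' t s) (at t)"
    and "\<And>t s. t \<ge> 0 \<Longrightarrow> s \<in> S \<Longrightarrow> G (v t) s \<le> v' t s"
    and "\<And>s. s \<in> S \<Longrightarrow> f s \<le> v 0 s"
    and "t \<ge> 0" "s \<in> S"
  shows "P t f s \<le> v t s"
proof -
  have "0 \<le> v t s - P t f s"
  proof (rule maximum_principle[where z = "\<lambda>t s. v t s - P t f s" and z' = "\<lambda>t s. v' t s - G (P t f) s"])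
    show "G (\<lambda>s. v t s - P t f s) s \<le> v' t s - G (P t f) s" if "t \<ge> 0" "s \<in> S" for t s
      using assms(2)[OF that] by (simp add: gen_def sum_subtractf sum.distrib algebra_simps)
  qed (use assms in \<open>auto intro!: DERIV_diff heat_has_derivative\<close>)
  then show ?thesis by simp
qed

text \<open>The means by which an explicit family is recognised as a heat flow: the semigroup law,
  the projections of the marked process, the given transition kernel and the product formula on the
  torus all follow from it.\<close>

lemma heat_unique:
  assumes "\<And>t s. t \<ge> 0 \<Longrightarrow> s \<in> S \<Longrightarrow> ((\<lambda>t. v t s) has_real_derivative G (v t) s) (at t)"
    and "t \<ge> 0" "s \<in> S"
  shows "v t s = P t (v 0) s"
proof (rule antisym)
  show "P t (v 0) s \<le> v t s"
    using assms by (intro heat_le_supersolution[where v' = "\<lambda>t. G (v t)"]) auto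
  have "G (\<lambda>s. - v t s) s = - G (v t) s" for t s
    by (simp add: gen_def sum_subtractf)
  then have "P t (\<lambda>s. - v 0 s) s \<le> - v t s"
    using assms
    by (intro heat_le_supersolution[where v' = "\<lambda>t s. - G (v t) s" and v = "\<lambda>t s. - v t s"])
       (auto intro!: derivative_eq_intros)
  moreover have "P t (\<lambda>s. - v 0 s) s = - P t (v 0) s"
    using heat_cmult[OF assms(3), of t "-1" "v 0"] by simp
  ultimately show "v t s \<le> P t (v 0) s" by simp
qed

lemma heat_heat:
  assumes "t \<ge> 0" "s \<in> S"
  shows "P t (P r f) s = P (t + r) f s"
proof -
  have "((\<lambda>t. P (t + r) f s) has_real_derivative G (P (t + r) f) s) (at t)" if "s \<in> S" for t s
    using heat_has_derivative[OF that, of f "t + r"] by (simp add: DERIV_shift)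
  from heat_unique[of "\<lambda>t. P (t + r) f", OF this] assms show ?thesis by simp
qed

section \<open>Reversibility\<close>

lemma sum_mult_lazy_step: "(\<Sum>s\<in>S. f s * B g s) = (\<Sum>s\<in>S. B f s * g s)"
proof -
  have *: "B h s = h s + G h s / (2 * real (card E))" for h s
    using card_E_pos by (simp add: gen_lazy_step)
  have "(\<Sum>s\<in>S. f s * G g s) = (\<Sum>s\<in>S. g s * G f s)"
    by (simp add: sum_mult_gen mult.commute)
  then show ?thesis
    by (simp add: * algebra_simps sum.distrib sum_divide_distrib[symmetric])
qed

lemma sum_mult_funpow_lazy_step: "(\<Sum>s\<in>S. f s * (B ^^ M) g s) = (\<Sum>s\<in>S. (B ^^ M) f s * g s)"
proof (induction M arbitrary: f)
  case (Suc M)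
  have "(\<Sum>s\<in>S. f s * (B ^^ Suc M) g s) = (\<Sum>s\<in>S. (B ^^ M) (B f) s * g s)"
    by (simp add: sum_mult_lazy_step Suc)
  then show ?case by (simp add: funpow_swap1)
qed simp

lemma sum_mult_heat: "(\<Sum>s\<in>S. f s * P t g s) = (\<Sum>s\<in>S. P t f s * g s)"
proof -
  let ?x = "2 * real (card E) * t"
  let ?w = "\<lambda>M. exp (- ?x) * (?x ^ M / fact M)"
  have 1: "(\<lambda>M. \<Sum>s\<in>S. f s * ((?w M) * (B ^^ M) g s)) sums (\<Sum>s\<in>S. f s * P t g s)"
    unfolding heat_def by (intro sums_sum sums_mult summable_sums summable_heat)
  have 2: "(\<lambda>M. \<Sum>s\<in>S. ((?w M) * (B ^^ M) f s) * g s) sums (\<Sum>s\<in>S. P t f s * g s)"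
    unfolding heat_def by (intro sums_sum sums_mult2 summable_sums summable_heat)
  have "(\<Sum>s\<in>S. f s * ((?w M) * (B ^^ M) g s))
      = (\<Sum>s\<in>S. ((?w M) * (B ^^ M) f s) * g s)" for M
  proof -
    have "(\<Sum>s\<in>S. f s * ((?w M) * (B ^^ M) g s))
       = (?w M) * (\<Sum>s\<in>S. f s * (B ^^ M) g s)"
      unfolding sum_distrib_left by (intro sum.cong) auto
    also have "\<dots> = (\<Sum>s\<in>S. ((?w M) * (B ^^ M) f s) * g s)"
      unfolding sum_mult_funpow_lazy_step sum_distrib_left by (intro sum.cong) auto
    finally show ?thesis .
  qed
  with 1 2 show ?thesis by (auto dest: sums_unique2)
qed

lemma sum_heat: "(\<Sum>s\<in>S. P t f s) = (\<Sum>s\<in>S. f s)"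
  using sum_mult_heat[of "\<lambda>_. 1" t f] by simp

lemma heat_indicator_sym:
  assumes "r \<in> S" "s \<in> S"
  shows "P t (indicator {r}) s = P t (indicator {s}) r"
  using sum_mult_heat[of "indicator {r}" t "indicator {s}"] assms finite_S
  by (simp add: indicator_def sum.delta if_distrib[of "\<lambda>x. x * _"] if_distrib[of "\<lambda>x. _ * x"] cong: if_cong)

lemma heat_eq_sum_indicator:
  assumes "s \<in> S"
  shows "P t f s = (\<Sum>r\<in>S. f r * P t (indicator {r}) s)"
proof -
  have "P t f s = P t (\<lambda>s. \<Sum>r\<in>S. f r * indicator {r} s) s"
    using assms finite_S by (intro heat_cong) (auto simp: indicator_def sum.delta if_distrib cong: if_cong)
  then show ?thesis by (simp add: heat_sum[OF assms])
qed

section \<open>Decay of the norm and of the energy\<close>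

lemma norm_has_derivative:
  "((\<lambda>t. \<Sum>s\<in>S. (P t f s)\<^sup>2) has_real_derivative - 2 * Dir (P t f)) (at t)"
proof -
  have "((\<lambda>t. \<Sum>s\<in>S. (P t f s)\<^sup>2) has_real_derivative (\<Sum>s\<in>S. 2 * (P t f s * G (P t f) s))) (at t)"
  proof (rule DERIV_sum)
    show "((\<lambda>t. (P t f s)\<^sup>2) has_real_derivative 2 * (P t f s * G (P t f) s)) (at t)" if "s \<in> S" for s
      using DERIV_mult[OF heat_has_derivative[OF that, of f t] heat_has_derivative[OF that, of f t]]
      by (simp add: power2_eq_square mult.commute)
  qed
  then show ?thesis
    by (simp add: sum_distrib_left[symmetric] sum_mult_gen_self)
qed

text \<open>By summation by parts, the derivative of the energy is minus twice the squared norm of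
  the generator applied to the flow.\<close>

lemma dirichlet_heat_le:
  assumes "t \<ge> 0"
  shows "Dir (P t f) \<le> Dir f"
proof -
  have "((\<lambda>t. Dir (P t f)) has_real_derivative
      - 2 * (\<Sum>s\<in>S. (G (P t f) s)\<^sup>2)) (at t)" for t
  proof -
    have "((\<lambda>t. \<Sum>s\<in>S. \<Sum>e\<in>E. (P t f (act e s) - P t f s)\<^sup>2) has_real_derivative
      (\<Sum>s\<in>S. \<Sum>e\<in>E. 2 * ((P t f (act e s) - P t f s) * (G (P t f) (act e s) - G (P t f) s)))) (at t)"
    proof (intro DERIV_sum)
      fix s e assume "s \<in> S" "e \<in> E"
      then have "((\<lambda>t. P t f (act e s) - P t f s) has_real_derivative G (P t f) (act e s) - G (P t f) s) (at t)"
        by (intro DERIV_diff heat_has_derivative act_closed)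
      from DERIV_mult[OF this this]
      show "((\<lambda>t. (P t f (act e s) - P t f s)\<^sup>2) has_real_derivative
          2 * ((P t f (act e s) - P t f s) * (G (P t f) (act e s) - G (P t f) s))) (at t)"
        by (simp add: power2_eq_square mult.commute)
    qed
    from DERIV_cdivide[OF this, of 2] show ?thesis
      using sum_mult_gen[of "G (P t f)" "P t f"]
      by (simp add: dirichlet_def sum_distrib_left[symmetric] power2_eq_square mult.commute)
  qed
  moreover have "- 2 * (\<Sum>s\<in>S. (G (P t f) s)\<^sup>2) \<le> 0" for t
    by (simp add: sum_nonneg)
  ultimately have "Dir (P t f) \<le> Dir (P 0 f)"
    by (intro le_initial_value[OF _ _ assms])
  also have "P 0 f = f" by (intro ext) simp
  finally show ?thesis .
qed

text \<open>The norm is lost at rate twice the current energy, which never exceeds the initial one.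
  This converts knowledge of the kernel at a single time into a Poincare inequality.\<close>

lemma norm_diff_heat_le:
  assumes "t \<ge> 0"
  shows "(\<Sum>s\<in>S. (f s)\<^sup>2) - (\<Sum>s\<in>S. (P t f s)\<^sup>2) \<le> 2 * t * Dir f"
proof -
  let ?y = "\<lambda>t. (\<Sum>s\<in>S. (P t f s)\<^sup>2) + 2 * t * Dir f"
  have der: "(?y has_real_derivative - 2 * Dir (P t f) + 2 * Dir f) (at t)" for t
    by (rule DERIV_add[OF norm_has_derivative]) (auto intro!: derivative_eq_intros)
  have "?y 0 \<le> ?y t"
  proof (rule DERIV_nonneg_imp_nondecreasing[OF assms])
    fix x :: real assume "0 \<le> x"
    then have "- 2 * Dir (P x f) + 2 * Dir f \<ge> 0"
      using dirichlet_heat_le[of x f] by simp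
    with der[of x] show "\<exists>y. (?y has_real_derivative y) (at x) \<and> 0 \<le> y" by blast
  qed
  then show ?thesis by simp
qed

text \<open>Gronwall: the flow keeps the sum zero, so the Poincare inequality applies at every time
  and \<open>exp (2 * t / c)\<close> times the squared norm is nonincreasing.\<close>

lemma norm_heat_le:
  assumes poincare: "\<And>f. (\<Sum>s\<in>S. f s) = 0 \<Longrightarrow> (\<Sum>s\<in>S. (f s)\<^sup>2) \<le> c * Dir f"
    and "(\<Sum>s\<in>S. f s) = 0" "c > 0" "t \<ge> 0"
  shows "(\<Sum>s\<in>S. (P t f s)\<^sup>2) \<le> exp (- 2 * t / c) * (\<Sum>s\<in>S. (f s)\<^sup>2)"
proof -
  let ?N = "\<lambda>t. (\<Sum>s\<in>S. (P t f s)\<^sup>2)"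
  let ?y = "\<lambda>t. exp (2 * t / c) * (?N t)"
  have "(?y has_real_derivative (2 / c * exp (2 * t / c)) * (?N t)
      + (- 2 * Dir (P t f)) * exp (2 * t / c)) (at t)" for t
    by (rule DERIV_mult[OF _ norm_has_derivative]) (use assms in \<open>auto intro!: derivative_eq_intros\<close>)
  moreover have "(2 / c * exp (2 * t / c)) * (?N t)
      + (- 2 * Dir (P t f)) * exp (2 * t / c) \<le> 0" for t
  proof -
    have "(?N t) / c \<le> Dir (P t f)"
      using poincare[of "P t f"] assms by (simp add: sum_heat field_simps)
    then have "exp (2 * t / c) * ((?N t) / c) \<le> exp (2 * t / c) * Dir (P t f)"
      by (intro mult_left_mono) auto
    then show ?thesis by (simp add: algebra_simps)
  qed
  ultimately have "?y t \<le> ?y 0"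
    by (rule le_initial_value[OF _ _ assms(4)])
  then have "exp (- 2 * t / c) * ?y t \<le> exp (- 2 * t / c) * (\<Sum>s\<in>S. (f s)\<^sup>2)"
    by (intro mult_left_mono) auto
  then show ?thesis
    by (simp add: mult.assoc[symmetric] exp_add[symmetric])
qed

end

section \<open>Regular graphs and a bound for two particles\<close>

text \<open>The transposition belonging to an edge; as edges are sets, it is described without
  ordering the two ends.\<close>

definition flip :: "'v set \<Rightarrow> 'v \<Rightarrow> 'v" where
  "flip e x = (if x \<in> e then (THE y. y \<in> e \<and> y \<noteq> x) else x)"

lemma flip_pair:
  assumes "u \<noteq> v"
  shows "flip {u, v} = Transposition.transpose u v"
proof
  fix x
  have "(THE y. y \<in> {u, v} \<and> y \<noteq> u) = v" "(THE y. y \<in> {u, v} \<and> y \<noteq> v) = u"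
    using assms by auto
  then show "flip {u, v} x = Transposition.transpose u v x"
    by (auto simp: flip_def Transposition.transpose_def)
qed

lemma switch_eq_flip:
  assumes "card e = 2"
  shows "switch e A = flip e ` A"
  using assms by (auto simp: card_2_iff switch_eq_transpose flip_pair)

lemma flip_flip: "card e = 2 \<Longrightarrow> flip e (flip e x) = x"
  by (auto simp: card_2_iff flip_pair)

lemma inj_flip: "card e = 2 \<Longrightarrow> inj (flip e)"
  by (metis flip_flip injI)

lemma flip_notin: "x \<notin> e \<Longrightarrow> flip e x = x"
  by (simp add: flip_def)

lemma flip_in: "card e = 2 \<Longrightarrow> x \<in> e \<Longrightarrow> flip e x \<in> e \<and> flip e x \<noteq> x \<and> e = {x, flip e x}"
  by (auto simp: card_2_iff flip_pair doubleton_eq_iff)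

text \<open>The first component holds the \<open>j\<close> balls revealed so far, as an unordered
  set; the second is the position of the next ball.\<close>

definition marked_configurations :: "'v set \<Rightarrow> nat \<Rightarrow> ('v set \<times> 'v) set" where
  "marked_configurations V j = Sigma (configurations V j) (\<lambda>Z. V - Z)"

definition marked_switch :: "'v set \<Rightarrow> 'v set \<times> 'v \<Rightarrow> 'v set \<times> 'v" where
  "marked_switch e s = (switch e (fst s), flip e (snd s))"

lemma sum_squared_deviation:
  fixes f :: "'a \<Rightarrow> real"
  assumes "finite N" "N \<noteq> {}"
  shows "(\<Sum>y\<in>N. (f y - (\<Sum>y\<in>N. f y) / real (card N))\<^sup>2)
    = (\<Sum>y\<in>N. \<Sum>y'\<in>N. (f y - f y')\<^sup>2) / (2 * real (card N))"
proof -
  let ?n = "real (card N)" and ?s = "\<Sum>y\<in>N. f y" and ?q = "\<Sum>y\<in>N. (f y)\<^sup>2"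
  have n: "?n > 0" using assms by (simp add: card_gt_0_iff)
  have "(\<Sum>y\<in>N. (f y - ?s / ?n)\<^sup>2) = ?q - 2 * (?s / ?n) * ?s + ?n * (?s / ?n)\<^sup>2"
    by (simp add: power2_diff sum.distrib sum_subtractf sum_distrib_left[symmetric] sum_distrib_right[symmetric]
        sum_divide_distrib[symmetric] mult_ac)
  moreover have "(\<Sum>y\<in>N. \<Sum>y'\<in>N. (f y - f y')\<^sup>2) = 2 * ?n * ?q - 2 * ?s * ?s"
    by (simp add: power2_diff sum.distrib sum_subtractf sum_distrib_left[symmetric] sum_distrib_right[symmetric]
        mult.assoc)
  ultimately show ?thesis
    using n by (simp add: field_simps power2_eq_square)
qed

locale regular_graph =
  fixes V :: "'v set" and E :: "'v set set" and D :: nat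
  assumes finite_V: "finite V" and V_nonempty: "V \<noteq> {}"
    and edges: "e \<in> E \<Longrightarrow> e \<subseteq> V \<and> card e = 2"
    and degree: "x \<in> V \<Longrightarrow> card {e \<in> E. x \<in> e} = D"
    and degree_pos: "D \<ge> 1"
begin

abbreviation "n \<equiv> real (card V)"
abbreviation "\<C> \<equiv> configurations V"
abbreviation "\<M> \<equiv> marked_configurations V"

lemma n_pos: "n > 0"
  using finite_V V_nonempty by (simp add: card_gt_0_iff)

lemma card_edge: "e \<in> E \<Longrightarrow> card e = 2"
  using edges by blast

lemma finite_edges: "finite E"
proof (rule finite_subset)
  show "E \<subseteq> Pow V" using edges by blast
qed (simp add: finite_V)

lemma edges_nonempty: "E \<noteq> {}"
  using V_nonempty degree degree_pos by (metis (no_types, lifting) Collect_empty_eq card.empty ex_in_conv not_one_le_zero)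

lemma flip_closed: "e \<in> E \<Longrightarrow> x \<in> V \<Longrightarrow> flip e x \<in> V"
  using flip_in[of e x] flip_notin[of x e] edges[of e] by (cases "x \<in> e") auto

lemma switch_image: "e \<in> E \<Longrightarrow> switch e A = flip e ` A"
  by (simp add: switch_eq_flip card_edge)

lemma switch_mem_configurations: "e \<in> E \<Longrightarrow> A \<in> \<C> k \<Longrightarrow> switch e A \<in> \<C> k"
  using inj_flip[of e] flip_closed[of e]
  by (auto simp: configurations_def switch_image card_edge card_image inj_on_subset)

lemma switch_switch: "e \<in> E \<Longrightarrow> switch e (switch e A) = A"
  by (auto simp: switch_image flip_flip card_edge image_image)

lemma finite_configurations: "finite (\<C> k)"
  by (rule finite_subset[of _ "Pow V"]) (auto simp: configurations_def finite_V)

sublocale vertex: involutive_action E flip V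
  by unfold_locales
     (auto simp: finite_edges edges_nonempty finite_V flip_closed flip_flip card_edge)

sublocale conf: involutive_action E switch "\<C> k" for k
  by unfold_locales
     (auto simp: finite_edges edges_nonempty finite_configurations switch_mem_configurations switch_switch)

sublocale marked: involutive_action E marked_switch "\<M> k" for k
proof
  show "finite (\<M> k)"
    by (auto simp: marked_configurations_def finite_configurations finite_V)
  fix e s assume e: "e \<in> E" and s: "s \<in> \<M> k"
  show "marked_switch e (marked_switch e s) = s"
    using e by (simp add: marked_switch_def switch_switch flip_flip card_edge)
  have "flip e x \<notin> switch e Z" if "x \<notin> Z" for x Z
    using that e by (simp add: switch_image inj_image_mem_iff[OF inj_flip] card_edge)
  then show "marked_switch e s \<in> \<M> k"
    using e s by (auto simp: marked_configurations_def marked_switch_def switch_mem_configurations flip_closed)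
qed (auto simp: finite_edges edges_nonempty)

section \<open>Kernels of one and two particles\<close>

definition p :: "real \<Rightarrow> 'v \<Rightarrow> 'v \<Rightarrow> real" where
  "p t x y = vertex.P t (indicator {y}) x"

text \<open>The probability that two exclusion particles started from the points of \<open>A\<close>
  are at the ends of an edge at time \<open>t\<close>.\<close>

definition adjacency :: "real \<Rightarrow> 'v set \<Rightarrow> real" where
  "adjacency t = conf.P t (\<lambda>A. of_bool (A \<in> E))"

definition nbrs :: "'v \<Rightarrow> 'v set" where
  "nbrs x = {y. {x, y} \<in> E}"

lemma nbrs_sym: "y \<in> nbrs x \<longleftrightarrow> x \<in> nbrs y"
  by (simp add: nbrs_def insert_commute)

lemma nbrs_subset: "nbrs x \<subseteq> V - {x}"
proof
  fix y assume "y \<in> nbrs x"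
  then show "y \<in> V - {x}"
    using edges[of "{x, y}"] by (auto simp: nbrs_def)
qed

lemma finite_nbrs: "finite (nbrs x)"
  using finite_V by (auto intro: finite_subset[OF nbrs_subset])

lemma edge_pair: "e \<in> E \<Longrightarrow> x \<in> e \<Longrightarrow> {x, flip e x} = e"
  using flip_in[of e x] card_edge[of e] by simp

lemma bij_betw_nbrs: "bij_betw (\<lambda>e. flip e x) {e \<in> E. x \<in> e} (nbrs x)"
proof (rule bij_betw_byWitness[where f' = "\<lambda>y. {x, y}"])
  show "\<forall>e\<in>{e \<in> E. x \<in> e}. {x, flip e x} = e"
    using edge_pair by auto
  show "\<forall>y\<in>nbrs x. flip {x, y} x = y"
  proof
    fix y assume "y \<in> nbrs x"
    then have "x \<noteq> y" using nbrs_subset[of x] by auto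
    then show "flip {x, y} x = y" by (simp add: flip_pair)
  qed
  show "(\<lambda>e. flip e x) ` {e \<in> E. x \<in> e} \<subseteq> nbrs x"
    using edge_pair by (auto simp: nbrs_def)
qed (auto simp: nbrs_def)

lemma card_nbrs: "x \<in> V \<Longrightarrow> card (nbrs x) = D"
  using bij_betw_same_card[OF bij_betw_nbrs, of x] degree[of x] by simp

lemma sum_edges_eq_sum_nbrs:
  assumes "f x = (0::real)"
  shows "(\<Sum>e\<in>E. f (flip e x)) = (\<Sum>y\<in>nbrs x. f y)"
proof -
  have "(\<Sum>e\<in>E. f (flip e x)) = (\<Sum>e\<in>{e \<in> E. x \<in> e}. f (flip e x))"
    using assms by (intro sum.mono_neutral_right) (auto simp: finite_edges flip_notin)
  also have "\<dots> = (\<Sum>y\<in>nbrs x. f y)"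
    using sum.reindex_bij_betw[OF bij_betw_nbrs] .
  finally show ?thesis .
qed

lemma sum_edges_vertices: "(\<Sum>e\<in>E. \<Sum>y\<in>e. f y) = real D * (\<Sum>y\<in>V. f y)" for f :: "'v \<Rightarrow> real"
proof -
  have "(\<Sum>e\<in>E. \<Sum>y\<in>e. f y) = (\<Sum>e\<in>E. \<Sum>y\<in>V. if y \<in> e then f y else 0)"
  proof (rule sum.cong[OF refl])
    fix e assume "e \<in> E"
    then show "(\<Sum>y\<in>e. f y) = (\<Sum>y\<in>V. if y \<in> e then f y else 0)"
      using edges[of e] finite_V by (simp add: sum.inter_restrict[symmetric] Int_absorb1)
  qed
  also have "\<dots> = (\<Sum>y\<in>V. \<Sum>e\<in>E. if y \<in> e then f y else 0)"
    by (rule sum.swap)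
  also have "\<dots> = (\<Sum>y\<in>V. real D * f y)"
  proof (rule sum.cong[OF refl])
    fix y assume "y \<in> V"
    have "(\<Sum>e\<in>E. if y \<in> e then f y else 0) = (\<Sum>e\<in>{e \<in> E. y \<in> e}. f y)"
      using finite_edges by (rule sum.inter_filter[symmetric])
    then show "(\<Sum>e\<in>E. if y \<in> e then f y else 0) = real D * f y"
      using degree[OF \<open>y \<in> V\<close>] by simp
  qed
  finally show ?thesis by (simp add: sum_distrib_left)
qed

lemma card_edges: "2 * real (card E) = n * real D"
  using sum_edges_vertices[of "\<lambda>_. 1"] by (simp add: card_edge mult.commute)

lemma sum_p: "x \<in> V \<Longrightarrow> (\<Sum>y\<in>V. p t x y) = 1"
  using vertex.heat_eq_sum_indicator[of x t "\<lambda>_. 1"] by (simp add: p_def)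

lemma p_nonneg: "x \<in> V \<Longrightarrow> t \<ge> 0 \<Longrightarrow> 0 \<le> p t x y"
  unfolding p_def by (intro vertex.heat_nonneg) auto

lemma heat_indicator: "x \<in> V \<Longrightarrow> b \<subseteq> V \<Longrightarrow> vertex.P t (indicator b) x = (\<Sum>y\<in>b. p t x y)"
  using finite_V unfolding p_def
  by (subst vertex.heat_eq_sum_indicator)
     (auto simp: indicator_def sum.inter_restrict[symmetric] Int_absorb1 if_distrib[of "\<lambda>x. x * _"] cong: if_cong)

lemma configurations_subset_iff:
  assumes "A \<in> \<C> k" "C \<in> \<C> k"
  shows "A \<subseteq> C \<longleftrightarrow> A = C"
  using assms finite_V card_subset_eq[of C A] finite_subset[of C V] by (auto simp: configurations_def)

lemma pair_cases:
  assumes "A \<in> \<C> 2"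
  obtains a b where "A = {a, b}" "a \<noteq> b" "a \<in> V" "b \<in> V"
  using assms by (auto simp: configurations_def card_2_iff)

lemma pair_mem: "a \<in> V \<Longrightarrow> b \<in> V \<Longrightarrow> a \<noteq> b \<Longrightarrow> {a, b} \<in> \<C> 2"
  by (simp add: configurations_def)

lemma edge_mem: "e \<in> E \<Longrightarrow> e \<in> \<C> 2"
  using edges by (auto simp: configurations_def)

lemma flip_eq_iff: "e \<in> E \<Longrightarrow> flip e a = flip e b \<longleftrightarrow> a = b"
  using flip_flip card_edge by metis

text \<open>Liggett's inequality for two particles. The edge inside the pair contributes \<open>(u a - u b)\<^sup>2\<close>
  to the product of two independent heat flows and nothing to the exclusion process.\<close>

lemma pair_heat_le:
  assumes "A \<in> \<C> 2" "t \<ge> 0"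
  shows "conf.P t (\<lambda>A. of_bool (A \<subseteq> b)) A \<le> (\<Prod>x\<in>A. vertex.P t (indicator b) x)"
proof (rule conf.heat_le_supersolution[where
      v = "\<lambda>t A. \<Prod>x\<in>A. vertex.P t (indicator b) x" and
      v' = "\<lambda>t A. \<Sum>x\<in>A. vertex.G (vertex.P t (indicator b)) x
          * (\<Prod>y\<in>A - {x}. vertex.P t (indicator b) y)", OF _ _ _ assms(2,1)])
  let ?u = "\<lambda>t. vertex.P t (indicator b)"
  fix t :: real and A assume "t \<ge> 0" and A: "A \<in> \<C> 2"
  then obtain x y where xy: "A = {x, y}" "x \<noteq> y" "x \<in> V" "y \<in> V"
    using pair_cases by blast
  then have diff: "{x, y} - {x} = {y}" "{x, y} - {y} = {x}" by auto
  show "((\<lambda>t. \<Prod>x\<in>A. ?u t x) has_real_derivative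
      (\<Sum>x\<in>A. vertex.G (?u t) x * (\<Prod>y\<in>A - {x}. ?u t y))) (at t)"
    using DERIV_mult[OF vertex.heat_has_derivative[OF xy(3), of "indicator b" t]
      vertex.heat_has_derivative[OF xy(4), of "indicator b" t]] xy(2)
    by (simp add: xy(1) diff)
  have edge: "(\<Prod>z\<in>switch e A. ?u t z) - (\<Prod>z\<in>A. ?u t z)
     \<le> (?u t (flip e x) - ?u t x) * ?u t y + (?u t (flip e y) - ?u t y) * ?u t x" if e: "e \<in> E" for e
  proof -
    have "switch e A = {flip e x, flip e y}"
      using e by (simp add: switch_image xy)
    then have prod: "(\<Prod>z\<in>switch e A. ?u t z) = ?u t (flip e x) * ?u t (flip e y)"
      using xy e by (simp add: flip_eq_iff)
    consider "x \<in> e" "y \<in> e" | "x \<notin> e" | "y \<notin> e" by blast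
    then show ?thesis
    proof cases
      case 1
      then have "e = {x, y}"
        using flip_in[of e x] card_edge[OF e] xy(2) by (metis insertE singletonD)
      then have "flip e x = y" "flip e y = x"
        using xy(2) by (auto simp: flip_pair)
      then show ?thesis
        using zero_le_power2[of "?u t x - ?u t y"]
        unfolding prod
        using xy(1,2) by (simp add: algebra_simps power2_eq_square)
    next
      case 2
      then show ?thesis
        unfolding prod using xy(1,2)
        by (simp add: flip_notin algebra_simps)
    next
      case 3
      then show ?thesis
        unfolding prod using xy(1,2)
        by (simp add: flip_notin algebra_simps)
    qed
  qed
  have "conf.G (\<lambda>A. \<Prod>x\<in>A. ?u t x) A \<le>
      (\<Sum>e\<in>E. (?u t (flip e x) - ?u t x) * ?u t y + (?u t (flip e y) - ?u t y) * ?u t x)"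
    unfolding gen_def by (intro sum_mono edge)
  then show "conf.G (\<lambda>A. \<Prod>x\<in>A. ?u t x) A \<le>
      (\<Sum>x\<in>A. vertex.G (?u t) x * (\<Prod>y\<in>A - {x}. ?u t y))"
    using xy(2) by (simp add: xy(1) diff gen_def sum.distrib sum_distrib_right)
next
  fix A assume "A \<in> \<C> 2"
  then show "of_bool (A \<subseteq> b) \<le> (\<Prod>x\<in>A. vertex.P 0 (indicator b) x)"
    by (elim pair_cases) (auto simp: indicator_def)
qed

text \<open>The comparison with target set \<open>C\<close>: a pair contained in \<open>C\<close> is
  \<open>C\<close> itself, and each of the two independent walks ends in \<open>C\<close> with
  probability at most \<open>2 * \<eta>\<close>.\<close>

lemma pair_kernel_le:
  assumes "\<And>x y. x \<in> V \<Longrightarrow> y \<in> V \<Longrightarrow> p t x y \<le> \<eta>"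
    and "A \<in> \<C> 2" "C \<in> \<C> 2" "t \<ge> 0"
  shows "conf.P t (indicator {C}) A \<le> (2 * \<eta>)\<^sup>2"
proof -
  obtain a b where ab: "A = {a, b}" "a \<noteq> b" "a \<in> V" "b \<in> V" using pair_cases[OF assms(2)] .
  obtain c d where cd: "C = {c, d}" "c \<noteq> d" "c \<in> V" "d \<in> V" using pair_cases[OF assms(3)] .
  have "conf.P t (indicator {C}) A = conf.P t (\<lambda>A. of_bool (A \<subseteq> C)) A"
  proof (rule conf.heat_cong[OF _ assms(2)])
    fix A' assume "A' \<in> \<C> 2"
    then have "A' \<subseteq> C \<longleftrightarrow> A' = C"
      using assms(3) by (rule configurations_subset_iff)
    then show "indicator {C} A' = (of_bool (A' \<subseteq> C) :: real)" by (simp add: indicator_def)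
  qed
  also have "\<dots> \<le> (\<Prod>x\<in>A. vertex.P t (indicator C) x)"
    using assms by (intro pair_heat_le)
  also have "\<dots> = (p t a c + p t a d) * (p t b c + p t b d)"
    using ab cd by (simp add: heat_indicator)
  also have "\<dots> \<le> (2 * \<eta>) * (2 * \<eta>)"
    using assms(1)[OF ab(3) cd(3)] assms(1)[OF ab(3) cd(4)] assms(1)[OF ab(4) cd(3)] assms(1)[OF ab(4) cd(4)]
      p_nonneg[OF ab(3) assms(4), of c] p_nonneg[OF ab(3) assms(4), of d] p_nonneg[OF ab(4) assms(4), of c]
      p_nonneg[OF ab(4) assms(4), of d]
    by (intro mult_mono) linarith+
  finally show ?thesis by (simp add: power2_eq_square)
qed

lemma adjacency_nonneg: "A \<in> \<C> 2 \<Longrightarrow> t \<ge> 0 \<Longrightarrow> 0 \<le> adjacency t A"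
  unfolding adjacency_def by (intro conf.heat_nonneg) auto

text \<open>The comparison is summed over all edges. One walk contributes the factor
  \<open>2 * \<eta>\<close> for each edge, and the probabilities of the other walk add up to
  \<open>D\<close>, because every vertex lies on \<open>D\<close> edges.\<close>

lemma adjacency_le:
  assumes "\<And>x y. x \<in> V \<Longrightarrow> y \<in> V \<Longrightarrow> p t x y \<le> \<eta>"
    and "A \<in> \<C> 2" "t \<ge> 0"
  shows "adjacency t A \<le> 2 * real D * \<eta>"
proof -
  let ?h = "\<lambda>e. conf.P t (\<lambda>A. of_bool (A \<subseteq> e)) A"
  obtain a b where ab: "A = {a, b}" "a \<noteq> b" "a \<in> V" "b \<in> V" using pair_cases[OF assms(2)] .
  have "adjacency t A = conf.P t (\<lambda>A. \<Sum>e\<in>E. 1 * of_bool (A \<subseteq> e)) A"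
    unfolding adjacency_def
  proof (rule conf.heat_cong[OF _ assms(2)])
    fix A' assume A': "A' \<in> \<C> 2"
    have "A' \<subseteq> e \<longleftrightarrow> A' = e" if "e \<in> E" for e
      using A' edge_mem[OF that] by (rule configurations_subset_iff)
    then have "(\<Sum>e\<in>E. 1 * of_bool (A' \<subseteq> e)) = (\<Sum>e\<in>E. if A' = e then 1 else (0::real))"
      by (intro sum.cong) auto
    then show "of_bool (A' \<in> E) = (\<Sum>e\<in>E. 1 * of_bool (A' \<subseteq> e) :: real)"
      using finite_edges by (simp add: sum.delta)
  qed
  also have "\<dots> = (\<Sum>e\<in>E. 1 * (?h e))"
    by (rule conf.heat_sum[OF assms(2)])
  also have "\<dots> \<le> (\<Sum>e\<in>E. 2 * \<eta> * (\<Sum>y\<in>e. p t b y))"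
  proof (rule sum_mono)
    fix e assume e: "e \<in> E"
    then obtain c d where cd: "e = {c, d}" "c \<noteq> d" "c \<in> V" "d \<in> V" using pair_cases[OF edge_mem] by blast
    have "1 * (?h e) \<le> (\<Prod>x\<in>A. vertex.P t (indicator e) x)"
      using pair_heat_le[OF assms(2,3)] by simp
    also have "\<dots> = (p t a c + p t a d) * (\<Sum>y\<in>e. p t b y)"
      using ab cd by (simp add: heat_indicator)
    also have "\<dots> \<le> 2 * \<eta> * (\<Sum>y\<in>e. p t b y)"
      using assms(1)[OF ab(3) cd(3)] assms(1)[OF ab(3) cd(4)] p_nonneg[OF ab(4) assms(3)]
      by (intro mult_right_mono sum_nonneg) auto
    finally show "1 * (?h e) \<le> 2 * \<eta> * (\<Sum>y\<in>e. p t b y)" .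
  qed
  also have "\<dots> = 2 * \<eta> * (real D * 1)"
    by (simp add: sum_distrib_left[symmetric] sum_edges_vertices sum_p[OF ab(4)])
  finally show ?thesis by (simp add: mult_ac)
qed

text \<open>Summing over the start of the second particle leaves a function of the first particle
  that solves the one-particle heat equation. By regularity its initial value is the constant
  \<open>D\<close>, which the flow preserves.\<close>

lemma sum_adjacency:
  assumes "a \<in> V" "t \<ge> 0"
  shows "(\<Sum>b\<in>V - {a}. adjacency t {a, b}) = real D"
proof -
  let ?d = "\<lambda>t a. (\<Sum>b\<in>V - {a}. conf.G (adjacency t) {a, b})"
  define R where "R t a = (\<Sum>b\<in>V - {a}. adjacency t {a, b})" for t a
  have der: "((\<lambda>t. R t a) has_real_derivative vertex.G (R t) a) (at t)" if a: "a \<in> V" for t a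
  proof -
    have "((\<lambda>t. R t a) has_real_derivative (?d t a)) (at t)"
      unfolding R_def adjacency_def using a
      by (intro DERIV_sum conf.heat_has_derivative[of _ 2] pair_mem) auto
    moreover have "(?d t a) = vertex.G (R t) a"
    proof -
      have "(\<Sum>b\<in>V - {a}. adjacency t (switch e {a, b})) = R t (flip e a)" if e: "e \<in> E" for e
        unfolding R_def using e a
        by (intro sum.reindex_bij_witness[where i = "flip e" and j = "flip e"])
           (auto simp: flip_closed flip_flip card_edge switch_image flip_eq_iff)
      then have "vertex.G (R t) a = (\<Sum>e\<in>E. (\<Sum>b\<in>V - {a}. adjacency t (switch e {a, b}) - adjacency t {a, b}))"
        by (simp add: gen_def sum_subtractf R_def)
      also have "\<dots> = (?d t a)"
        unfolding gen_def by (rule sum.swap)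
      finally show ?thesis by simp
    qed
    ultimately show ?thesis by simp
  qed
  have R0: "R 0 a = real D" if a: "a \<in> V" for a
  proof -
    have "R 0 a = (\<Sum>b\<in>V - {a}. if {a, b} \<in> E then 1 else 0)"
      by (simp add: R_def adjacency_def of_bool_def)
    also have "\<dots> = real (card {b \<in> V - {a}. {a, b} \<in> E})"
      using finite_V by (simp add: sum.inter_filter[symmetric])
    also have "{b \<in> V - {a}. {a, b} \<in> E} = nbrs a"
      using nbrs_subset by (auto simp: nbrs_def)
    finally show ?thesis using card_nbrs[OF a] by simp
  qed
  have "R t a = vertex.P t (R 0) a"
    using assms by (intro vertex.heat_unique der) auto
  also have "\<dots> = vertex.P t (\<lambda>_. real D) a"
    using assms R0 by (intro vertex.heat_cong) auto
  finally show ?thesis by (simp add: R_def)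
qed

end

section \<open>Poincare inequalities for one and two particles\<close>

context regular_graph
begin

text \<open>An upper bound on the kernel suffices: \<open>q = 3/(2n) - p t\<close> is nonnegative with row sums
  \<open>1/2\<close>, and replacing \<open>p t\<close> by \<open>-q\<close> does not change the quadratic form on sum-zero functions.\<close>

lemma vertex_poincare:
  assumes "\<And>x y. x \<in> V \<Longrightarrow> y \<in> V \<Longrightarrow> p t x y \<le> 3 / (2 * n)" "t \<ge> 0" "(\<Sum>x\<in>V. g x) = 0"
  shows "(\<Sum>x\<in>V. (g x)\<^sup>2) \<le> 2 * t * vertex.Dir g"
proof -
  define q where "q x y = 3 / (2 * n) - p t x y" for x y
  let ?a = "\<lambda>x y. ((g x)\<^sup>2 + (g y)\<^sup>2) / 2 * q x y"
  have q: "q x y \<ge> 0" if "x \<in> V" "y \<in> V" for x y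
    using assms(1)[OF that] by (simp add: q_def)
  have psym: "p t x y = p t y x" if "x \<in> V" "y \<in> V" for x y
    using vertex.heat_indicator_sym[OF that(2,1), of t] by (simp add: p_def)
  have sum_q: "(\<Sum>y\<in>V. q x y) = 1 / 2" if "x \<in> V" for x
    using that n_pos by (simp add: q_def sum_subtractf sum_p)
  have sum_q': "(\<Sum>x\<in>V. q x y) = 1 / 2" if "y \<in> V" for y
    using sum_q[OF that] that psym by (simp add: q_def cong: sum.cong)
  have "vertex.P (t / 2) (vertex.P (t / 2) g) x = vertex.P t g x" if "x \<in> V" for x
    using vertex.heat_heat[OF _ that, of "t / 2" "t / 2" g] assms(2) by simp
  then have "(\<Sum>x\<in>V. (vertex.P (t / 2) g x)\<^sup>2) = (\<Sum>x\<in>V. g x * vertex.P t g x)"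
    using vertex.sum_mult_heat[of g "t / 2" "vertex.P (t / 2) g"]
    by (simp add: power2_eq_square)
  also have "\<dots> = (\<Sum>x\<in>V. \<Sum>y\<in>V. g x * g y * p t x y)"
    by (intro sum.cong refl, subst vertex.heat_eq_sum_indicator)
       (auto simp: sum_distrib_left p_def mult_ac)
  also have "\<dots> = (\<Sum>x\<in>V. \<Sum>y\<in>V. g x * g y * (3 / (2 * n))) - (\<Sum>x\<in>V. \<Sum>y\<in>V. g x * g y * q x y)"
    by (simp add: q_def sum_subtractf[symmetric] algebra_simps)
  also have "(\<Sum>x\<in>V. \<Sum>y\<in>V. g x * g y * (3 / (2 * n))) = 0"
    using assms(3) by (simp add: sum_distrib_left[symmetric] sum_distrib_right[symmetric] sum_divide_distrib[symmetric])
  also have "0 - (\<Sum>x\<in>V. \<Sum>y\<in>V. g x * g y * q x y)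
      \<le> (\<Sum>x\<in>V. \<Sum>y\<in>V. (?a x y))"
  proof -
    have "- (g x * g y * q x y) \<le> (?a x y)" if "x \<in> V" "y \<in> V" for x y
    proof -
      have "- (g x * g y) \<le> ((g x)\<^sup>2 + (g y)\<^sup>2) / 2"
        using zero_le_power2[of "g x + g y"] by (simp add: power2_sum)
      from mult_right_mono[OF this q[OF that]] show ?thesis by simp
    qed
    then show ?thesis
      by (simp add: sum_negf[symmetric] del: sum_negf) (intro sum_mono; simp)
  qed
  also have "\<dots> = (\<Sum>x\<in>V. (g x)\<^sup>2 / 2 * (\<Sum>y\<in>V. q x y)) + (\<Sum>y\<in>V. (g y)\<^sup>2 / 2 * (\<Sum>x\<in>V. q x y))"
  proof -
    have "(\<Sum>y\<in>V. (g y)\<^sup>2 / 2 * (\<Sum>x\<in>V. q x y)) = (\<Sum>x\<in>V. \<Sum>y\<in>V. (g y)\<^sup>2 / 2 * q x y)"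
      by (simp add: sum_distrib_left) (rule sum.swap)
    moreover have "(\<Sum>x\<in>V. (g x)\<^sup>2 / 2 * (\<Sum>y\<in>V. q x y)) = (\<Sum>x\<in>V. \<Sum>y\<in>V. (g x)\<^sup>2 / 2 * q x y)"
      by (simp add: sum_distrib_left)
    moreover have "(\<Sum>x\<in>V. \<Sum>y\<in>V. (?a x y))
        = (\<Sum>x\<in>V. \<Sum>y\<in>V. (g x)\<^sup>2 / 2 * q x y) + (\<Sum>x\<in>V. \<Sum>y\<in>V. (g y)\<^sup>2 / 2 * q x y)"
      by (simp add: sum.distrib add_divide_distrib distrib_right)
    ultimately show ?thesis by simp
  qed
  also have "\<dots> = (\<Sum>x\<in>V. (g x)\<^sup>2) / 2"
    by (simp add: sum_q sum_q' sum_divide_distrib[symmetric] cong: sum.cong)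
  \<comment> \<open>So at most half of the squared norm remains at time \<open>t / 2\<close>, while
    the loss up to that time is at most \<open>t * vertex.Dir g\<close>.\<close>
  finally show ?thesis
    using vertex.norm_diff_heat_le[of "t / 2" g] assms(2) by (simp add: field_simps)
qed

lemma dirichlet_vertex: "vertex.Dir g = (\<Sum>x\<in>V. \<Sum>y\<in>nbrs x. (g y - g x)\<^sup>2) / 2"
  unfolding dirichlet_def
  by (intro arg_cong[where f = "\<lambda>x. x / 2"] sum.cong refl sum_edges_eq_sum_nbrs) simp

text \<open>Tensorisation: the variance splits into the variances of the rows and the variance of
  the row means, and by Cauchy-Schwarz averaging over \<open>y\<close> does not increase the energy
  in \<open>x\<close>. The constant is that of one factor.\<close>

lemma product_poincare:
  fixes h :: "'v \<Rightarrow> 'v \<Rightarrow> real"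
  assumes poincare: "\<And>g. (\<Sum>x\<in>V. g x) = 0 \<Longrightarrow> (\<Sum>x\<in>V. (g x)\<^sup>2) \<le> c * vertex.Dir g"
    and c: "c \<ge> 0"
  shows "\<exists>m. (\<Sum>x\<in>V. \<Sum>y\<in>V. (h x y - m)\<^sup>2) \<le> c * ((\<Sum>x\<in>V. vertex.Dir (h x))
      + (\<Sum>y\<in>V. vertex.Dir (\<lambda>x. h x y)))"
proof -
  define r where "r x = (\<Sum>y\<in>V. h x y) / n" for x
  define m where "m = (\<Sum>x\<in>V. r x) / n"
  let ?d = "(\<Sum>y\<in>V. vertex.Dir (\<lambda>x. h x y))"
  let ?dx = "(\<Sum>x\<in>V. vertex.Dir (h x))"
  let ?sq = "(\<Sum>x\<in>V. \<Sum>y\<in>V. (h x y - m)\<^sup>2)"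
  have shift: "vertex.Dir (\<lambda>x. g x - a) = vertex.Dir g" for g a
    by (simp add: dirichlet_def)
  have sum0: "(\<Sum>x\<in>V. g x - (\<Sum>x\<in>V. g x) / n) = 0" for g
    using n_pos by (simp add: sum_subtractf)
  have var: "(\<Sum>x\<in>V. (g x - (\<Sum>x\<in>V. g x) / n)\<^sup>2) \<le> c * vertex.Dir g" for g
    using poincare[OF sum0[of g]] by (simp only: shift)
  have "(\<Sum>y\<in>V. (h x y - m)\<^sup>2) = (\<Sum>y\<in>V. (h x y - r x)\<^sup>2) + n * (r x - m)\<^sup>2" for x
  proof -
    have "(h x y - m)\<^sup>2 = (h x y - r x)\<^sup>2 + (r x - m)\<^sup>2 + 2 * (r x - m) * (h x y - r x)" for y
      by (simp add: power2_eq_square algebra_simps)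
    then have "(\<Sum>y\<in>V. (h x y - m)\<^sup>2) = (\<Sum>y\<in>V. (h x y - r x)\<^sup>2) + n * (r x - m)\<^sup>2
        + 2 * (r x - m) * (\<Sum>y\<in>V. h x y - r x)"
      by (simp add: sum.distrib sum_distrib_left)
    then show ?thesis using sum0[of "h x"] by (simp add: r_def)
  qed
  then have "?sq = (\<Sum>x\<in>V. \<Sum>y\<in>V. (h x y - r x)\<^sup>2) + n * (\<Sum>x\<in>V. (r x - m)\<^sup>2)"
    by (simp add: sum.distrib sum_distrib_left)
  also have "(\<Sum>x\<in>V. \<Sum>y\<in>V. (h x y - r x)\<^sup>2) \<le> (\<Sum>x\<in>V. c * vertex.Dir (h x))"
    unfolding r_def by (intro sum_mono var)
  also have "n * (\<Sum>x\<in>V. (r x - m)\<^sup>2) \<le> n * (c * vertex.Dir r)"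
    unfolding m_def by (intro mult_left_mono var) simp
  also have "n * (c * vertex.Dir r) \<le> c * ?d"
  proof -
    have "n * (r x' - r x)\<^sup>2 \<le> (\<Sum>y\<in>V. (h x' y - h x y)\<^sup>2)" for x x'
    proof -
      have "r x' - r x = (\<Sum>y\<in>V. h x' y - h x y) / n"
        by (simp add: r_def sum_subtractf diff_divide_distrib)
      then have "n * (r x' - r x)\<^sup>2 = (\<Sum>y\<in>V. h x' y - h x y)\<^sup>2 / n"
        using n_pos by (simp add: power_divide power2_eq_square)
      also have "\<dots> \<le> (\<Sum>y\<in>V. (h x' y - h x y)\<^sup>2) * n / n"
        using n_pos by (intro divide_right_mono sum_squared_le_sum_of_squares finite_V) auto
      finally show ?thesis using n_pos by simp
    qed
    then have "n * vertex.Dir r \<le> (\<Sum>x\<in>V. \<Sum>e\<in>E. \<Sum>y\<in>V. (h (flip e x) y - h x y)\<^sup>2) / 2"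
      unfolding dirichlet_def by (simp add: sum_distrib_left sum_mono)
    also have "(\<Sum>x\<in>V. \<Sum>e\<in>E. \<Sum>y\<in>V. (h (flip e x) y - h x y)\<^sup>2)
       = (\<Sum>x\<in>V. \<Sum>y\<in>V. \<Sum>e\<in>E. (h (flip e x) y - h x y)\<^sup>2)"
      by (intro sum.cong refl sum.swap)
    also have "\<dots> = (\<Sum>y\<in>V. \<Sum>x\<in>V. \<Sum>e\<in>E. (h (flip e x) y - h x y)\<^sup>2)"
      by (rule sum.swap)
    finally have "n * vertex.Dir r \<le> ?d"
      by (simp add: dirichlet_def sum_divide_distrib)
    from mult_left_mono[OF this c] show ?thesis by (simp add: mult_ac)
  qed
  finally have "?sq \<le> c * (?dx
      + ?d)"
    by (simp add: sum_distrib_left distrib_left)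
  then show ?thesis by blast
qed

section \<open>Energy on unordered pairs\<close>

lemma sum_pairs:
  fixes F :: "'v set \<Rightarrow> real"
  shows "(\<Sum>x\<in>V. \<Sum>y\<in>V - {x}. F {x, y}) = 2 * (\<Sum>A\<in>\<C> 2. F A)"
proof -
  let ?o = "\<lambda>A x. (x, THE y. y \<in> A \<and> y \<noteq> x)"
  have "(\<Sum>x\<in>V. \<Sum>y\<in>V - {x}. F {x, y}) = (\<Sum>(x, y)\<in>Sigma V (\<lambda>x. V - {x}). F {x, y})"
    using finite_V by (simp add: sum.Sigma)
  also have "\<dots> = (\<Sum>(A, x)\<in>Sigma (\<C> 2) (\<lambda>A. A). F A)"
  proof (rule sum.reindex_bij_witness[where j = "\<lambda>(x, y). ({x, y}, x)" and i = "\<lambda>(A, x). (?o A x)"])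
    fix s :: "'v \<times> 'v" assume "s \<in> Sigma V (\<lambda>x. V - {x})"
    then obtain x y where s: "s = (x, y)" "x \<in> V" "y \<in> V" "x \<noteq> y" by auto
    have "(THE z. z \<in> {x, y} \<and> z \<noteq> x) = y" using s by auto
    then show "(case case s of (x, y) \<Rightarrow> ({x, y}, x) of (A, x) \<Rightarrow> (?o A x)) = s"
      using s by simp
    show "(case s of (x, y) \<Rightarrow> ({x, y}, x)) \<in> Sigma (\<C> 2) (\<lambda>A. A)"
      using s by (simp add: pair_mem)
    show "(case case s of (x, y) \<Rightarrow> ({x, y}, x) of (A, x) \<Rightarrow> F A) = (case s of (x, y) \<Rightarrow> F {x, y})"
      using s by simp
  next
    fix s :: "'v set \<times> 'v" assume "s \<in> Sigma (\<C> 2) (\<lambda>A. A)"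
    then obtain A x where s: "s = (A, x)" "A \<in> \<C> 2" "x \<in> A" by auto
    then obtain y where A: "A = {x, y}" "x \<noteq> y" "x \<in> V" "y \<in> V"
      by (elim pair_cases) auto
    have "(THE z. z \<in> {x, y} \<and> z \<noteq> x) = y" using A by auto
    then show "(case case s of (A, x) \<Rightarrow> (?o A x) of (x, y) \<Rightarrow> ({x, y}, x)) = s"
      "(case s of (A, x) \<Rightarrow> (?o A x)) \<in> Sigma V (\<lambda>x. V - {x})"
      using s A by auto
  qed
  also have "\<dots> = (\<Sum>A\<in>\<C> 2. \<Sum>x\<in>A. F A)"
  proof (subst sum.Sigma)
    show "\<forall>A\<in>\<C> 2. finite A"
      using finite_V by (auto simp: configurations_def intro: finite_subset)
  qed (auto simp: finite_configurations)
  also have "\<dots> = 2 * (\<Sum>A\<in>\<C> 2. F A)"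
    unfolding sum_distrib_left by (intro sum.cong refl) (simp add: configurations_def)
  finally show ?thesis .
qed

lemma card_pairs: "real (card (\<C> 2)) = n * (n - 1) / 2"
proof -
  have "(\<Sum>x\<in>V. \<Sum>y\<in>V - {x}. 1) = n * (n - 1)"
    using finite_V n_pos by (simp add: of_nat_diff Suc_le_eq)
  then have "2 * real (card (\<C> 2)) = n * (n - 1)"
    using sum_pairs[of "\<lambda>_. 1"] by (simp only: sum_constant mult_1_right)
  then show ?thesis by simp
qed

lemma sum_off_diagonal_swap:
  "(\<Sum>x\<in>V. \<Sum>y\<in>V - {x}. g x y) = (\<Sum>y\<in>V. \<Sum>x\<in>V - {y}. g x y)" for g :: "'v \<Rightarrow> 'v \<Rightarrow> real"
proof -
  have "(\<Sum>y\<in>V - {x}. g x y) = (\<Sum>y\<in>V. if x = y then 0 else g x y)" for x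
    using finite_V by (intro sum.mono_neutral_cong_left) auto
  moreover have "(\<Sum>x\<in>V - {y}. g x y) = (\<Sum>x\<in>V. if x = y then 0 else g x y)" for y
    using finite_V by (intro sum.mono_neutral_cong_left) auto
  ultimately show ?thesis
    by simp (rule sum.swap)
qed

lemma sum_nbrs_swap:
  "(\<Sum>x\<in>V. \<Sum>y\<in>nbrs x. g x y) = (\<Sum>y\<in>V. \<Sum>x\<in>nbrs y. g x y)" for g :: "'v \<Rightarrow> 'v \<Rightarrow> real"
proof -
  have "(\<Sum>y\<in>nbrs x. g x y) = (\<Sum>y\<in>V. if y \<in> nbrs x then g x y else 0)" for x
    using finite_V nbrs_subset[of x] by (intro sum.mono_neutral_cong_left) auto
  moreover have "(\<Sum>x\<in>nbrs y. g x y) = (\<Sum>x\<in>V. if y \<in> nbrs x then g x y else 0)" for y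
    using finite_V nbrs_subset[of y] by (intro sum.mono_neutral_cong_left) (auto simp: nbrs_sym[of y])
  ultimately show ?thesis
    by simp (rule sum.swap)
qed

lemma sum_diff_if:
  "finite N \<Longrightarrow> (\<Sum>z\<in>N. if z = x then 0 else g z) = (\<Sum>z\<in>N - {x}. g z)" for g :: "'a \<Rightarrow> real"
  by (intro sum.mono_neutral_cong_right) auto

text \<open>An edge joining the two points of a pair fixes the pair, which is why \<open>x\<close>
  is removed from the neighbours of \<open>y\<close>. Every other edge moves at most one point, so
  the energy can be written as a sum over a resting point \<open>x\<close> and a moving point
  \<open>y\<close>.\<close>

lemma dirichlet_pairs:
  "(\<Sum>x\<in>V. \<Sum>y\<in>V - {x}. \<Sum>z\<in>nbrs y - {x}. (f {x, z} - f {x, y})\<^sup>2)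
    = 2 * conf.Dir 2 f" (is "?W = _")
proof -
  define F where "F A = (\<Sum>e\<in>E. (f (switch e A) - f A)\<^sup>2)" for A
  have F: "F {x, y} = (\<Sum>z\<in>nbrs y - {x}. (f {x, z} - f {x, y})\<^sup>2) + (\<Sum>z\<in>nbrs x - {y}. (f {y, z} - f {y, x})\<^sup>2)"
    if xy: "x \<noteq> y" for x y
  proof -
    define \<psi> where "\<psi> x y z = (if z = x then 0 else (f {x, z} - f {x, y})\<^sup>2)" for x y z
    have \<psi>: "\<psi> x y y = 0" for x y
      by (simp add: \<psi>_def)
    have "(f (switch e {x, y}) - f {x, y})\<^sup>2 = \<psi> x y (flip e y) + \<psi> y x (flip e x)"
      if e: "e \<in> E" for e
    proof -
      consider "x \<in> e" "y \<in> e" | "x \<notin> e" | "y \<notin> e" by blast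
      then show ?thesis
      proof cases
        case 1
        then have "e = {x, y}"
          using edge_pair[OF e, of x] xy by (metis insertE singletonD)
        then have "flip e x = y" "flip e y = x"
          using xy by (auto simp: flip_pair)
        then show ?thesis
          using e by (simp add: switch_image \<psi>_def insert_commute)
      next
        case 2
        then have "flip e y \<noteq> x"
          using e xy by (metis flip_eq_iff flip_notin)
        then show ?thesis
          using e 2 by (simp add: switch_image \<psi>_def flip_notin)
      next
        case 3
        then have "flip e x \<noteq> y"
          using e xy by (metis flip_eq_iff flip_notin)
        then show ?thesis
          using e 3 by (simp add: switch_image \<psi>_def flip_notin insert_commute)
      qed
    qed
    then have "F {x, y} = (\<Sum>e\<in>E. \<psi> x y (flip e y)) + (\<Sum>e\<in>E. \<psi> y x (flip e x))"
      by (simp add: F_def sum.distrib)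
    also have "\<dots> = (\<Sum>z\<in>nbrs y. \<psi> x y z) + (\<Sum>z\<in>nbrs x. \<psi> y x z)"
      using sum_edges_eq_sum_nbrs[of "\<psi> x y" y] sum_edges_eq_sum_nbrs[of "\<psi> y x" x] \<psi> by simp
    finally show ?thesis
      by (simp add: \<psi>_def sum_diff_if finite_nbrs)
  qed
  have "2 * (2 * conf.Dir 2 f) = 2 * (\<Sum>A\<in>\<C> 2. F A)"
    by (simp add: dirichlet_def F_def)
  also have "\<dots> = (\<Sum>x\<in>V. \<Sum>y\<in>V - {x}. F {x, y})"
    by (rule sum_pairs[symmetric])
  also have "\<dots> = (\<Sum>x\<in>V. \<Sum>y\<in>V - {x}. (\<Sum>z\<in>nbrs y - {x}. (f {x, z} - f {x, y})\<^sup>2)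
     + (\<Sum>z\<in>nbrs x - {y}. (f {y, z} - f {y, x})\<^sup>2))"
    by (intro sum.cong refl F) auto
  also have "\<dots> = ?W + (\<Sum>x\<in>V. \<Sum>y\<in>V - {x}. \<Sum>z\<in>nbrs x - {y}. (f {y, z} - f {y, x})\<^sup>2)"
    by (simp add: sum.distrib)
  also have "(\<Sum>x\<in>V. \<Sum>y\<in>V - {x}. \<Sum>z\<in>nbrs x - {y}. (f {y, z} - f {y, x})\<^sup>2) = ?W"
    by (rule sum_off_diagonal_swap)
  finally show ?thesis by simp
qed

text \<open>A function of pairs is extended to the diagonal by averaging over the neighbours. Two
  neighbours \<open>y\<close>, \<open>z\<close> of \<open>x\<close> are compared along the two moves \<open>{x, y} \<rightarrow> {z, y} \<rightarrow> {z, x}\<close>.\<close>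

lemma pair_poincare:
  assumes poincare: "\<And>g. (\<Sum>x\<in>V. g x) = 0 \<Longrightarrow> (\<Sum>x\<in>V. (g x)\<^sup>2) \<le> c * vertex.Dir g"
    and c: "c \<ge> 0" and f: "(\<Sum>A\<in>\<C> 2. f A) = 0"
  shows "(\<Sum>A\<in>\<C> 2. (f A)\<^sup>2) \<le> 5 * c * conf.Dir 2 f"
proof -
  define avg where "avg x = (\<Sum>z\<in>nbrs x. f {x, z}) / real D" for x
  define h where "h x y = (if x = y then avg x else f {x, y})" for x y
  let ?sq = "\<lambda>m. (\<Sum>x\<in>V. \<Sum>y\<in>V. (h x y - m)\<^sup>2)"
  let ?dev = "\<lambda>x. (\<Sum>z\<in>nbrs x. (f {x, z} - avg x)\<^sup>2)"
  let ?local = "\<lambda>x. (\<Sum>y\<in>nbrs x. \<Sum>z\<in>nbrs x - {y}. (f {y, z} - f {y, x})\<^sup>2)"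
  define W where "W = (\<Sum>x\<in>V. \<Sum>y\<in>V - {x}. \<Sum>z\<in>nbrs y - {x}. (f {x, z} - f {x, y})\<^sup>2)"
  define K where "K = (\<Sum>x\<in>V. \<Sum>z\<in>nbrs x. (f {x, z} - avg x)\<^sup>2)"
  have h_sym: "h x y = h y x" for x y
    by (simp add: h_def insert_commute)
  have dir_h: "vertex.Dir (h x) = (?dev x)
      + (\<Sum>y\<in>V - {x}. \<Sum>z\<in>nbrs y - {x}. (f {x, z} - f {x, y})\<^sup>2) / 2" if x: "x \<in> V" for x
  proof -
    let ?d = "\<lambda>y. \<Sum>z\<in>nbrs y. (h x z - h x y)\<^sup>2"
    have "?d x = (?dev x)"
      using nbrs_subset[of x] by (intro sum.cong) (auto simp: h_def)
    moreover have "(\<Sum>y\<in>V - {x}. ?d y) = (\<Sum>y\<in>V - {x}. \<Sum>z\<in>nbrs y - {x}. (f {x, z} - f {x, y})\<^sup>2)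
       + (?dev x)"
    proof -
      have "?d y = (\<Sum>z\<in>nbrs y - {x}. (f {x, z} - f {x, y})\<^sup>2) + (if y \<in> nbrs x then (f {x, y} - avg x)\<^sup>2 else 0)"
        if y: "y \<in> V - {x}" for y
      proof -
        have 1: "(\<Sum>z\<in>nbrs y - {x}. (h x z - h x y)\<^sup>2) = (\<Sum>z\<in>nbrs y - {x}. (f {x, z} - f {x, y})\<^sup>2)"
          using y by (intro sum.cong) (auto simp: h_def)
        show ?thesis
        proof (cases "y \<in> nbrs x")
          case True
          then have "x \<in> nbrs y" by (simp add: nbrs_sym)
          from sum.remove[OF finite_nbrs this, of "\<lambda>z. (h x z - h x y)\<^sup>2"] show ?thesis
            using True y 1 by (auto simp: h_def power2_commute)
        next
          case False
          then have "x \<notin> nbrs y" by (simp add: nbrs_sym)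
          then show ?thesis using 1 False by simp
        qed
      qed
      moreover have "(\<Sum>y\<in>V - {x}. if y \<in> nbrs x then (f {x, y} - avg x)\<^sup>2 else 0) = (\<Sum>y\<in>nbrs x. (f {x, y} - avg x)\<^sup>2)"
        using nbrs_subset[of x] finite_V by (intro sum.mono_neutral_cong_right) auto
      ultimately show ?thesis by (simp add: sum.distrib)
    qed
    ultimately show ?thesis
      unfolding dirichlet_vertex using sum.remove[OF finite_V x, of ?d] by simp
  qed
  have dir: "(\<Sum>x\<in>V. vertex.Dir (h x)) = K + W / 2"
    by (simp add: dir_h K_def W_def sum.distrib sum_divide_distrib)
  have K: "K \<le> 2 * W"
  proof -
    define T where "T = (\<Sum>x\<in>V. \<Sum>y\<in>nbrs x. \<Sum>z\<in>nbrs x - {y}. (f {y, z} - f {y, x})\<^sup>2)"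
    \<comment> \<open>\<open>T\<close> contains only those moves of \<open>W\<close> that start from
      two adjacent points.\<close>
    have "T \<le> W"
    proof -
      have "T = (\<Sum>y\<in>V. \<Sum>x\<in>nbrs y. \<Sum>z\<in>nbrs x - {y}. (f {y, z} - f {y, x})\<^sup>2)"
        unfolding T_def by (rule sum_nbrs_swap)
      also have "\<dots> \<le> W"
        unfolding W_def using nbrs_subset finite_V
        by (intro sum_mono sum_mono2) (auto intro: sum_nonneg)
      finally show ?thesis .
    qed
    have "(?dev x) \<le> (?local x) * 2 / real D"
      if x: "x \<in> V" for x
    proof -
      have "nbrs x \<noteq> {}" using card_nbrs[OF x] degree_pos by auto
      then have "(?dev x) = (\<Sum>y\<in>nbrs x. \<Sum>z\<in>nbrs x. (f {x, y} - f {x, z})\<^sup>2) / (2 * real D)"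
        using sum_squared_deviation[OF finite_nbrs, of x "\<lambda>z. f {x, z}"] card_nbrs[OF x] by (simp add: avg_def)
      also have "(\<Sum>y\<in>nbrs x. \<Sum>z\<in>nbrs x. (f {x, y} - f {x, z})\<^sup>2)
         \<le> (\<Sum>y\<in>nbrs x. \<Sum>z\<in>nbrs x. (if z = y then 0 else 2 * (f {y, z} - f {y, x})\<^sup>2)
             + (if y = z then 0 else 2 * (f {z, y} - f {z, x})\<^sup>2))"
      proof (intro sum_mono)
        fix y z
        have "(f {x, y} - f {x, z})\<^sup>2 \<le> 2 * (f {y, z} - f {y, x})\<^sup>2 + 2 * (f {z, y} - f {z, x})\<^sup>2"
          using zero_le_power2[of "(f {y, z} - f {y, x}) + (f {y, z} - f {z, x})"]
          by (simp add: power2_eq_square algebra_simps insert_commute)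
        then show "(f {x, y} - f {x, z})\<^sup>2 \<le> (if z = y then 0 else 2 * (f {y, z} - f {y, x})\<^sup>2)
             + (if y = z then 0 else 2 * (f {z, y} - f {z, x})\<^sup>2)"
          by auto
      qed
      also have "\<dots> = 4 * (?local x)"
      proof -
        have "(\<Sum>y\<in>nbrs x. \<Sum>z\<in>nbrs x. if y = z then 0 else 2 * (f {z, y} - f {z, x})\<^sup>2)
          = (\<Sum>y\<in>nbrs x. \<Sum>z\<in>nbrs x. if z = y then 0 else 2 * (f {y, z} - f {y, x})\<^sup>2)"
          by (subst sum.swap) (simp add: eq_commute)
        then show ?thesis
          by (simp add: sum.distrib sum_diff_if finite_nbrs sum_distrib_left[symmetric])
      qed
      finally show ?thesis by (simp add: mult.commute divide_right_mono)
    qed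
    then have "K \<le> (\<Sum>x\<in>V. (?local x) * 2 / real D)"
      unfolding K_def by (rule sum_mono)
    also have "\<dots> = T * 2 / real D"
      by (simp add: T_def sum_distrib_right sum_divide_distrib)
    also have "\<dots> \<le> T * 2 / 1"
      using degree_pos by (intro divide_left_mono) (auto simp: T_def sum_nonneg)
    finally show ?thesis using \<open>T \<le> W\<close> by simp
  qed
  obtain m where m: "(?sq m) \<le> c * ((\<Sum>x\<in>V. vertex.Dir (h x))
      + (\<Sum>y\<in>V. vertex.Dir (\<lambda>x. h x y)))"
    using product_poincare[OF poincare c, of h] by blast
  have "(\<Sum>y\<in>V. vertex.Dir (\<lambda>x. h x y)) = K + W / 2"
  proof -
    have "(\<lambda>x. h x y) = h y" for y using h_sym by blast
    then show ?thesis by (simp add: dir)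
  qed
  with m dir have "(?sq m) \<le> c * (2 * K + W)"
    by simp
  \<comment> \<open>\<open>2 * K + W \<le> 5 * W\<close>, and \<open>W\<close> is twice the energy.
    Passing from ordered to unordered pairs then halves the factor 10.\<close>
  also have "\<dots> \<le> c * (10 * conf.Dir 2 f)"
    using K c dirichlet_pairs[of f] unfolding W_def[symmetric] by (intro mult_left_mono) auto
  finally have upper: "(?sq m) \<le> 10 * c * conf.Dir 2 f"
    by simp
  have "2 * (\<Sum>A\<in>\<C> 2. (f A - m)\<^sup>2) = (\<Sum>x\<in>V. \<Sum>y\<in>V - {x}. (f {x, y} - m)\<^sup>2)"
    by (rule sum_pairs[symmetric])
  also have "\<dots> = (\<Sum>x\<in>V. \<Sum>y\<in>V - {x}. (h x y - m)\<^sup>2)"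
    by (intro sum.cong refl) (auto simp: h_def)
  also have "\<dots> \<le> (?sq m)"
    using finite_V by (intro sum_mono sum_mono2) auto
  finally have "2 * (\<Sum>A\<in>\<C> 2. (f A - m)\<^sup>2) \<le> 10 * c * conf.Dir 2 f"
    using upper by simp
  moreover have "(\<Sum>A\<in>\<C> 2. (f A)\<^sup>2) \<le> (\<Sum>A\<in>\<C> 2. (f A - m)\<^sup>2)"
    using f by (simp add: power2_diff sum.distrib sum_subtractf sum_distrib_left[symmetric] sum_distrib_right[symmetric])
  ultimately show ?thesis by simp
qed

text \<open>At time \<open>t\<close> the upper bound makes the squared deviation from uniform at
  most \<open>9 / n\<^sup>2\<close>. The Poincare constant is \<open>10 * t\<close>, so a further
  time \<open>15 * t\<close> gains \<open>exp (- 3)\<close> and leaves at most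
  \<open>1 / n\<^sup>2\<close>. The kernel at time \<open>32 * t\<close> is an inner product of two
  kernels at time \<open>16 * t\<close>, hence at least
  \<open>2 / (n * (n - 1)) - 1 / n\<^sup>2\<close>.\<close>

lemma pair_kernel_ge:
  assumes bound: "\<And>x y. x \<in> V \<Longrightarrow> y \<in> V \<Longrightarrow> p t x y \<le> 3 / (2 * n)" and t: "t > 0"
    and A: "A \<in> \<C> 2" and C: "C \<in> \<C> 2"
  shows "1 / (n * (n - 1)) \<le> conf.P (32 * t) (indicator {C}) A"
proof -
  let ?S = "\<C> 2" and ?P = "conf.P"
  define M where "M = real (card ?S)"
  have M: "M = n * (n - 1) / 2" by (simp add: M_def card_pairs)
  have M_pos: "M > 0"
    using A finite_configurations by (auto simp: M_def card_gt_0_iff)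
  then have "n * (n - 1) > 0" by (simp add: M)
  with n_pos have n1: "n > 1" unfolding zero_less_mult_iff by linarith
  have poincare: "(\<Sum>A\<in>?S. (f A)\<^sup>2) \<le> (10 * t) * dirichlet E switch ?S f" if "(\<Sum>A\<in>?S. f A) = 0" for f
  proof -
    have "(\<Sum>A\<in>?S. (f A)\<^sup>2) \<le> 5 * (2 * t) * dirichlet E switch ?S f"
      by (rule pair_poincare[OF vertex_poincare[OF bound] _ that]) (use t in auto)
    then show ?thesis by simp
  qed
  have sum_ind: "(\<Sum>A'\<in>?S. ?P s (indicator {B}) A') = 1" if "B \<in> ?S" for B s
    using that finite_configurations by (simp add: conf.sum_heat indicator_def sum.delta)
  have sq: "(\<Sum>A'\<in>?S. (?P s (indicator {B}) A' - 1 / M)\<^sup>2) = (\<Sum>A'\<in>?S. (?P s (indicator {B}) A')\<^sup>2) - 1 / M" if "B \<in> ?S" for B s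
  proof -
    have "(\<Sum>A'\<in>?S. (?P s (indicator {B}) A' - 1 / M)\<^sup>2) = (\<Sum>A'\<in>?S. (?P s (indicator {B}) A')\<^sup>2)
        - 2 / M * (\<Sum>A'\<in>?S. ?P s (indicator {B}) A') + M * (1 / M)\<^sup>2"
      unfolding M_def by (simp add: power2_diff sum.distrib sum_subtractf sum_distrib_left mult_ac)
    then show ?thesis
      using M_pos sum_ind[OF that] by (simp add: power2_eq_square)
  qed
  have inner: "(\<Sum>A'\<in>?S. ?P s (indicator {B}) A' * ?P s (indicator {B'}) A') = ?P (2 * s) (indicator {B'}) B"
    if "B \<in> ?S" "B' \<in> ?S" "s \<ge> 0" for B B' s
  proof -
    have "(\<Sum>A'\<in>?S. ?P s (indicator {B}) A' * ?P s (indicator {B'}) A')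
        = (\<Sum>A'\<in>?S. indicator {B} A' * ?P s (?P s (indicator {B'})) A')"
      by (rule conf.sum_mult_heat[symmetric])
    also have "\<dots> = ?P s (?P s (indicator {B'})) B"
      using that finite_configurations
      by (simp add: indicator_def sum.delta if_distrib[of "\<lambda>x. x * _"] cong: if_cong)
    also have "\<dots> = ?P (s + s) (indicator {B'}) B"
      by (rule conf.heat_heat[OF that(3,1)])
    finally show ?thesis by simp
  qed
  have p2: "p (2 * t) x y \<le> 3 / (2 * n)" if "x \<in> V" "y \<in> V" for x y
  proof -
    have "p (2 * t) x y = vertex.P t (vertex.P t (indicator {y})) x"
      using vertex.heat_heat[of t x t "indicator {y}"] t that by (simp add: p_def)
    also have "\<dots> \<le> vertex.P t (\<lambda>_. 3 / (2 * n)) x"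
      using bound that t by (intro vertex.heat_mono) (auto simp: p_def)
    finally show ?thesis by simp
  qed
  define \<phi> where "\<phi> B A' = ?P t (indicator {B}) A' - 1 / M" for B A'
  have \<phi>_heat: "?P (15 * t) (\<phi> B) A' = ?P (16 * t) (indicator {B}) A' - 1 / M" if "B \<in> ?S" "A' \<in> ?S" for B A'
    unfolding \<phi>_def using that t
    by (simp add: conf.heat_diff conf.heat_heat)
  have decay: "(\<Sum>A'\<in>?S. (?P (15 * t) (\<phi> B) A')\<^sup>2) \<le> 1 / n\<^sup>2" if B: "B \<in> ?S" for B
  proof -
    have "(\<Sum>A'\<in>?S. \<phi> B A') = 0"
      using sum_ind[OF B] M_pos by (simp add: \<phi>_def sum_subtractf M_def[symmetric])
    then have "(\<Sum>A'\<in>?S. (?P (15 * t) (\<phi> B) A')\<^sup>2) \<le> exp (- 2 * (15 * t) / (10 * t)) * (\<Sum>A'\<in>?S. (\<phi> B A')\<^sup>2)"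
      using t by (intro conf.norm_heat_le poincare) auto
    also have "exp (- 2 * (15 * t) / (10 * t)) = inverse (exp 3)"
      using t by (simp add: exp_minus)
    also have "(\<Sum>A'\<in>?S. (\<phi> B A')\<^sup>2) \<le> 9 / n\<^sup>2"
    proof -
      have "(\<Sum>A'\<in>?S. (\<phi> B A')\<^sup>2) \<le> (\<Sum>A'\<in>?S. (?P t (indicator {B}) A')\<^sup>2)"
        unfolding \<phi>_def using sq[OF B, of t] M_pos by simp
      also have "\<dots> = ?P (2 * t) (indicator {B}) B"
        using inner[OF B B, of t] t by (simp add: power2_eq_square)
      also have "\<dots> \<le> (2 * (3 / (2 * n)))\<^sup>2"
        using t by (intro pair_kernel_le[OF p2 B B]) auto
      finally show ?thesis by (simp add: power_divide)
    qed
    also have "inverse (exp 3) * (9 / n\<^sup>2) \<le> 1 / n\<^sup>2"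
    proof -
      \<comment> \<open>The right-hand side is \<open>(3 / 2) ^ 6 = 729 / 64\<close>.\<close>
      have "(9 :: real) \<le> (1 + 3 / real 6) ^ 6" by (simp add: power_divide)
      also have "\<dots> \<le> exp 3" by (rule exp_ge_one_plus_x_over_n_power_n) auto
      finally show ?thesis using n_pos by (simp add: field_simps)
    qed
    finally show ?thesis by simp
  qed
  \<comment> \<open>The square of the sum bounds the inner product of the two deviations from below
    by minus the mean of their squared norms.\<close>
  have "0 \<le> (\<Sum>A'\<in>?S. (?P (15 * t) (\<phi> A) A' + ?P (15 * t) (\<phi> C) A')\<^sup>2)"
    by (intro sum_nonneg) auto
  also have "\<dots> = (\<Sum>A'\<in>?S. (?P (15 * t) (\<phi> A) A')\<^sup>2) + (\<Sum>A'\<in>?S. (?P (15 * t) (\<phi> C) A')\<^sup>2)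
     + 2 * (\<Sum>A'\<in>?S. ?P (15 * t) (\<phi> A) A' * ?P (15 * t) (\<phi> C) A')"
    by (simp add: power2_sum sum.distrib sum_distrib_left mult.assoc)
  also have "(\<Sum>A'\<in>?S. ?P (15 * t) (\<phi> A) A' * ?P (15 * t) (\<phi> C) A')
     = (\<Sum>A'\<in>?S. (?P (16 * t) (indicator {A}) A' - 1 / M) * (?P (16 * t) (indicator {C}) A' - 1 / M))"
    using A C by (intro sum.cong refl) (simp add: \<phi>_heat)
  also have "\<dots> = ?P (32 * t) (indicator {C}) A - 1 / M"
    using inner[OF A C, of "16 * t"] t sum_ind[OF A, of "16 * t"] sum_ind[OF C, of "16 * t"] M_pos
    by (simp add: algebra_simps sum.distrib sum_subtractf sum_divide_distrib[symmetric] M_def[symmetric])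
  finally have "1 / M - 1 / n\<^sup>2 \<le> ?P (32 * t) (indicator {C}) A"
    using decay[OF A] decay[OF C] by simp
  moreover have "1 / n\<^sup>2 \<le> 1 / (n * (n - 1))"
    using n1 by (intro divide_left_mono) (auto simp: power2_eq_square)
  moreover have "1 / M = 2 * (1 / (n * (n - 1)))"
    by (simp add: M)
  ultimately show ?thesis by simp
qed

text \<open>There are \<open>n * D / 2\<close> edges, and the pair occupies each of them with
  probability at least \<open>1 / (n * (n - 1))\<close>.\<close>

lemma adjacency_ge:
  assumes "\<And>x y. x \<in> V \<Longrightarrow> y \<in> V \<Longrightarrow> p t x y \<le> 3 / (2 * n)" and "t > 0"
    and A: "A \<in> \<C> 2"
  shows "real D / (2 * n) \<le> adjacency (32 * t) A"
proof -
  have "n * (n - 1) > 0"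
  proof -
    have "0 < real (card (\<C> 2))"
      using A finite_configurations[of 2] by (auto simp: card_gt_0_iff)
    then show ?thesis by (simp add: card_pairs)
  qed
  with n_pos have n1: "n > 1" unfolding zero_less_mult_iff by linarith
  have "real D / (2 * n) \<le> n * real D / 2 * (1 / (n * (n - 1)))"
    using n1 by (simp add: field_simps)
  also have "\<dots> = (\<Sum>C\<in>E. 1 / (n * (n - 1)))"
    by (simp add: card_edges[symmetric])
  also have "\<dots> \<le> (\<Sum>C\<in>E. conf.P (32 * t) (indicator {C}) A)"
    by (rule sum_mono, rule pair_kernel_ge[OF assms(1,2) A edge_mem])
  also have "\<dots> = adjacency (32 * t) A"
  proof -
    have "adjacency (32 * t) A = (\<Sum>C\<in>\<C> 2. of_bool (C \<in> E) * conf.P (32 * t) (indicator {C}) A)"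
      unfolding adjacency_def by (rule conf.heat_eq_sum_indicator[OF A])
    also have "\<dots> = (\<Sum>C\<in>E. conf.P (32 * t) (indicator {C}) A)"
      using edge_mem finite_configurations by (intro sum.mono_neutral_cong_right) auto
    finally show ?thesis by simp
  qed
  finally show ?thesis .
qed

end

section \<open>Matching a marked particle with free vertices\<close>

text \<open>The symmetric double sum makes the squared difference along a pair a function of the
  unordered pair; the division by 2 undoes the double counting.\<close>

definition sqdiff :: "('v \<Rightarrow> real) \<Rightarrow> 'v set \<Rightarrow> real" where
  "sqdiff q A = (\<Sum>x\<in>A. \<Sum>y\<in>A. (q x - q y)\<^sup>2) / 2"

lemma sqdiff_pair: "x \<noteq> y \<Longrightarrow> sqdiff q {x, y} = (q x - q y)\<^sup>2"
  by (simp add: sqdiff_def power2_commute)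

lemma sqdiff_nonneg: "0 \<le> sqdiff q A"
  by (auto simp: sqdiff_def intro!: sum_nonneg)

lemma sqdiff_cong: "(\<And>x. x \<in> A \<Longrightarrow> q x = q' x) \<Longrightarrow> sqdiff q A = sqdiff q' A"
  by (simp add: sqdiff_def)

context regular_graph
begin

lemma sum_marked: "(\<Sum>s\<in>\<M> j. f s) = (\<Sum>Z\<in>\<C> j. \<Sum>x\<in>V - Z. f (Z, x))"
  using finite_configurations finite_V unfolding marked_configurations_def
  by (subst sum.Sigma) auto

lemma sum_switch_complement:
  assumes "e \<in> E"
  shows "(\<Sum>x\<in>V - Z. f (flip e x)) = (\<Sum>y\<in>V - switch e Z. f y)"
proof (rule sum.reindex_bij_witness[where i = "flip e" and j = "flip e"])
  fix y assume "y \<in> V - switch e Z"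
  then show "flip e y \<in> V - Z"
    using assms flip_closed[OF assms] flip_flip[OF card_edge[OF assms]]
    by (auto simp: switch_image) (metis imageI)
next
  fix x assume "x \<in> V - Z"
  then show "flip e x \<in> V - switch e Z"
    using assms flip_closed[OF assms] by (auto simp: switch_image flip_eq_iff)
qed (use assms in \<open>auto simp: flip_flip card_edge\<close>)

lemma switch_disjoint: "e \<inter> Z = {} \<Longrightarrow> switch e Z = Z"
  by (simp add: switch_def)

section \<open>Edges used before any edge touching them\<close>

definition touching :: "'v set \<Rightarrow> real" where
  "touching e = real (card {e' \<in> E. e' \<inter> e \<noteq> {}})"

lemma touching_bounds:
  assumes "e \<in> E"
  shows "1 \<le> touching e" "touching e \<le> real (card E)" "touching e \<le> 2 * real D"
proof -
  have "{e} \<subseteq> {e' \<in> E. e' \<inter> e \<noteq> {}}"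
    using assms card_edge[OF assms] by auto
  from card_mono[OF _ this] show "1 \<le> touching e"
    using finite_edges by (simp add: touching_def)
  show "touching e \<le> real (card E)"
    unfolding touching_def using finite_edges by (auto intro!: card_mono)
  obtain u v where e: "e = {u, v}" "u \<in> V" "v \<in> V"
    using pair_cases[OF edge_mem[OF assms]] by metis
  have "card {e' \<in> E. e' \<inter> e \<noteq> {}} \<le> card ({e' \<in> E. u \<in> e'} \<union> {e' \<in> E. v \<in> e'})"
    using finite_edges e by (intro card_mono) auto
  also have "\<dots> \<le> D + D"
    using card_Un_le[of "{e' \<in> E. u \<in> e'}" "{e' \<in> E. v \<in> e'}"] e by (simp add: degree)
  finally show "touching e \<le> 2 * real D" by (simp add: touching_def)
qed

text \<open>The probability that \<open>e\<close> occurs among the first \<open>M\<close> updates before any edge touching it.\<close>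

definition first_use :: "nat \<Rightarrow> 'v set \<Rightarrow> real" where
  "first_use M e = (1 - (1 - touching e / real (card E)) ^ M) / touching e"

lemma first_use_nonneg:
  assumes "e \<in> E"
  shows "0 \<le> first_use M e"
proof -
  have "(1 - touching e / real (card E)) ^ M \<le> 1"
    using touching_bounds[OF assms] vertex.card_E_pos
    by (intro power_le_one) (auto simp: field_simps)
  then show ?thesis using touching_bounds(1)[OF assms] by (simp add: first_use_def)
qed

text \<open>First-step analysis: the first update is either \<open>e\<close> itself, which is a
  success, or one of the edges disjoint from \<open>e\<close>, after which \<open>M\<close> updates
  remain; any other touching edge is a failure.\<close>

lemma first_use_Suc:
  assumes "e \<in> E"
  shows "real (card E) * first_use (Suc M) e = 1 + (real (card E) - touching e) * first_use M e"
proof -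
  define s c \<rho> where "s = touching e" "c = real (card E)" "\<rho> = (1 - s / c) ^ M"
  have "s > 0" "c > 0"
    using touching_bounds(1)[OF assms] vertex.card_E_pos by (auto simp: s_c_\<rho>_def)
  then have "c * ((1 - (1 - s / c) * \<rho>) / s) = 1 + (c - s) * ((1 - \<rho>) / s)"
    by (simp add: field_simps)
  then show ?thesis by (simp add: first_use_def s_c_\<rho>_def)
qed

text \<open>If \<open>q\<close> is a probability vector on the complement of \<open>Z\<close>, the
  mean of \<open>test g\<close> under \<open>q\<close> is the sum of squares of \<open>q\<close>
  minus the squared distance of \<open>q\<close> and \<open>g (Z, _)\<close>. So \<open>test\<close>
  linearises the sum of squares, and the supremum is attained where \<open>g\<close> agrees with
  \<open>q\<close>.\<close>

definition test :: "('v set \<times> 'v \<Rightarrow> real) \<Rightarrow> 'v set \<times> 'v \<Rightarrow> real" where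
  "test g s = 2 * g s - (\<Sum>y\<in>V - fst s. (g (fst s, y))\<^sup>2)"

abbreviation "mean q Z h \<equiv> \<Sum>x\<in>V - Z. q x * h (Z, x)"
abbreviation "sqsum q Z \<equiv> \<Sum>x\<in>V - Z. (q x)\<^sup>2"
abbreviation "free_edges Z \<equiv> {e \<in> E. e \<inter> Z = {}}"
abbreviation "free_pairs Z \<equiv> {A \<in> \<C> 2. A \<inter> Z = {}}"
abbreviation "mass q Z \<equiv> \<Sum>x\<in>V - Z. q x"

lemma sum_test_le:
  assumes "mass q Z = 1"
  shows "(mean q Z (test g)) \<le> (sqsum q Z)"
proof -
  have "(mean q Z (test g)) = (\<Sum>x\<in>V - Z. 2 * q x * g (Z, x)) - (\<Sum>x\<in>V - Z. q x) * (\<Sum>x\<in>V - Z. (g (Z, x))\<^sup>2)"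
    by (simp add: test_def right_diff_distrib sum_subtractf sum_distrib_right mult_ac)
  also have "\<dots> = (\<Sum>x\<in>V - Z. (q x)\<^sup>2 - (q x - g (Z, x))\<^sup>2)"
    by (simp add: assms power2_diff sum_subtractf sum.distrib)
  also have "\<dots> \<le> (sqsum q Z)"
    by (intro sum_mono) simp
  finally show ?thesis .
qed

lemma sum_lazy_step_marked:
  "(mean q Z (marked.B H))
    = (\<Sum>e\<in>E. ((mean q Z H) + (\<Sum>x\<in>V - Z. q x * H (switch e Z, flip e x))) / 2) / real (card E)"
proof -
  have "(mean q Z (marked.B H))
    = (\<Sum>x\<in>V - Z. \<Sum>e\<in>E. (q x * H (Z, x) + q x * H (switch e Z, flip e x)) / (2 * real (card E)))"
    by (simp add: lazy_step_def marked_switch_def sum_divide_distrib sum_distrib_left distrib_left)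
  also have "\<dots> = (\<Sum>e\<in>E. \<Sum>x\<in>V - Z. (q x * H (Z, x) + q x * H (switch e Z, flip e x)) / (2 * real (card E)))"
    by (rule sum.swap)
  also have "\<dots> = (\<Sum>e\<in>E. ((mean q Z H) + (\<Sum>x\<in>V - Z. q x * H (switch e Z, flip e x))) / 2 / real (card E))"
    by (intro sum.cong refl) (simp add: sum_divide_distrib[symmetric] sum.distrib)
  finally show ?thesis by (simp add: sum_divide_distrib)
qed

lemma sum_swapped: "e \<in> E \<Longrightarrow> (\<Sum>x\<in>V - Z. q x * H (switch e Z, flip e x))
   = (\<Sum>y\<in>V - switch e Z. q (flip e y) * H (switch e Z, y))"
  using sum_switch_complement[of e "\<lambda>y. q (flip e y) * H (switch e Z, y)" Z]
  by (simp add: flip_flip card_edge)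

text \<open>The pairs matched here are the endpoints of edges that are used before all edges touching
  them: averaging over such an edge commutes with the earlier updates, so it may be performed first.\<close>

lemma funpow_test_le:
  assumes "Z \<in> \<C> j" "mass q Z = 1"
  shows "mean q Z ((marked.B ^^ M) (test g))
    \<le> sqsum q Z - (\<Sum>e\<in>free_edges Z. first_use M e * sqdiff q e) / 2"
  using assms
proof (induction M arbitrary: Z q)
  case 0
  then show ?case using sum_test_le[of q Z g] by (simp add: first_use_def)
next
  case (Suc M)
  define H where "H = (marked.B ^^ M) (test g)"
  let ?Q = "sqsum q Z"
  let ?free = "free_edges Z"
  let ?u = "\<lambda>q e. first_use M e * sqdiff q e"
  let ?kept = "\<lambda>e e'. (if e' \<inter> e = {} then ?u q e' else 0)"
  let ?own = "\<lambda>e e'. (if e' = e then sqdiff q e' else 0)"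
  let ?swapped = "\<lambda>e. (\<Sum>x\<in>V - Z. q x * H (switch e Z, flip e x))"
  have IH: "(mean q Z H)
      \<le> (sqsum q Z) - (\<Sum>e\<in>free_edges Z. ?u q e) / 2"
    if "Z \<in> \<C> j" "mass q Z = 1" for Z q
    unfolding H_def by (rule Suc.IH[OF that])
  have step: "((mean q Z H) + (?swapped e)) / 2
    \<le> ?Q - (\<Sum>e'\<in>?free. (?own e e')
          + (?kept e e')) / 2" if e: "e \<in> E" for e
  proof -
    let ?R = "\<Sum>e'\<in>?free. (?kept e e')"
    have nonneg: "0 \<le> ?u q' e'" if "e' \<in> E" for e' q'
      by (intro mult_nonneg_nonneg first_use_nonneg that sqdiff_nonneg)
    have Q_swap: "(\<Sum>y\<in>V - switch e Z. (q (flip e y))\<^sup>2) = ?Q"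
      using sum_switch_complement[OF e, of "\<lambda>y. (q (flip e y))\<^sup>2" Z] e
      by (simp add: flip_flip card_edge)
    have mass_swap: "(\<Sum>y\<in>V - switch e Z. q (flip e y)) = 1"
      using sum_switch_complement[OF e, of "\<lambda>y. q (flip e y)" Z] e Suc.prems(2)
      by (simp add: flip_flip card_edge)
    show ?thesis
    proof (cases "e \<inter> Z = {}")
      \<comment> \<open>Both outcomes of the coin leave \<open>Z\<close> unchanged, so they combine
        into a single vector, the average of \<open>q\<close> along \<open>e\<close>. This gains
        half of \<open>sqdiff q e\<close>; the edges disjoint from \<open>e\<close> keep their
        differences, and those touching \<open>e\<close> are given up.\<close>
      case True
      then have Z: "switch e Z = Z" by (rule switch_disjoint)
      define q' where "q' x = (q x + q (flip e x)) / 2" for x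
      have "((mean q Z H) + (?swapped e)) / 2
        = (\<Sum>x\<in>V - Z. q' x * H (Z, x))"
        unfolding sum_swapped[OF e] unfolding Z
        by (simp add: q'_def sum.distrib[symmetric] sum_divide_distrib distrib_right add_divide_distrib)
      also have "\<dots> \<le> (\<Sum>x\<in>V - Z. (q' x)\<^sup>2) - (\<Sum>e'\<in>?free. ?u q' e') / 2"
      proof (rule IH[OF Suc.prems(1)])
        show "(\<Sum>x\<in>V - Z. q' x) = 1"
          using mass_swap Suc.prems(2) by (simp add: q'_def Z sum.distrib sum_divide_distrib[symmetric])
      qed
      also have "(\<Sum>x\<in>V - Z. (q' x)\<^sup>2) = ?Q - sqdiff q e / 2"
      proof -
        have "(q' x)\<^sup>2 = (q x)\<^sup>2 / 2 + (q (flip e x))\<^sup>2 / 2 - (q x - q (flip e x))\<^sup>2 / 4" for x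
          by (simp add: q'_def power2_eq_square field_simps)
        then have "(\<Sum>x\<in>V - Z. (q' x)\<^sup>2) = ?Q - (\<Sum>x\<in>V - Z. (q x - q (flip e x))\<^sup>2) / 4"
          using Q_swap by (simp add: Z sum.distrib sum_subtractf sum_divide_distrib[symmetric])
        moreover have "(\<Sum>x\<in>V - Z. (q x - q (flip e x))\<^sup>2) = (\<Sum>x\<in>e. (q x - q (flip e x))\<^sup>2)"
          using True edges[OF e] finite_V by (intro sum.mono_neutral_right) (auto simp: flip_notin)
        moreover obtain u v where "e = {u, v}" "u \<noteq> v"
          using pair_cases[OF edge_mem[OF e]] by metis
        ultimately show ?thesis
          by (simp add: flip_pair sqdiff_pair power2_commute[of "q v"])
      qed
      finally have "((mean q Z H) + (?swapped e)) / 2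
        \<le> ?Q - sqdiff q e / 2 - (\<Sum>e'\<in>?free. ?u q' e') / 2" .
      moreover have "?R \<le> (\<Sum>e'\<in>?free. ?u q' e')"
      proof (rule sum_mono)
        fix e' assume e': "e' \<in> ?free"
        have "sqdiff q' e' = sqdiff q e'" if "e' \<inter> e = {}"
          using that by (intro sqdiff_cong) (auto simp: q'_def flip_notin disjoint_iff)
        then show "(?kept e e') \<le> ?u q' e'"
          using nonneg[of e' q'] e' by auto
      qed
      ultimately have *: "((mean q Z H) + (?swapped e)) / 2
        \<le> ?Q - (sqdiff q e + ?R) / 2"
        by (simp add: add_divide_distrib)
      have "(\<Sum>e'\<in>?free. if e' = e then sqdiff q e' else 0) = sqdiff q e"
        using e True finite_edges by (simp add: sum.delta)
      then show ?thesis using * by (simp add: sum.distrib)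
    next
      \<comment> \<open>Here the two outcomes may lead to different sets, and the induction
        hypothesis is applied to each separately. A free edge disjoint from \<open>e\<close> is free
        in both, with the same difference of values.\<close>
      case False
      have "(mean q Z H) \<le> ?Q - (\<Sum>e'\<in>?free. ?u q e') / 2"
        by (rule IH[OF Suc.prems])
      moreover have "(\<Sum>e'\<in>?free. ?u q e') \<ge> ?R"
        using nonneg by (intro sum_mono) auto
      moreover have "(?swapped e) \<le> ?Q - ?R / 2"
      proof -
        let ?q = "\<lambda>x. q (flip e x)"
        let ?free' = "{e' \<in> E. e' \<inter> switch e Z = {}}"
        have "(?swapped e)
          \<le> ?Q - (\<Sum>e'\<in>?free'. ?u ?q e') / 2"
          using IH[OF switch_mem_configurations[OF e Suc.prems(1)] mass_swap] Q_swap
          by (simp add: sum_swapped[OF e])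
        moreover have "?R \<le> (\<Sum>e'\<in>?free'. ?u ?q e')"
        proof -
          have "?R = (\<Sum>e'\<in>{e' \<in> ?free. e' \<inter> e = {}}. ?u q e')"
            using finite_edges by (simp add: sum.inter_filter[symmetric])
          also have "\<dots> = (\<Sum>e'\<in>{e' \<in> ?free. e' \<inter> e = {}}. ?u ?q e')"
          proof (rule sum.cong[OF refl])
            fix e' assume "e' \<in> {e' \<in> ?free. e' \<inter> e = {}}"
            then have "sqdiff q e' = sqdiff ?q e'"
              by (intro sqdiff_cong) (auto simp: flip_notin disjoint_iff)
            then show "?u q e' = ?u ?q e'" by simp
          qed
          also have "\<dots> \<le> (\<Sum>e'\<in>?free'. ?u ?q e')"
            using nonneg finite_edges by (intro sum_mono2) (auto simp: switch_def split: if_splits)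
          finally show ?thesis .
        qed
        ultimately show ?thesis by linarith
      qed
      moreover have "(\<Sum>e'\<in>?free. if e' = e then sqdiff q e' else 0) = 0"
        using False by (intro sum.neutral) auto
      ultimately show ?thesis by (simp add: sum.distrib)
    qed
  qed
  \<comment> \<open>Summed over the first update, the terms kept for \<open>e'\<close> reproduce the
    recursion for \<open>first_use\<close>.\<close>
  have sum_e: "(\<Sum>e\<in>E. (?own e e') + (?kept e e'))
     = real (card E) * first_use (Suc M) e' * sqdiff q e'" if e': "e' \<in> E" for e'
  proof -
    have "{e \<in> E. e' \<inter> e = {}} = E - {e \<in> E. e \<inter> e' \<noteq> {}}" by auto
    then have "real (card {e \<in> E. e' \<inter> e = {}}) = real (card E) - touching e'"
      using finite_edges touching_bounds(2)[OF e']
      by (simp add: card_Diff_subset touching_def of_nat_diff)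
    moreover have "(\<Sum>e\<in>E. if e' \<inter> e = {} then ?u q e' else 0)
       = real (card {e \<in> E. e' \<inter> e = {}}) * (?u q e')"
      using finite_edges by (simp add: sum.inter_filter[symmetric])
    moreover have "(\<Sum>e\<in>E. if e' = e then sqdiff q e' else 0) = sqdiff q e'"
      using finite_edges e' by (simp add: sum.delta)
    ultimately show ?thesis
      unfolding first_use_Suc[OF e'] sum.distrib by (simp only: distrib_right mult_1 mult.assoc)
  qed
  have "(mean q Z ((marked.B ^^ Suc M) (test g)))
    = (mean q Z (marked.B H))"
    by (simp add: H_def)
  also have "\<dots> \<le> (\<Sum>e\<in>E. ?Q - (\<Sum>e'\<in>?free. (?own e e')
          + (?kept e e')) / 2) / real (card E)"
    unfolding sum_lazy_step_marked using step by (intro divide_right_mono sum_mono) auto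
  also have "\<dots> = ?Q - (\<Sum>e\<in>E. \<Sum>e'\<in>?free. (?own e e')
          + (?kept e e')) / 2 / real (card E)"
    using vertex.card_E_pos by (simp add: sum_subtractf diff_divide_distrib sum_divide_distrib[symmetric])
  also have "(\<Sum>e\<in>E. \<Sum>e'\<in>?free. (?own e e')
          + (?kept e e'))
     = (\<Sum>e'\<in>?free. real (card E) * first_use (Suc M) e' * sqdiff q e')"
    by (subst sum.swap) (intro sum.cong refl sum_e, simp)
  also have "\<dots> = real (card E) * (\<Sum>e'\<in>?free. first_use (Suc M) e' * sqdiff q e')"
    by (simp add: sum_distrib_left mult.assoc)
  finally show ?case
    using vertex.card_E_pos by simp
qed

lemma sum_heat_marked_sums:
  assumes "Z \<in> \<C> j"
  shows "(\<lambda>M. exp (- (2 * real (card E) * t)) * ((2 * real (card E) * t) ^ M / fact M)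
      * (mean q Z ((marked.B ^^ M) h)))
     sums (mean q Z (marked.P t h))"
proof -
  let ?w = "\<lambda>M. exp (- (2 * real (card E) * t)) * ((2 * real (card E) * t) ^ M / fact M)"
  have "(\<lambda>M. \<Sum>x\<in>V - Z. q x * (?w M * (marked.B ^^ M) h (Z, x)))
     sums (mean q Z (marked.P t h))"
    unfolding heat_def using assms
    by (intro sums_sum sums_mult summable_sums marked.summable_heat[of _ j]) (auto simp: marked_configurations_def)
  moreover have "(\<Sum>x\<in>V - Z. q x * (?w M * (marked.B ^^ M) h (Z, x)))
      = ?w M * (mean q Z ((marked.B ^^ M) h))" for M
    unfolding sum_distrib_left by (intro sum.cong refl) simp
  ultimately show ?thesis by simp
qed

text \<open>With a Poisson number of updates of mean \<open>2 * card E\<close>,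
  \<open>first_use\<close> averages to \<open>(1 - exp (- 2 * touching e)) / touching e\<close>. As
  \<open>touching e\<close> lies between 1 and \<open>2 * D\<close>, this is at least
  \<open>1 / (4 * D)\<close>, and half of it is gained.\<close>

lemma heat_test_le:
  assumes "Z \<in> \<C> j" "mass q Z = 1"
  shows "(mean q Z (marked.P 1 (test g)))
    \<le> sqsum q Z - (\<Sum>e\<in>free_edges Z. sqdiff q e) / (8 * real D)"
proof -
  let ?c = "real (card E)" and ?Q = "sqsum q Z" and ?free = "free_edges Z"
  let ?w = "\<lambda>M. exp (- (2 * ?c)) * ((2 * ?c) ^ M / fact M)"
  let ?kept = "\<lambda>e M. (?w M * 1 ^ M - ?w M * (1 - touching e / ?c) ^ M) * (sqdiff q e / touching e)"
  let ?lhs = "(mean q Z (marked.P 1 (test g)))"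
  have w1: "(\<lambda>M. ?w M * x ^ M) sums exp (- (2 * ?c) + 2 * ?c * x)" for x
    by (rule poisson_sums)
  have "(\<lambda>M. ?w M * 1 ^ M * ?Q - (\<Sum>e\<in>?free. (?kept e M)) / 2)
     sums (exp (- (2 * ?c) + 2 * ?c * 1) * ?Q - (\<Sum>e\<in>?free. (exp (- (2 * ?c) + 2 * ?c * 1)
         - exp (- (2 * ?c) + 2 * ?c * (1 - touching e / ?c))) * (sqdiff q e / touching e)) / 2)"
    by (intro sums_diff sums_mult2 sums_sum sums_divide w1)
  moreover have "?w M * 1 ^ M * ?Q - (\<Sum>e\<in>?free. (?kept e M)) / 2
      = ?w M * (?Q - (\<Sum>e\<in>?free. first_use M e * sqdiff q e) / 2)" for M
  proof -
    have "(\<Sum>e\<in>?free. (?kept e M))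
       = ?w M * (\<Sum>e\<in>?free. first_use M e * sqdiff q e)"
      unfolding sum_distrib_left first_use_def
      by (intro sum.cong refl) (simp add: right_diff_distrib diff_divide_distrib left_diff_distrib)
    then show ?thesis by (simp add: right_diff_distrib)
  qed
  moreover have "exp (- (2 * ?c) + 2 * ?c * (1 - touching e / ?c)) = exp (- 2 * touching e)" for e
    using vertex.card_E_pos by (simp add: right_diff_distrib)
  ultimately have rhs: "(\<lambda>M. ?w M * (?Q - (\<Sum>e\<in>?free. first_use M e * sqdiff q e) / 2))
     sums (?Q - (\<Sum>e\<in>?free. (1 - exp (- 2 * touching e)) * (sqdiff q e / touching e)) / 2)"
    by simp
  have lhs: "(\<lambda>M. ?w M * (mean q Z ((marked.B ^^ M) (test g))))
     sums ?lhs"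
    using sum_heat_marked_sums[OF assms(1), of 1 q "test g"] by simp
  have "?lhs
     \<le> ?Q - (\<Sum>e\<in>?free. (1 - exp (- 2 * touching e)) * (sqdiff q e / touching e)) / 2"
    by (rule sums_le[OF _ lhs rhs]) (rule mult_left_mono[OF funpow_test_le[OF assms]], simp)
  also have "\<dots> \<le> ?Q - (\<Sum>e\<in>?free. 1 / (4 * real D) * sqdiff q e) / 2"
  proof (intro diff_left_mono divide_right_mono sum_mono)
    fix e assume "e \<in> ?free"
    then have b: "1 \<le> touching e" "touching e \<le> 2 * real D" using touching_bounds by auto
    have "exp (- 2 * touching e) \<le> exp (- ln 2)"
      using b ln_2_less_1 by (subst exp_le_cancel_iff) linarith
    then have "1 / 2 \<le> 1 - exp (- 2 * touching e)" by (simp add: exp_minus)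
    moreover have "1 / (2 * real D) \<le> 1 / touching e"
      using b by (intro divide_left_mono) auto
    ultimately have "1 / 2 * (1 / (2 * real D)) \<le> (1 - exp (- 2 * touching e)) * (1 / touching e)"
      using b by (intro mult_mono) auto
    from mult_right_mono[OF this sqdiff_nonneg[of q e]]
    show "1 / (4 * real D) * sqdiff q e \<le> (1 - exp (- 2 * touching e)) * (sqdiff q e / touching e)"
      by simp
  qed simp
  finally show ?thesis by (simp add: sum_divide_distrib)
qed

section \<open>Transport of the gain through a preceding time interval\<close>

lemma sqdiff_switch: "e \<in> E \<Longrightarrow> sqdiff (\<lambda>x. q (flip e x)) (switch e A) = sqdiff q A"
proof -
  assume e: "e \<in> E"
  have inj: "inj_on (flip e) A"
    using e by (auto intro!: inj_onI simp: flip_eq_iff)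
  show ?thesis
    unfolding sqdiff_def switch_image[OF e] using e
    by (simp add: sum.reindex[OF inj] flip_flip card_edge)
qed

lemma sum_free_pairs_switch:
  fixes f :: "'v set \<Rightarrow> real"
  assumes "e \<in> E"
  shows "(\<Sum>A\<in>free_pairs (switch e Z). f A)
     = (\<Sum>A\<in>free_pairs Z. f (switch e A))"
proof (rule sum.reindex_bij_witness[where i = "switch e" and j = "switch e"])
  have disj: "switch e A \<inter> switch e B = {} \<longleftrightarrow> A \<inter> B = {}" for A B
    using assms inj_flip[OF card_edge[OF assms]]
    by (simp add: switch_image image_Int[symmetric])
  fix A
  show "A \<in> free_pairs (switch e Z) \<Longrightarrow> switch e A \<in> free_pairs Z"
    using assms disj[of A "switch e Z"] by (auto simp: switch_mem_configurations switch_switch)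
  show "A \<in> free_pairs Z \<Longrightarrow> switch e A \<in> free_pairs (switch e Z)"
    using assms disj[of A Z] by (simp add: switch_mem_configurations)
qed (use assms in \<open>auto simp: switch_switch\<close>)

text \<open>\<open>h\<close> is evaluated after time \<open>t\<close>. A switch moves
  \<open>Z\<close>, \<open>q\<close> and the free pairs simultaneously, so each update preserves the
  sum of squares and the squared differences, while the weights \<open>f\<close> are averaged
  exactly as in the exclusion process with two particles.\<close>

lemma heat_pairs_le:
  assumes H: "\<And>Z q. Z \<in> \<C> j \<Longrightarrow> mass q Z = 1 \<Longrightarrow>
      (mean q Z h) \<le> (sqsum q Z)
         - \<kappa> * (\<Sum>A\<in>free_pairs Z. f A * sqdiff q A)"
    and "Z \<in> \<C> j" "mass q Z = 1" "t \<ge> 0"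
  shows "(mean q Z (marked.P t h)) \<le> (sqsum q Z)
         - \<kappa> * (\<Sum>A\<in>free_pairs Z. conf.P t f A * sqdiff q A)"
proof -
  have funpow: "(mean q Z ((marked.B ^^ M) h)) \<le> (sqsum q Z)
         - \<kappa> * (\<Sum>A\<in>free_pairs Z. (conf.B ^^ M) f A * sqdiff q A)"
    if "Z \<in> \<C> j" "mass q Z = 1" for M Z q
    using that
  proof (induction M arbitrary: Z q)
    case 0
    then show ?case using H by simp
  next
    case (Suc M)
    define G where "G = (marked.B ^^ M) h"
    define f' where "f' = (conf.B ^^ M) f"
    let ?Q = "sqsum q Z" and ?free = "free_pairs Z"
    have step: "((mean q Z G) + (\<Sum>x\<in>V - Z. q x * G (switch e Z, flip e x))) / 2
       \<le> ?Q - \<kappa> * (\<Sum>A\<in>?free. (f' A + f' (switch e A)) / 2 * sqdiff q A)" if e: "e \<in> E" for e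
    proof -
      let ?q = "\<lambda>x. q (flip e x)"
      have 1: "(mean q Z G) \<le> ?Q - \<kappa> * (\<Sum>A\<in>?free. f' A * sqdiff q A)"
        unfolding G_def f'_def by (rule Suc.IH[OF Suc.prems])
      have "(\<Sum>y\<in>V - switch e Z. ?q y) = 1"
        using sum_switch_complement[OF e, of ?q Z] e Suc.prems(2)
        by (simp add: flip_flip card_edge)
      from Suc.IH[OF switch_mem_configurations[OF e Suc.prems(1)] this]
      have "(\<Sum>x\<in>V - Z. q x * G (switch e Z, flip e x)) \<le> (\<Sum>x\<in>V - switch e Z. (?q x)\<^sup>2)
         - \<kappa> * (\<Sum>A\<in>free_pairs (switch e Z). f' A * sqdiff ?q A)"
        unfolding sum_swapped[OF e] G_def f'_def .
      also have "(\<Sum>x\<in>V - switch e Z. (?q x)\<^sup>2) = ?Q"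
        using sum_switch_complement[OF e, of "\<lambda>y. (?q y)\<^sup>2" Z] e
        by (simp add: flip_flip card_edge)
      also have "(\<Sum>A\<in>free_pairs (switch e Z). f' A * sqdiff ?q A)
         = (\<Sum>A\<in>?free. f' (switch e A) * sqdiff q A)"
        unfolding sum_free_pairs_switch[OF e] by (simp add: sqdiff_switch[OF e])
      finally show ?thesis
        using 1 by (simp add: sum.distrib sum_divide_distrib[symmetric] distrib_right distrib_left add_divide_distrib)
    qed
    have "(mean q Z ((marked.B ^^ Suc M) h))
      = (mean q Z (marked.B G))"
      by (simp add: G_def)
    also have "\<dots> \<le> (\<Sum>e\<in>E. ?Q - \<kappa> * (\<Sum>A\<in>?free. (f' A + f' (switch e A)) / 2 * sqdiff q A)) / real (card E)"
      unfolding sum_lazy_step_marked using step by (intro divide_right_mono sum_mono) auto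
    also have "\<dots> = ?Q - \<kappa> * ((\<Sum>e\<in>E. \<Sum>A\<in>?free. (f' A + f' (switch e A)) / 2 * sqdiff q A) / real (card E))"
      using vertex.card_E_pos
      by (simp add: sum_subtractf diff_divide_distrib sum_distrib_left[symmetric])
    also have "(\<Sum>e\<in>E. \<Sum>A\<in>?free. (f' A + f' (switch e A)) / 2 * sqdiff q A) / real (card E)
       = (\<Sum>A\<in>?free. conf.B f' A * sqdiff q A)"
      unfolding lazy_step_def
      by (subst sum.swap) (simp add: sum_divide_distrib sum_distrib_right)
    finally show ?case by (simp add: f'_def)
  qed
  let ?Q = "sqsum q Z" and ?free = "free_pairs Z"
  let ?l = "2 * real (card E) * t"
  let ?w = "\<lambda>M. exp (- ?l) * (?l ^ M / fact M)"
  have w: "?w sums 1"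
    using poisson_sums[of ?l 1] by simp
  have "(\<lambda>M. ?w M * ?Q - \<kappa> * (\<Sum>A\<in>?free. ?w M * (conf.B ^^ M) f A * sqdiff q A))
    sums (1 * ?Q - \<kappa> * (\<Sum>A\<in>?free. conf.P t f A * sqdiff q A))"
    unfolding heat_def
    by (intro sums_diff sums_mult2 sums_mult sums_sum w summable_sums conf.summable_heat[of _ 2]) auto
  then have rhs: "(\<lambda>M. ?w M * (?Q - \<kappa> * (\<Sum>A\<in>?free. (conf.B ^^ M) f A * sqdiff q A)))
    sums (?Q - \<kappa> * (\<Sum>A\<in>?free. conf.P t f A * sqdiff q A))"
    by (simp add: right_diff_distrib sum_distrib_left mult_ac)
  show ?thesis
    by (rule sums_le[OF _ sum_heat_marked_sums[OF assms(2)] rhs])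
       (use assms in \<open>intro mult_left_mono funpow; simp\<close>)
qed

end

section \<open>Contraction of the conditional second moment\<close>

context regular_graph
begin

text \<open>For a joint law \<open>F\<close> each summand is the mass of \<open>Z\<close> times the
  sum of squares of the conditional law of the next ball; since \<open>x / 0 = 0\<close>, sets of
  mass zero contribute nothing.\<close>

definition \<Psi> :: "nat \<Rightarrow> ('v set \<times> 'v \<Rightarrow> real) \<Rightarrow> real" where
  "\<Psi> j F = (\<Sum>Z\<in>\<C> j. (\<Sum>x\<in>V - Z. (F (Z, x))\<^sup>2) / (\<Sum>x\<in>V - Z. F (Z, x)))"

text \<open>\<open>\<Psi>\<close> is a supremum of the linear functionals given by \<open>test g\<close>, so a bound for these on each
  fibre over \<open>Z\<close>, where \<open>F\<close> is a multiple of a probability vector \<open>q\<close>, is enough.\<close>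

lemma Psi_heat_le:
  assumes fibre: "\<And>Z q g. Z \<in> \<C> j \<Longrightarrow> (\<And>x. x \<in> V - Z \<Longrightarrow> 0 \<le> q x) \<Longrightarrow> mass q Z = 1 \<Longrightarrow>
      (mean q Z (marked.P t (test g))) \<le> a * (sqsum q Z) + b"
    and F: "\<And>s. s \<in> \<M> j \<Longrightarrow> 0 \<le> F s" and t: "t \<ge> 0"
  shows "\<Psi> j (marked.P t F) \<le> a * \<Psi> j F + b * (\<Sum>s\<in>\<M> j. F s)"
proof -
  define F' where "F' = marked.P t F"
  let ?q = "\<lambda>Z. (\<Sum>x\<in>V - Z. (F' (Z, x))\<^sup>2)"
  define m where "m F Z = (\<Sum>x\<in>V - Z. F (Z, x))" for F :: "'v set \<times> 'v \<Rightarrow> real" and Z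
  \<comment> \<open>The conditional law at the later time is the optimal test function: with it the
    linear functional equals \<open>\<Psi> j F'\<close>.\<close>
  define g where "g s = F' s / m F' (fst s)" for s
  have F_nonneg: "0 \<le> F (Z, x)" if "Z \<in> \<C> j" "x \<in> V - Z" for Z x
    using F that by (simp add: marked_configurations_def)
  have F'_nonneg: "0 \<le> F' (Z, x)" if "Z \<in> \<C> j" "x \<in> V - Z" for Z x
    unfolding F'_def using that F t
    by (intro marked.heat_nonneg[of j]) (auto simp: marked_configurations_def)
  have "(?q Z) / m F' Z = (\<Sum>x\<in>V - Z. F' (Z, x) * test g (Z, x))"
    if Z: "Z \<in> \<C> j" for Z
  proof (cases "m F' Z = 0")
    case True
    then have "F' (Z, x) = 0" if "x \<in> V - Z" for x
      using sum_nonneg_eq_0_iff[of "V - Z" "\<lambda>x. F' (Z, x)"] F'_nonneg[OF Z] finite_V that by (auto simp: m_def)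
    then show ?thesis by simp
  next
    case False
    have "(\<Sum>x\<in>V - Z. F' (Z, x) * test g (Z, x))
       = 2 * ((?q Z) / m F' Z) - m F' Z * (\<Sum>x\<in>V - Z. (g (Z, x))\<^sup>2)"
    proof -
      have "(\<Sum>x\<in>V - Z. F' (Z, x) * test g (Z, x))
          = (\<Sum>x\<in>V - Z. 2 * (F' (Z, x) * g (Z, x))) - (\<Sum>x\<in>V - Z. F' (Z, x)) * (\<Sum>x\<in>V - Z. (g (Z, x))\<^sup>2)"
        by (simp add: test_def right_diff_distrib sum_subtractf sum_distrib_right mult_ac)
      also have "(\<Sum>x\<in>V - Z. 2 * (F' (Z, x) * g (Z, x))) = 2 * ((?q Z) / m F' Z)"
        by (simp add: g_def power2_eq_square sum_distrib_left sum_divide_distrib)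
      finally show ?thesis by (simp add: m_def)
    qed
    also have "(\<Sum>x\<in>V - Z. (g (Z, x))\<^sup>2) = (?q Z) / (m F' Z)\<^sup>2"
      by (simp add: g_def power_divide sum_divide_distrib)
    finally show ?thesis using False by (simp add: power2_eq_square)
  qed
  then have "\<Psi> j F' = (\<Sum>s\<in>\<M> j. F' s * test g s)"
    by (simp add: \<Psi>_def m_def sum_marked)
  \<comment> \<open>Reversibility moves the semigroup from the law to the test function, where the
    hypothesis on the fibres applies.\<close>
  also have "\<dots> = (\<Sum>s\<in>\<M> j. F s * marked.P t (test g) s)"
    unfolding F'_def by (rule marked.sum_mult_heat[symmetric])
  also have "\<dots> = (\<Sum>Z\<in>\<C> j. \<Sum>x\<in>V - Z. F (Z, x) * marked.P t (test g) (Z, x))"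
    by (rule sum_marked)
  also have "\<dots> \<le> (\<Sum>Z\<in>\<C> j. a * ((\<Sum>x\<in>V - Z. (F (Z, x))\<^sup>2) / m F Z) + b * m F Z)"
  proof (rule sum_mono)
    fix Z assume Z: "Z \<in> \<C> j"
    have m_nonneg: "0 \<le> m F Z" unfolding m_def by (intro sum_nonneg F_nonneg Z)
    show "(\<Sum>x\<in>V - Z. F (Z, x) * marked.P t (test g) (Z, x))
       \<le> a * ((\<Sum>x\<in>V - Z. (F (Z, x))\<^sup>2) / m F Z) + b * m F Z"
    proof (cases "m F Z = 0")
      case True
      then have "F (Z, x) = 0" if "x \<in> V - Z" for x
        using sum_nonneg_eq_0_iff[of "V - Z" "\<lambda>x. F (Z, x)"] F_nonneg[OF Z] finite_V that by (auto simp: m_def)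
      then show ?thesis using True by simp
    next
      case False
      have "(\<Sum>x\<in>V - Z. F (Z, x) / m F Z) = 1"
        using False by (simp add: sum_divide_distrib[symmetric] m_def[symmetric])
      then have "(\<Sum>x\<in>V - Z. F (Z, x) / m F Z * marked.P t (test g) (Z, x))
         \<le> a * (\<Sum>x\<in>V - Z. (F (Z, x) / m F Z)\<^sup>2) + b"
        using F_nonneg[OF Z] m_nonneg by (intro fibre[OF Z]) auto
      from mult_left_mono[OF this m_nonneg] show ?thesis
        using False by (simp add: sum_distrib_left[symmetric] sum_divide_distrib[symmetric] power_divide
            distrib_left power2_eq_square mult.left_commute[of "m F Z" a] mult.commute[of b])
    qed
  qed
  also have "\<dots> = a * \<Psi> j F + b * (\<Sum>s\<in>\<M> j. F s)"
    by (simp add: \<Psi>_def m_def sum_marked sum.distrib sum_distrib_left)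
  finally show ?thesis by (simp add: F'_def)
qed

lemma Psi_heat_mono:
  assumes "\<And>s. s \<in> \<M> j \<Longrightarrow> 0 \<le> F s" "t \<ge> 0"
  shows "\<Psi> j (marked.P t F) \<le> \<Psi> j F"
proof -
  have "\<Psi> j (marked.P t F) \<le> 1 * \<Psi> j F + 0 * (\<Sum>s\<in>\<M> j. F s)"
  proof (rule Psi_heat_le[OF _ assms])
    fix Z :: "'v set" and q :: "'v \<Rightarrow> real" and g
    assume Z: "Z \<in> \<C> j" and q: "mass q Z = 1"
    \<comment> \<open>With the factor \<open>\<kappa> = 0\<close> only the preservation of the sum
      of squares is left.\<close>
    have "(mean q Z (marked.P t (test g))) \<le> (sqsum q Z)
         - 0 * (\<Sum>A\<in>free_pairs Z. conf.P t (\<lambda>_. 0) A * sqdiff q A)"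
      using sum_test_le by (intro heat_pairs_le[OF _ Z q assms(2)]) simp
    then show "(mean q Z (marked.P t (test g))) \<le> 1 * (sqsum q Z) + 0"
      by simp
  qed
  then show ?thesis by simp
qed

text \<open>One round: the process runs for time \<open>T\<close>, and the matching follows in the
  last unit of time. The weights there are the indicator of the edges, and time \<open>T\<close>
  turns them into \<open>adjacency T\<close>. Counting ordered pairs changes \<open>8 * D\<close>
  into \<open>16 * D\<close>.\<close>

lemma heat_round_le:
  assumes Z: "Z \<in> \<C> j" and q: "mass q Z = 1" and T: "T \<ge> 0"
  shows "(mean q Z (marked.P (T + 1) (test g))) \<le> (sqsum q Z)
     - (\<Sum>x\<in>V - Z. \<Sum>y\<in>V - Z - {x}. adjacency T {x, y} * (q x - q y)\<^sup>2) / (16 * real D)"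
proof -
  let ?pairs = "(\<Sum>A\<in>free_pairs Z. adjacency T A * sqdiff q A)"
  let ?form = "(\<Sum>x\<in>V - Z. \<Sum>y\<in>V - Z - {x}. adjacency T {x, y} * (q x - q y)\<^sup>2)"
  have one: "(mean q Z (marked.P 1 (test g))) \<le> (sqsum q Z)
     - 1 / (8 * real D) * (\<Sum>A\<in>free_pairs Z. of_bool (A \<in> E) * sqdiff q A)"
    if "Z \<in> \<C> j" "mass q Z = 1" for Z q
  proof -
    have "(\<Sum>A\<in>free_pairs Z. of_bool (A \<in> E) * sqdiff q A)
       = (\<Sum>e\<in>free_edges Z. sqdiff q e)"
      using edge_mem finite_configurations by (intro sum.mono_neutral_cong_right) auto
    then show ?thesis using heat_test_le[OF that, of g] by simp
  qed
  have "(\<Sum>x\<in>V - Z. q x * marked.P T (marked.P 1 (test g)) (Z, x)) \<le> (sqsum q Z)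
     - 1 / (8 * real D) * ?pairs"
    unfolding adjacency_def by (rule heat_pairs_le[OF one Z q T])
  moreover have "(\<Sum>x\<in>V - Z. q x * marked.P T (marked.P 1 (test g)) (Z, x))
     = (mean q Z (marked.P (T + 1) (test g)))"
    using Z T by (intro sum.cong refl arg_cong2[where f = "(*)"] marked.heat_heat[of _ _ j])
      (auto simp: marked_configurations_def)
  moreover have "?form
     = 2 * ?pairs"
  proof -
    define f where "f A = (if A \<inter> Z = {} then adjacency T A * sqdiff q A else 0)" for A
    have "2 * ?pairs = 2 * (\<Sum>A\<in>\<C> 2. f A)"
      unfolding f_def using finite_configurations by (simp add: sum.inter_filter)
    also have "\<dots> = (\<Sum>x\<in>V. \<Sum>y\<in>V - {x}. f {x, y})"
      by (rule sum_pairs[symmetric])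
    also have "\<dots> = (\<Sum>x\<in>V - Z. \<Sum>y\<in>V - {x}. f {x, y})"
      using finite_V by (intro sum.mono_neutral_right) (auto simp: f_def)
    also have "\<dots> = (\<Sum>x\<in>V - Z. \<Sum>y\<in>V - Z - {x}. f {x, y})"
      using finite_V by (intro sum.cong sum.mono_neutral_right refl) (auto simp: f_def)
    also have "\<dots> = ?form"
      by (intro sum.cong refl) (auto simp: f_def sqdiff_pair)
    finally show ?thesis by (rule sym)
  qed
  ultimately show ?thesis by simp
qed

section \<open>Local and global rounds\<close>

lemma card_complement: "Z \<in> \<C> j \<Longrightarrow> real (card (V - Z)) = n - real j"
  using finite_V card_mono[OF finite_V, of Z]
  by (auto simp: configurations_def card_Diff_subset finite_subset of_nat_diff)

text \<open>The weights at \<open>x\<close> sum to \<open>D\<close> and each is at most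
  \<open>2 * D * \<eta>\<close>, so the \<open>j\<close> vertices of \<open>Z\<close> take away at
  most \<open>D / 2\<close>. Expanding the square, the diagonal terms give at least \<open>D\<close>
  times the sum of squares, and the mixed terms cost at most \<open>4 * D * \<eta>\<close> because
  \<open>q\<close> has mass 1.\<close>

lemma local_round:
  assumes bound: "\<And>x y. x \<in> V \<Longrightarrow> y \<in> V \<Longrightarrow> p T x y \<le> \<eta>" and \<eta>: "4 * real j * \<eta> \<le> 1" "0 \<le> \<eta>" and T: "T \<ge> 0"
    and F: "\<And>s. s \<in> \<M> j \<Longrightarrow> 0 \<le> F s" "(\<Sum>s\<in>\<M> j. F s) = 1"
  shows "\<Psi> j (marked.P (T + 1) F) \<le> 15 / 16 * \<Psi> j F + \<eta> / 4"
proof -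
  have "\<Psi> j (marked.P (T + 1) F) \<le> 15 / 16 * \<Psi> j F + \<eta> / 4 * (\<Sum>s\<in>\<M> j. F s)"
  proof (rule Psi_heat_le)
    fix Z :: "'v set" and q :: "'v \<Rightarrow> real" and g
    assume Z: "Z \<in> \<C> j" and q_nonneg: "\<And>x. x \<in> V - Z \<Longrightarrow> 0 \<le> q x"
      and q: "mass q Z = 1"
    let ?U = "V - Z" and ?w = "\<lambda>x y. adjacency T {x, y}"
    let ?Q = "\<Sum>x\<in>?U. (q x)\<^sup>2"
    let ?right = "(\<Sum>x\<in>?U. \<Sum>y\<in>?U - {x}. ?w x y * (q y)\<^sup>2)"
    let ?mixed = "(\<Sum>x\<in>?U. \<Sum>y\<in>?U - {x}. ?w x y * (q x * q y))"
    let ?left = "(\<Sum>x\<in>?U. \<Sum>y\<in>?U - {x}. ?w x y * (q x)\<^sup>2)"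
    let ?form = "(\<Sum>x\<in>?U. \<Sum>y\<in>?U - {x}. ?w x y * (q x - q y)\<^sup>2)"
    have D: "real D > 0" using degree_pos by simp
    have w_le: "?w x y \<le> 2 * real D * \<eta>" if "x \<in> V" "y \<in> V" "x \<noteq> y" for x y
      using that by (intro adjacency_le[OF bound _ T] pair_mem)
    have w_nonneg: "0 \<le> ?w x y" if "x \<in> V" "y \<in> V" "x \<noteq> y" for x y
      using that by (intro adjacency_nonneg[OF _ T] pair_mem)
    have row: "real D / 2 \<le> (\<Sum>y\<in>?U - {x}. ?w x y)" if x: "x \<in> ?U" for x
    proof -
      have Z': "Z \<subseteq> V" "finite Z" "card Z = j"
        using Z finite_V by (auto simp: configurations_def intro: finite_subset)
      have "(\<Sum>y\<in>?U - {x}. ?w x y) = (\<Sum>y\<in>V - {x}. ?w x y) - (\<Sum>y\<in>Z. ?w x y)"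
      proof -
        have "?U - {x} = (V - {x}) - Z" by auto
        moreover have "Z \<subseteq> V - {x}" using x Z' by auto
        ultimately show ?thesis
          using finite_V sum_diff[of "V - {x}" Z "?w x"] by (simp only: finite_Diff)
      qed
      also have "(\<Sum>y\<in>V - {x}. ?w x y) = real D"
        using x T by (intro sum_adjacency) auto
      moreover have "(\<Sum>y\<in>Z. ?w x y) \<le> (\<Sum>y\<in>Z. 2 * real D * \<eta>)"
        using x Z' by (intro sum_mono w_le) auto
      moreover have "(\<Sum>y\<in>Z. 2 * real D * \<eta>) \<le> real D / 2"
        using mult_left_mono[OF \<eta>(1), of "real D / 2"] Z' by (simp add: mult_ac)
      ultimately show ?thesis by linarith
    qed
    have sym: "?right = ?left"
    proof -
      have "?right = (\<Sum>x\<in>?U. \<Sum>y\<in>?U. if y = x then 0 else ?w x y * (q y)\<^sup>2)"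
        using finite_V by (simp add: sum_diff_if)
      also have "\<dots> = (\<Sum>x\<in>?U. \<Sum>y\<in>?U. if y = x then 0 else ?w x y * (q x)\<^sup>2)"
        by (subst sum.swap) (intro sum.cong refl, simp add: insert_commute)
      finally show ?thesis using finite_V by (simp add: sum_diff_if)
    qed
    have "?form
      = 2 * ?left - 2 * ?mixed"
    proof -
      have "?form
        = (\<Sum>x\<in>?U. \<Sum>y\<in>?U - {x}. ?w x y * (q x)\<^sup>2 + ?w x y * (q y)\<^sup>2 - 2 * (?w x y * (q x * q y)))"
        by (intro sum.cong refl) (simp add: power2_diff algebra_simps)
      also have "\<dots> = ?left + ?right
         - 2 * ?mixed"
        by (simp only: sum.distrib sum_subtractf sum_distrib_left)
      finally show ?thesis unfolding sym by simp
    qed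
    moreover have "real D / 2 * ?Q \<le> ?left"
      unfolding sum_distrib_right[symmetric] sum_distrib_left
      using row by (intro sum_mono mult_right_mono) auto
    moreover have "?mixed \<le> 2 * real D * \<eta>"
    proof -
      have "?mixed \<le> (\<Sum>x\<in>?U. \<Sum>y\<in>?U - {x}. 2 * real D * \<eta> * (q x * q y))"
        using q_nonneg by (intro sum_mono mult_right_mono w_le) auto
      also have "\<dots> \<le> (\<Sum>x\<in>?U. \<Sum>y\<in>?U. 2 * real D * \<eta> * (q x * q y))"
        using q_nonneg finite_V \<eta> by (intro sum_mono sum_mono2) auto
      also have "\<dots> = 2 * real D * \<eta> * ((\<Sum>x\<in>?U. q x) * (\<Sum>y\<in>?U. q y))"
        by (subst sum_product) (simp only: sum_distrib_left)
      finally show ?thesis by (simp add: q)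
    qed
    ultimately have "real D * ?Q - 4 * real D * \<eta> \<le> ?form"
      by linarith
    from divide_right_mono[OF this, of "16 * real D"] D
    have "?Q / 16 - \<eta> / 4 \<le> ?form / (16 * real D)"
      by (simp add: diff_divide_distrib)
    then show "(\<Sum>x\<in>?U. q x * marked.P (T + 1) (test g) (Z, x)) \<le> 15 / 16 * ?Q + \<eta> / 4"
      using heat_round_le[OF Z q T, of g] by simp
  qed (use F T in auto)
  then show ?thesis by (simp add: F)
qed

text \<open>With weights at least \<open>D / (2 * n)\<close> the form dominates a multiple of the
  variance of \<open>q\<close>. Since \<open>n \<le> 2 * (n - j)\<close>, this is 1/32 of the excess
  of the sum of squares over its minimum.\<close>

lemma global_round:
  assumes bound: "\<And>x y. x \<in> V \<Longrightarrow> y \<in> V \<Longrightarrow> p t x y \<le> 3 / (2 * n)" and t: "t > 0"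
    and j: "2 * real j \<le> n"
    and F: "\<And>s. s \<in> \<M> j \<Longrightarrow> 0 \<le> F s" "(\<Sum>s\<in>\<M> j. F s) = 1"
  shows "\<Psi> j (marked.P (32 * t + 1) F) - 1 / (n - real j) \<le> 31 / 32 * (\<Psi> j F - 1 / (n - real j))"
proof -
  define N where "N = n - real j"
  have N: "N \<ge> n / 2" "N > 0" using j n_pos by (auto simp: N_def)
  have "\<Psi> j (marked.P (32 * t + 1) F)
      \<le> 31 / 32 * \<Psi> j F + 1 / (32 * N) * (\<Sum>s\<in>\<M> j. F s)"
  proof (rule Psi_heat_le)
    fix Z :: "'v set" and q :: "'v \<Rightarrow> real" and g
    assume Z: "Z \<in> \<C> j" and q: "mass q Z = 1"
    let ?U = "V - Z" and ?w = "\<lambda>x y. adjacency (32 * t) {x, y}"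
    let ?Q = "\<Sum>x\<in>?U. (q x)\<^sup>2"
    let ?form = "(\<Sum>x\<in>?U. \<Sum>y\<in>?U - {x}. ?w x y * (q x - q y)\<^sup>2)"
    let ?dev = "(\<Sum>x\<in>?U. \<Sum>y\<in>?U. (q x - q y)\<^sup>2)"
    have card_U: "real (card ?U) = N" using card_complement[OF Z] by (simp add: N_def)
    have dev: "?dev = 2 * N * ?Q - 2"
    proof -
      have "?dev = 2 * real (card ?U) * ?Q - 2 * (\<Sum>x\<in>?U. q x) * (\<Sum>x\<in>?U. q x)"
        by (simp add: power2_diff sum.distrib sum_subtractf sum_distrib_left[symmetric] sum_distrib_right[symmetric]
            mult.assoc)
      then show ?thesis by (simp add: q card_U)
    qed
    have "0 \<le> ?dev"
      by (intro sum_nonneg) auto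
    then have NQ: "1 \<le> N * ?Q" unfolding dev by linarith
    have D: "real D > 0" using degree_pos by simp
    have "real D / (2 * n) * (2 * N * ?Q - 2) = (\<Sum>x\<in>?U. \<Sum>y\<in>?U - {x}. real D / (2 * n) * (q x - q y)\<^sup>2)"
    proof -
      have "(\<Sum>y\<in>?U. (q x - q y)\<^sup>2) = (\<Sum>y\<in>?U - {x}. (q x - q y)\<^sup>2)" for x
        using finite_V by (intro sum.mono_neutral_right) auto
      then have "2 * N * ?Q - 2 = (\<Sum>x\<in>?U. \<Sum>y\<in>?U - {x}. (q x - q y)\<^sup>2)"
        by (simp only: dev[symmetric])
      then show ?thesis by (simp only: sum_distrib_left)
    qed
    also have "\<dots> \<le> ?form"
      by (intro sum_mono mult_right_mono adjacency_ge[OF bound t] pair_mem) auto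
    finally have "real D / (2 * n) * (2 * N * ?Q - 2) / (16 * real D)
       \<le> ?form / (16 * real D)"
      using D by (intro divide_right_mono) auto
    moreover have "real D / (2 * n) * (2 * N * ?Q - 2) / (16 * real D) = (N * ?Q - 1) / (16 * n)"
      using D n_pos by (simp add: field_simps)
    moreover have "(N * ?Q - 1) / (32 * N) \<le> (N * ?Q - 1) / (16 * n)"
      using N n_pos NQ by (intro divide_left_mono) auto
    moreover have "(N * ?Q - 1) / (32 * N) = ?Q / 32 - 1 / (32 * N)"
      using N by (simp add: field_simps)
    moreover have "(\<Sum>x\<in>?U. q x * marked.P (32 * t + 1) (test g) (Z, x))
        \<le> ?Q - ?form / (16 * real D)"
      using t by (intro heat_round_le[OF Z q]) simp
    ultimately show "(\<Sum>x\<in>?U. q x * marked.P (32 * t + 1) (test g) (Z, x)) \<le> 31 / 32 * ?Q + 1 / (32 * N)"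
      by linarith
  qed (use F t in auto)
  then show ?thesis
    unfolding F(2) N_def[symmetric] by (simp add: field_simps)
qed

end

section \<open>From the conditional second moment to total variation\<close>

context regular_graph
begin

section \<open>Projections of the marked process\<close>

lemma marked_switch_pair: "marked_switch e (Z, x) = (switch e Z, flip e x)"
  by (simp add: marked_switch_def)

text \<open>The revealed balls alone perform an exclusion process: an edge only relabels the
  complement over which the marked position is summed, so the sum solves the backward
  equation.\<close>

lemma heat_marked_marginal:
  assumes s: "(Z0, x0) \<in> \<M> j" and Z: "Z \<in> \<C> j" and t: "t \<ge> 0"
  shows "(\<Sum>x\<in>V - Z. marked.P t (indicator {(Z0, x0)}) (Z, x)) = conf.P t (indicator {Z0}) Z"
proof -
  let ?f = "\<lambda>t. marked.P t (indicator {(Z0, x0)})"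
  define v where "v t Z = (\<Sum>x\<in>V - Z. ?f t (Z, x))" for t Z
  have "((\<lambda>t. v t Z) has_real_derivative conf.G (v t) Z) (at t)" if Z: "Z \<in> \<C> j" for t Z
  proof -
    have "((\<lambda>t. v t Z) has_real_derivative
        (\<Sum>x\<in>V - Z. marked.G (?f t) (Z, x))) (at t)"
      unfolding v_def using Z
      by (intro DERIV_sum marked.heat_has_derivative[of _ j]) (auto simp: marked_configurations_def)
    also have "(\<Sum>x\<in>V - Z. marked.G (?f t) (Z, x))
       = conf.G (v t) Z"
      unfolding gen_def v_def marked_switch_pair
      by (subst sum.swap, intro sum.cong refl)
         (simp add: sum_subtractf sum_switch_complement[where f = "\<lambda>x. ?f t (switch _ Z, x)"])
    finally show ?thesis .
  qed
  from conf.heat_unique[of j v, OF this t Z]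
  have "v t Z = conf.P t (v 0) Z" .
  also have "\<dots> = conf.P t (indicator {Z0}) Z"
  proof (rule conf.heat_cong[OF _ Z])
    fix Z' assume "Z' \<in> \<C> j"
    have "v 0 Z' = (\<Sum>x\<in>V - Z'. if x = x0 then indicator {Z0} Z' else 0)"
      unfolding v_def by (intro sum.cong refl) (auto simp: indicator_def)
    then show "v 0 Z' = indicator {Z0} Z'"
      using s finite_V by (auto simp: marked_configurations_def sum.delta indicator_def)
  qed
  finally show ?thesis by (simp add: v_def)
qed

lemma switch_remove: "e \<in> E \<Longrightarrow> switch e (Y - {x}) = switch e Y - {flip e x}"
  using inj_flip[OF card_edge, of e] by (auto simp: switch_image inj_image_mem_iff flip_eq_iff)

text \<open>Forgetting which of the \<open>Suc j\<close> balls is marked also leaves an exclusion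
  process; the sum over the possible marks solves its backward equation.\<close>

lemma heat_marked_insert:
  assumes s: "(Z0, x0) \<in> \<M> j" and Y: "Y \<in> \<C> (Suc j)" and t: "t \<ge> 0"
  shows "(\<Sum>x\<in>Y. marked.P t (indicator {(Z0, x0)}) (Y - {x}, x))
     = conf.P t (indicator {insert x0 Z0}) Y"
proof -
  let ?f = "\<lambda>t. marked.P t (indicator {(Z0, x0)})"
  define v where "v t Y = (\<Sum>x\<in>Y. ?f t (Y - {x}, x))" for t Y
  have marked: "(Y - {x}, x) \<in> \<M> j" if "Y \<in> \<C> (Suc j)" "x \<in> Y" for Y x
    using that finite_V by (auto simp: marked_configurations_def configurations_def finite_subset)
  have "((\<lambda>t. v t Y) has_real_derivative conf.G (v t) Y) (at t)" if Y: "Y \<in> \<C> (Suc j)" for t Y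
  proof -
    have "((\<lambda>t. v t Y) has_real_derivative (\<Sum>x\<in>Y. marked.G (?f t) (Y - {x}, x))) (at t)"
      unfolding v_def using Y marked by (intro DERIV_sum marked.heat_has_derivative[of _ j]) auto
    also have "(\<Sum>x\<in>Y. marked.G (?f t) (Y - {x}, x)) = conf.G (v t) Y"
    proof -
      have "(\<Sum>x\<in>Y. (?f t) (switch e (Y - {x}), flip e x)) = v t (switch e Y)" if e: "e \<in> E" for e
      proof -
        have "inj_on (flip e) Y" using e by (auto intro!: inj_onI simp: flip_eq_iff)
        then show ?thesis
          using e by (simp add: v_def switch_remove switch_image[of e Y] sum.reindex)
      qed
      then show ?thesis
        unfolding gen_def marked_switch_pair
        by (subst sum.swap) (simp add: sum_subtractf v_def[symmetric])
    qed
    finally show ?thesis .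
  qed
  from conf.heat_unique[of "Suc j" v, OF this t Y]
  have "v t Y = conf.P t (v 0) Y" .
  also have "\<dots> = conf.P t (indicator {insert x0 Z0}) Y"
  proof (rule conf.heat_cong[OF _ Y])
    fix Y' assume Y': "Y' \<in> \<C> (Suc j)"
    then have "finite Y'" using finite_V by (auto simp: configurations_def finite_subset)
    have "v 0 Y' = (\<Sum>x\<in>Y'. if x = x0 then indicator {insert x0 Z0} Y' else 0)"
      unfolding v_def using s
      by (intro sum.cong refl) (auto simp: indicator_def marked_configurations_def)
    then show "v 0 Y' = indicator {insert x0 Z0} Y'"
      using \<open>finite Y'\<close> by (auto simp: sum.delta indicator_def)
  qed
  finally show ?thesis by (simp add: v_def)
qed

lemma sum_configurations_Suc:
  "(\<Sum>Y\<in>\<C> (Suc j). \<Sum>x\<in>Y. h (Y - {x}, x)) = (\<Sum>Z\<in>\<C> j. \<Sum>x\<in>V - Z. h (Z, x))"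
  for h :: "'v set \<times> 'v \<Rightarrow> real"
proof -
  have fin: "\<forall>Y\<in>\<C> (Suc j). finite Y"
    using finite_V by (auto simp: configurations_def finite_subset)
  have "(\<Sum>Y\<in>\<C> (Suc j). \<Sum>x\<in>Y. h (Y - {x}, x))
     = (\<Sum>(Y, x)\<in>Sigma (\<C> (Suc j)) (\<lambda>Y. Y). h (Y - {x}, x))"
    by (rule sum.Sigma[OF finite_configurations fin])
  also have "\<dots> = (\<Sum>(Z, x)\<in>\<M> j. h (Z, x))"
    using finite_V
    by (intro sum.reindex_bij_witness[where j = "\<lambda>(Y, x). (Y - {x}, x)" and i = "\<lambda>(Z, x). (insert x Z, x)"])
       (auto simp: marked_configurations_def configurations_def finite_subset card_insert_if)
  also have "\<dots> = (\<Sum>Z\<in>\<C> j. \<Sum>x\<in>V - Z. h (Z, x))"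
    by (simp add: sum_marked)
  finally show ?thesis .
qed

lemma card_configurations_Suc:
  "real (card (\<C> (Suc j))) * real (Suc j) = real (card (\<C> j)) * (n - real j)"
proof -
  have "(\<Sum>Y\<in>\<C> (Suc j). \<Sum>x\<in>Y. 1) = real (card (\<C> (Suc j))) * real (Suc j)"
    by (simp add: configurations_def)
  moreover have "(\<Sum>Z\<in>\<C> j. \<Sum>x\<in>V - Z. 1) = real (card (\<C> j)) * (n - real j)"
    by (simp add: card_complement)
  ultimately show ?thesis
    using sum_configurations_Suc[of "\<lambda>_. 1" j] by simp
qed

text \<open>An absolute value is bounded by a square through the arithmetic-geometric mean
  inequality with a weight proportional to the mass of \<open>Z\<close>. The bound on each fibre is
  then linear in that mass and in the summand of \<open>\<Psi>\<close>, so it can be summed over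
  \<open>Z\<close>.\<close>

lemma sum_deviation_le:
  assumes F: "\<And>s. s \<in> \<M> j \<Longrightarrow> 0 \<le> F s" "(\<Sum>s\<in>\<M> j. F s) = 1"
    and j: "real j < n" and \<epsilon>: "\<epsilon> > 0" "(n - real j) * (\<Psi> j F - 1 / (n - real j)) \<le> \<epsilon>\<^sup>2"
  shows "(\<Sum>Z\<in>\<C> j. \<Sum>x\<in>V - Z. \<bar>F (Z, x) - (\<Sum>y\<in>V - Z. F (Z, y)) / (n - real j)\<bar>) \<le> \<epsilon>"
proof -
  let ?q = "\<lambda>Z. (\<Sum>x\<in>V - Z. (F (Z, x))\<^sup>2)"
  define N where "N = n - real j"
  define m where "m Z = (\<Sum>y\<in>V - Z. F (Z, y))" for Z
  have N: "N > 0" using j by (simp add: N_def)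
  let ?dev = "\<lambda>Z. (\<Sum>x\<in>V - Z. (F (Z, x) - m Z / N)\<^sup>2)"
  have fibre: "(\<Sum>x\<in>V - Z. \<bar>F (Z, x) - m Z / N\<bar>)
     \<le> (\<epsilon> * m Z + (N * ((?q Z) / m Z) - m Z) / \<epsilon>) / 2" if Z: "Z \<in> \<C> j" for Z
  proof -
    have F_nonneg: "0 \<le> F (Z, x)" if "x \<in> V - Z" for x
      using F(1) Z that by (simp add: marked_configurations_def)
    show ?thesis
    proof (cases "m Z = 0")
      case True
      then have "F (Z, x) = 0" if "x \<in> V - Z" for x
        using sum_nonneg_eq_0_iff[of "V - Z" "\<lambda>x. F (Z, x)"] F_nonneg finite_V that by (auto simp: m_def)
      then show ?thesis using True by simp
    next
      case False
      moreover have "0 \<le> m Z" unfolding m_def by (intro sum_nonneg F_nonneg)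
      ultimately have m: "m Z > 0" by simp
      \<comment> \<open>\<open>m Z / N\<close> is the value of the uniform law on this fibre, and
        \<open>\<epsilon>\<close> the relative deviation to be tolerated.\<close>
      define a where "a = \<epsilon> * m Z / N"
      have a: "a > 0" using \<epsilon> m N by (simp add: a_def)
      have "\<bar>y\<bar> \<le> (a + y\<^sup>2 / a) / 2" for y :: real
      proof -
        have "2 * a * \<bar>y\<bar> \<le> a\<^sup>2 + y\<^sup>2"
          using zero_le_power2[of "a - \<bar>y\<bar>"] by (simp add: power2_diff)
        then show ?thesis using a by (simp add: field_simps power2_eq_square)
      qed
      then have "(\<Sum>x\<in>V - Z. \<bar>F (Z, x) - m Z / N\<bar>) \<le> (\<Sum>x\<in>V - Z. (a + (F (Z, x) - m Z / N)\<^sup>2 / a) / 2)"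
        by (intro sum_mono) blast
      also have "\<dots> = (N * a + (?dev Z) / a) / 2"
        using card_complement[OF Z] by (simp add: sum_divide_distrib[symmetric] sum.distrib N_def)
      also have "(?dev Z) = (?q Z) - 2 * (m Z / N) * m Z + N * (m Z / N)\<^sup>2"
      proof -
        have "(?dev Z) = (?q Z) - (\<Sum>x\<in>V - Z. 2 * (m Z / N) * F (Z, x)) + (\<Sum>x\<in>V - Z. (m Z / N)\<^sup>2)"
          by (simp add: power2_diff sum.distrib sum_subtractf mult_ac)
        then show ?thesis
          using card_complement[OF Z] by (simp only: sum_distrib_left[symmetric] m_def[symmetric] sum_constant N_def)
      qed
      also have "\<dots> = (?q Z) - (m Z)\<^sup>2 / N"
        using N by (simp add: field_simps power2_eq_square)
      also have "(N * a + ((?q Z) - (m Z)\<^sup>2 / N) / a) / 2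
        = (\<epsilon> * m Z + (N * ((?q Z) / m Z) - m Z) / \<epsilon>) / 2"
        using N m \<epsilon> by (simp add: a_def field_simps power2_eq_square)
      finally show ?thesis .
    qed
  qed
  have "(\<Sum>Z\<in>\<C> j. \<Sum>x\<in>V - Z. \<bar>F (Z, x) - m Z / N\<bar>)
     \<le> (\<Sum>Z\<in>\<C> j. (\<epsilon> * m Z + (N * ((?q Z) / m Z) - m Z) / \<epsilon>) / 2)"
    by (intro sum_mono fibre)
  also have "\<dots> = (\<epsilon> * (\<Sum>Z\<in>\<C> j. m Z) + (N * \<Psi> j F - (\<Sum>Z\<in>\<C> j. m Z)) / \<epsilon>) / 2"
    by (simp only: \<Psi>_def m_def sum_divide_distrib[symmetric] sum.distrib sum_subtractf sum_distrib_left[symmetric])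
  also have "(\<Sum>Z\<in>\<C> j. m Z) = 1"
    using F(2) by (simp add: sum_marked m_def)
  also have "N * \<Psi> j F - 1 = N * (\<Psi> j F - 1 / N)"
    using N by (simp add: field_simps)
  also have "(\<epsilon> * 1 + N * (\<Psi> j F - 1 / N) / \<epsilon>) / 2 \<le> (\<epsilon> * 1 + \<epsilon>\<^sup>2 / \<epsilon>) / 2"
    using \<epsilon> by (intro divide_right_mono add_left_mono) (auto simp: N_def)
  also have "\<dots> = \<epsilon>"
    using \<epsilon> by (simp add: power2_eq_square)
  finally show ?thesis by (simp add: N_def m_def)
qed

text \<open>The l1 distance to the uniform law, which bounds the difference of the two laws on every
  event.\<close>

definition deviation :: "real \<Rightarrow> 'v set \<Rightarrow> real" where
  "deviation t A = (\<Sum>Y\<in>\<C> (card A).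
     \<bar>conf.P t (indicator {A}) Y - 1 / real (card (\<C> (card A)))\<bar>)"

text \<open>Chain rule: the joint law is compared with the one that keeps the law of
  \<open>Z\<close> and makes the next ball uniform on the complement; what remains is the deviation
  of \<open>Z\<close> alone.\<close>

lemma deviation_insert_le:
  assumes s: "(Z0, x0) \<in> \<M> j" and t: "t \<ge> 0"
  defines "F \<equiv> marked.P t (indicator {(Z0, x0)})"
  shows "deviation t (insert x0 Z0) \<le> deviation t Z0
    + (\<Sum>Z\<in>\<C> j. \<Sum>x\<in>V - Z. \<bar>F (Z, x) - (\<Sum>y\<in>V - Z. F (Z, y)) / (n - real j)\<bar>)"
proof -
  let ?m = "\<lambda>Z. (\<Sum>y\<in>V - Z. F (Z, y))"
  define N where "N = n - real j"
  define c where "c = real (card (\<C> j))"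
  have Z0: "Z0 \<in> \<C> j" "x0 \<in> V" "x0 \<notin> Z0" using s by (auto simp: marked_configurations_def)
  then have fin: "finite Z0" "card Z0 = j" using finite_V by (auto simp: configurations_def finite_subset)
  then have card_ins: "card (insert x0 Z0) = Suc j" using Z0 by simp
  have c: "c > 0" using Z0 finite_configurations[of j] by (auto simp: c_def card_gt_0_iff)
  have "card Z0 < card V"
    using Z0 finite_V by (intro psubset_card_mono) (auto simp: configurations_def)
  then have N: "N > 0" using fin by (simp add: N_def)
  \<comment> \<open>Each set of \<open>Suc j\<close> vertices comes from \<open>Suc j\<close> marked
    configurations, of which there are \<open>c * N\<close> in total.\<close>
  have c': "1 / real (card (\<C> (Suc j))) = real (Suc j) / (c * N)"
  proof -
    have eq: "real (card (\<C> (Suc j))) * real (Suc j) = c * N"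
      using card_configurations_Suc[of j] by (simp add: c_def N_def)
    have "real (card (\<C> (Suc j))) \<noteq> 0"
    proof
      assume "real (card (\<C> (Suc j))) = 0"
      with eq have "c * N = 0" by simp
      with c N show False by simp
    qed
    then show ?thesis using c N eq by (simp add: field_simps del: of_nat_Suc)
  qed
  have "deviation t (insert x0 Z0) = (\<Sum>Y\<in>\<C> (Suc j). \<bar>\<Sum>x\<in>Y. F (Y - {x}, x) - 1 / (c * N)\<bar>)"
    unfolding deviation_def card_ins
  proof (intro sum.cong refl arg_cong[where f = abs])
    fix Y assume Y: "Y \<in> \<C> (Suc j)"
    then have "(\<Sum>x\<in>Y. 1 / (c * N)) = real (Suc j) / (c * N)" by (simp add: configurations_def)
    then show "conf.P t (indicator {insert x0 Z0}) Y - 1 / real (card (\<C> (Suc j)))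
        = (\<Sum>x\<in>Y. F (Y - {x}, x) - 1 / (c * N))"
      using heat_marked_insert[OF s Y t] unfolding sum_subtractf F_def c' by (simp only:)
  qed
  also have "\<dots> \<le> (\<Sum>Y\<in>\<C> (Suc j). \<Sum>x\<in>Y. \<bar>F (Y - {x}, x) - 1 / (c * N)\<bar>)"
    by (intro sum_mono sum_abs)
  also have "\<dots> = (\<Sum>Z\<in>\<C> j. \<Sum>x\<in>V - Z. \<bar>F (Z, x) - 1 / (c * N)\<bar>)"
    by (rule sum_configurations_Suc[of "\<lambda>s. \<bar>F s - 1 / (c * N)\<bar>"])
  also have "\<dots> \<le> (\<Sum>Z\<in>\<C> j. \<Sum>x\<in>V - Z. \<bar>F (Z, x) - (?m Z) / N\<bar>
      + \<bar>(?m Z) / N - 1 / (c * N)\<bar>)"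
  proof -
    have "\<bar>a - c\<bar> \<le> \<bar>a - b\<bar> + \<bar>b - c\<bar>" for a b c :: real by linarith
    then show ?thesis by (intro sum_mono)
  qed
  also have "\<dots> = (\<Sum>Z\<in>\<C> j. \<Sum>x\<in>V - Z. \<bar>F (Z, x) - (?m Z) / N\<bar>)
      + (\<Sum>Z\<in>\<C> j. \<Sum>x\<in>V - Z. \<bar>(?m Z) / N - 1 / (c * N)\<bar>)"
    by (simp only: sum.distrib)
  also have "(\<Sum>Z\<in>\<C> j. \<Sum>x\<in>V - Z. \<bar>(?m Z) / N - 1 / (c * N)\<bar>) = deviation t Z0"
    unfolding deviation_def fin
  proof (rule sum.cong[OF refl])
    fix Z assume Z: "Z \<in> \<C> j"
    have "(\<Sum>x\<in>V - Z. \<bar>(?m Z) / N - 1 / (c * N)\<bar>) = N * \<bar>(?m Z) / N - 1 / (c * N)\<bar>"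
      using card_complement[OF Z] by (simp only: sum_constant N_def)
    also have "\<dots> = \<bar>N * ((?m Z) / N - 1 / (c * N))\<bar>"
      using N by (simp add: abs_mult)
    also have "N * ((?m Z) / N - 1 / (c * N)) = (?m Z) - 1 / c"
      using N by (simp add: right_diff_distrib)
    finally show "(\<Sum>x\<in>V - Z. \<bar>(?m Z) / N - 1 / (c * N)\<bar>)
        = \<bar>conf.P t (indicator {Z0}) Z - 1 / real (card (\<C> j))\<bar>"
      using heat_marked_marginal[OF s Z t] by (simp add: F_def c_def)
  qed
  finally show ?thesis by (simp add: N_def)
qed

lemma deviation_le:
  assumes t: "t \<ge> 0" and \<epsilon>: "\<epsilon> > 0"
    and \<Psi>: "\<And>j s. j < k \<Longrightarrow> s \<in> \<M> j \<Longrightarrow>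
      (n - real j) * (\<Psi> j (marked.P t (indicator {s})) - 1 / (n - real j)) \<le> \<epsilon>\<^sup>2"
    and A: "A \<subseteq> V" "card A \<le> k"
  shows "deviation t A \<le> \<epsilon> * real (card A)"
  using finite_subset[OF A(1) finite_V] A
proof (induction A rule: finite_induct)
  case empty
  have conf0: "\<C> 0 = {{}}"
    using finite_V by (auto simp: configurations_def finite_subset)
  have "(\<Sum>Y\<in>\<C> 0. conf.P t (indicator {{}}) Y) = 1"
    by (simp add: conf.sum_heat) (simp add: conf0)
  then show ?case by (simp add: deviation_def conf0)
next
  case (insert x A)
  define j where "j = card A"
  have s: "(A, x) \<in> \<M> j" and j: "j < k"
    using insert by (auto simp: marked_configurations_def configurations_def j_def)
  let ?F = "marked.P t (indicator {(A, x)})"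
  have "j < card V"
    unfolding j_def using insert finite_V by (intro psubset_card_mono) auto
  moreover have "0 \<le> ?F s'" if "s' \<in> \<M> j" for s'
    using that t by (intro marked.heat_nonneg[of j]) auto
  moreover have "(\<Sum>s\<in>\<M> j. ?F s) = 1"
    using s marked.finite_S[of j] by (simp add: marked.sum_heat indicator_def sum.delta)
  ultimately have "(\<Sum>Z\<in>\<C> j. \<Sum>y\<in>V - Z. \<bar>?F (Z, y) - (\<Sum>y\<in>V - Z. ?F (Z, y)) / (n - real j)\<bar>) \<le> \<epsilon>"
    using \<Psi>[OF j s] \<epsilon> by (intro sum_deviation_le) auto
  moreover have "deviation t A \<le> \<epsilon> * real (card A)"
    using insert by simp
  ultimately show ?case
    using deviation_insert_le[OF s t] insert(1,2) by (simp add: distrib_left)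
qed

text \<open>Both solve Kolmogorov's backward equation with the same initial value.\<close>

lemma transition_kernel_eq_heat:
  assumes "A \<in> \<C> k" "t \<ge> 0"
  shows "transition_kernel E t A B = conf.P t (indicator {B}) A"
proof -
  have "transition_kernel E t A B = conf.P t (\<lambda>A. transition_kernel E 0 A B) A"
    using transition_kernel_backward_equation[of E _ B] assms unfolding generator_eq_gen
    by (intro conf.heat_unique[of k "\<lambda>t A. transition_kernel E t A B"])
  also have "(\<lambda>A. transition_kernel E 0 A B) = indicator {B}"
    by (auto simp: transition_kernel_0 indicator_def)
  finally show ?thesis .
qed

lemma mixing_time_le:
  assumes t: "t \<ge> 0" and k: "k \<ge> 1" "k \<le> card V"
    and \<Psi>: "\<And>j s. j < k \<Longrightarrow> s \<in> \<M> j \<Longrightarrow>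
      (n - real j) * (\<Psi> j (marked.P t (indicator {s})) - 1 / (n - real j)) \<le> (1 / (4 * real k))\<^sup>2"
  shows "mixing_time V E k \<le> ereal t"
proof -
  let ?S = "\<C> k"
  let ?u = "pmf (pmf_of_set ?S)"
  have "tv_distance ?S (transition_kernel E t A) ?u \<le> 1 / 4" if A: "A \<in> ?S" for A
  proof -
    have A': "A \<subseteq> V" "card A = k" using A by (auto simp: configurations_def)
    have u: "?u Y = 1 / real (card ?S)" if "Y \<in> ?S" for Y
    proof -
      have "?S \<noteq> {}" using A by auto
      then show ?thesis using that finite_configurations by simp
    qed
    have "sum (transition_kernel E t A) Q - sum ?u Q \<le> 1 / 4" if Q: "Q \<subseteq> ?S" for Q
    proof -
      have "sum (transition_kernel E t A) Q - sum ?u Q = (\<Sum>Y\<in>Q. conf.P t (indicator {A}) Y - 1 / real (card ?S))"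
      proof -
        \<comment> \<open>The heat flow acts on functions of the starting point; reversibility lets
          it be read as the law of the end point.\<close>
        have "transition_kernel E t A Y = conf.P t (indicator {A}) Y" if "Y \<in> Q" for Y
          using transition_kernel_eq_heat[OF A t, of Y] conf.heat_indicator_sym[OF _ A, of Y t] Q that by auto
        then have "sum (transition_kernel E t A) Q = (\<Sum>Y\<in>Q. conf.P t (indicator {A}) Y)"
          by (intro sum.cong) auto
        moreover have "sum ?u Q = (\<Sum>Y\<in>Q. 1 / real (card ?S))"
          using u Q by (intro sum.cong) auto
        ultimately show ?thesis by (simp only: sum_subtractf)
      qed
      also have "\<dots> \<le> (\<Sum>Y\<in>Q. \<bar>conf.P t (indicator {A}) Y - 1 / real (card ?S)\<bar>)"
        by (intro sum_mono) auto
      also have "\<dots> \<le> deviation t A"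
        unfolding deviation_def A' using Q finite_configurations by (intro sum_mono2) auto
      also have "\<dots> \<le> 1 / (4 * real k) * real (card A)"
        using k A' by (intro deviation_le[OF t _ \<Psi>, of k]) auto
      finally show ?thesis using A' k by simp
    qed
    then show ?thesis
      unfolding tv_distance_def using finite_configurations by (subst Max_le_iff) auto
  qed
  then show ?thesis
    unfolding mixing_time_def using t by (intro Inf_lower) auto
qed

lemma Psi_indicator_le:
  assumes "s \<in> \<M> j"
  shows "\<Psi> j (indicator {s}) \<le> 1"
proof -
  let ?I = "\<lambda>Z. (\<Sum>x\<in>V - Z. indicator {s} (Z, x) :: real)"
  have "(\<Sum>x\<in>V - Z. (indicator {s} (Z, x))\<^sup>2) / (\<Sum>x\<in>V - Z. indicator {s} (Z, x)) \<le> (?I Z)"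
    for Z
  proof -
    have "(\<Sum>x\<in>V - Z. (indicator {s} (Z, x))\<^sup>2) = (?I Z)"
      by (intro sum.cong) (auto simp: indicator_def)
    moreover have "(?I Z) = (if Z = fst s \<and> snd s \<in> V - Z then 1 else 0)"
    proof -
      have "(?I Z) = (\<Sum>x\<in>V - Z. if x = snd s then (if Z = fst s then 1 else 0) else 0)"
        by (intro sum.cong refl) (auto simp: indicator_def prod_eq_iff)
      then show ?thesis using finite_V by (auto simp: sum.delta)
    qed
    ultimately show ?thesis by simp
  qed
  then have "\<Psi> j (indicator {s}) \<le> (\<Sum>Z\<in>\<C> j. \<Sum>x\<in>V - Z. indicator {s} (Z, x))"
    unfolding \<Psi>_def by (rule sum_mono)
  also have "\<dots> = (\<Sum>s'\<in>\<M> j. indicator {s} s')"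
    by (rule sum_marked[symmetric])
  also have "\<dots> = 1"
    using assms marked.finite_S[of j] by (simp add: indicator_def sum.delta)
  finally show ?thesis .
qed

section \<open>Iteration of the rounds from a point mass\<close>

context
  fixes j s
  assumes s: "s \<in> \<M> j"
begin

text \<open>By reversibility this is the law at time \<open>t\<close> of the marked process started
  from \<open>s\<close>.\<close>

abbreviation "flow t \<equiv> marked.P t (indicator {s})"

lemma flow_nonneg: "t \<ge> 0 \<Longrightarrow> s' \<in> \<M> j \<Longrightarrow> 0 \<le> flow t s'"
  by (intro marked.heat_nonneg[of j]) auto

lemma sum_flow: "(\<Sum>s'\<in>\<M> j. flow t s') = 1"
  using s marked.finite_S[of j] by (simp add: marked.sum_heat indicator_def sum.delta)

lemma Psi_flow_add: "t \<ge> 0 \<Longrightarrow> \<Psi> j (flow (t + r)) = \<Psi> j (marked.P t (flow r))"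
  unfolding \<Psi>_def
  by (intro sum.cong arg_cong2[where f = "(/)"] refl arg_cong[where f = "\<lambda>x. x ^ 2"] marked.heat_heat[symmetric])
     (auto simp: marked_configurations_def)

lemma Psi_flow_mono:
  assumes "0 \<le> r" "r \<le> t"
  shows "\<Psi> j (flow t) \<le> \<Psi> j (flow r)"
  using Psi_flow_add[of "t - r" r] Psi_heat_mono[of j "flow r" "t - r"] flow_nonneg assms by simp

lemma Psi_flow_le_1:
  assumes "t \<ge> 0"
  shows "\<Psi> j (flow t) \<le> 1"
proof -
  have "\<Psi> j (flow t) \<le> \<Psi> j (flow 0)" using assms by (intro Psi_flow_mono) auto
  also have "flow 0 = indicator {s}" by (rule ext) simp
  finally show ?thesis using Psi_indicator_le[OF s] by simp
qed

lemma local_rounds: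
  assumes "\<And>x y. x \<in> V \<Longrightarrow> y \<in> V \<Longrightarrow> p T x y \<le> \<eta>" "4 * real j * \<eta> \<le> 1" "0 \<le> \<eta>" "T \<ge> 0" "r \<ge> 0"
  shows "\<Psi> j (flow (real R * (T + 1) + r)) \<le> (15 / 16) ^ R * \<Psi> j (flow r) + 4 * \<eta>"
proof (induction R)
  case 0
  then show ?case using assms by simp
next
  case (Suc R)
  let ?t = "real R * (T + 1) + r"
  have "\<Psi> j (flow (real (Suc R) * (T + 1) + r)) = \<Psi> j (flow ((T + 1) + ?t))"
    by (simp add: algebra_simps)
  also have "\<dots> = \<Psi> j (marked.P (T + 1) (flow ?t))"
    using assms by (intro Psi_flow_add) auto
  also have "\<dots> \<le> 15 / 16 * \<Psi> j (flow ?t) + \<eta> / 4"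
    using assms by (intro local_round flow_nonneg sum_flow) auto
  also have "\<dots> \<le> 15 / 16 * ((15 / 16) ^ R * \<Psi> j (flow r) + 4 * \<eta>) + \<eta> / 4"
    using Suc by simp
  \<comment> \<open>\<open>4 * \<eta>\<close> is the fixed point of the map sending \<open>u\<close>
    to \<open>15 / 16 * u + \<eta> / 4\<close>.\<close>
  also have "\<dots> = (15 / 16) ^ Suc R * \<Psi> j (flow r) + 4 * \<eta>"
    by (simp add: algebra_simps)
  finally show ?case .
qed

lemma global_rounds:
  assumes "\<And>x y. x \<in> V \<Longrightarrow> y \<in> V \<Longrightarrow> p t x y \<le> 3 / (2 * n)" "t > 0" "2 * real j \<le> n" "r \<ge> 0"
  shows "\<Psi> j (flow (real R * (32 * t + 1) + r)) - 1 / (n - real j)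
    \<le> (31 / 32) ^ R * (\<Psi> j (flow r) - 1 / (n - real j))"
proof (induction R)
  case 0
  then show ?case by simp
next
  case (Suc R)
  let ?t = "real R * (32 * t + 1) + r"
  have "\<Psi> j (flow (real (Suc R) * (32 * t + 1) + r)) = \<Psi> j (flow ((32 * t + 1) + ?t))"
    by (simp add: algebra_simps)
  also have "\<dots> = \<Psi> j (marked.P (32 * t + 1) (flow ?t))"
    using assms by (intro Psi_flow_add) auto
  also have "\<dots> - 1 / (n - real j) \<le> 31 / 32 * (\<Psi> j (flow ?t) - 1 / (n - real j))"
    using assms by (intro global_round flow_nonneg sum_flow) auto
  also have "\<dots> \<le> 31 / 32 * ((31 / 32) ^ R * (\<Psi> j (flow r) - 1 / (n - real j)))"
    using Suc by (intro mult_left_mono) auto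
  finally show ?case by (simp add: mult.assoc)
qed

end

text \<open>The scale \<open>T\<close> is multiplied by 4, that is, the length scale by 2, so \<open>O(d)\<close> rounds are enough
  between two scales, and the total time is dominated by the last scale. The first scale at which
  \<open>4 * k * \<eta> \<le> 1\<close> needs \<open>O(d + log k)\<close> rounds.\<close>

lemma local_phases:
  fixes \<eta> :: "real \<Rightarrow> real" and b d g k :: nat and L :: real
  defines "\<eta> \<equiv> \<lambda>T. (2 ^ g / sqrt T) ^ d"
  assumes s: "s \<in> \<M> j" and j: "j \<le> k" and k: "1 \<le> k" "real k \<le> 2 ^ b" and d: "d \<ge> 1"
    and bound: "\<And>T x y. 1 \<le> T \<Longrightarrow> T \<le> L\<^sup>2 \<Longrightarrow> x \<in> V \<Longrightarrow> y \<in> V \<Longrightarrow> p T x y \<le> \<eta> T"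
    and T: "1 \<le> T" "T \<le> L\<^sup>2" "4 * real k * \<eta> T \<le> 1"
    and t: "100 * (real d + real b) * T \<le> t"
  shows "\<Psi> j (marked.P t (indicator {s})) \<le> 8 * \<eta> T"
proof -
  define K where "K = 100 * (real d + real b)"
  let ?F = "\<lambda>t. marked.P t (indicator {s})"
  have K: "K \<ge> 100" using d by (simp add: K_def)
  have \<eta>_pos: "\<eta> T > 0" if "T > 0" for T
    using that by (simp add: \<eta>_def)
  have \<eta>_quarter: "\<eta> (T / 4) = 2 ^ d * \<eta> T" if "T > 0" for T
  proof -
    have "2 ^ g / sqrt (T / 4) = 2 * (2 ^ g / sqrt T)" by (simp add: real_sqrt_divide)
    then show ?thesis by (simp only: \<eta>_def power_mult_distrib)
  qed
  \<comment> \<open>So sixteen rounds halve the excess.\<close>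
  have rate: "(15 / 16 :: real) ^ (16 * R) \<le> (1 / 2) ^ R" for R :: nat
  proof -
    have "(15 / 16 :: real) ^ 16 \<le> 1 / 2" by (simp add: power_divide)
    then show ?thesis unfolding power_mult by (rule power_mono) simp
  qed
  have four_j: "4 * real j * \<eta> T \<le> 1" if "4 * real k * \<eta> T \<le> 1" "T > 0" for T
  proof -
    have "4 * real j * \<eta> T \<le> 4 * real k * \<eta> T"
      using j \<eta>_pos[OF that(2)] by (intro mult_right_mono) auto
    with that show ?thesis by linarith
  qed
  \<comment> \<open>Induction on a bound \<open>m\<close> for the number of scales between 1 and the
    real number \<open>T\<close>.\<close>
  have "\<forall>T. 1 \<le> T \<longrightarrow> T \<le> L\<^sup>2 \<longrightarrow> 4 * real k * \<eta> T \<le> 1 \<longrightarrow> T < 4 ^ m \<longrightarrow> \<Psi> j (?F (K * T)) \<le> 8 * \<eta> T" for m :: nat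
  proof (induction m)
    case 0
    then show ?case by auto
  next
    case (Suc m)
    show ?case
    proof (intro allI impI)
      fix T assume T: "1 \<le> T" "T \<le> L\<^sup>2" "4 * real k * \<eta> T \<le> 1" "T < 4 ^ Suc m"
      note rounds = local_rounds[OF s bound[OF T(1,2)] four_j[OF T(3)]]
      show "\<Psi> j (?F (K * T)) \<le> 8 * \<eta> T"
      proof (cases "1 \<le> T / 4 \<and> 4 * real k * \<eta> (T / 4) \<le> 1")
        case True
        then have IH: "\<Psi> j (?F (K * (T / 4))) \<le> 8 * \<eta> (T / 4)"
          using Suc T by (intro Suc[rule_format]) auto
        \<comment> \<open>Halving \<open>d + 1\<close> times turns
          \<open>8 * \<eta> (T / 4) = 8 * 2 ^ d * \<eta> T\<close> into \<open>4 * \<eta> T\<close>.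
          The rounds fit into the part \<open>3 / 4 * K * T\<close> of the time that the smaller
          scale leaves.\<close>
        let ?R = "16 * (d + 1)"
        have "\<Psi> j (?F (K * T)) \<le> \<Psi> j (?F (real ?R * (T + 1) + K * (T / 4)))"
        proof (rule Psi_flow_mono[OF s])
          have "real ?R * (T + 1) \<le> (32 * real d) * (2 * T)"
            using T d by (intro mult_mono) auto
          also have "\<dots> \<le> (3 / 4 * K) * T"
            using T unfolding K_def mult.assoc[symmetric] by (intro mult_right_mono) auto
          finally show "real ?R * (T + 1) + K * (T / 4) \<le> K * T" by simp
        qed (use T K in auto)
        also have "\<dots> \<le> (15 / 16) ^ ?R * \<Psi> j (?F (K * (T / 4))) + 4 * \<eta> T"
          using T K \<eta>_pos[of T] by (intro rounds) auto
        also have "(15 / 16) ^ ?R * \<Psi> j (?F (K * (T / 4))) \<le> (1 / 2) ^ (d + 1) * (8 * \<eta> (T / 4))"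
        proof -
          have "(15 / 16) ^ ?R * \<Psi> j (?F (K * (T / 4))) \<le> (15 / 16) ^ ?R * (8 * \<eta> (T / 4))"
            by (intro mult_left_mono IH) simp
          also have "\<dots> \<le> (1 / 2) ^ (d + 1) * (8 * \<eta> (T / 4))"
            using \<eta>_pos[of "T / 4"] T by (intro mult_right_mono rate) auto
          finally show ?thesis .
        qed
        also have "(1 / 2) ^ (d + 1) * (8 * \<eta> (T / 4)) = 4 * \<eta> T"
          using T by (simp add: \<eta>_quarter power_divide)
        finally show ?thesis by simp
      next
        case False
        \<comment> \<open>This is the first admissible scale: \<open>T / 4\<close> is below 1 or
          violates the density condition. Either way \<open>\<eta> T\<close> cannot be small, and
          \<open>d + b\<close> halvings of the trivial bound 1 get below
          \<open>4 * \<eta> T\<close>.\<close>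
        have lower: "1 \<le> 2 ^ d * (4 * real k) * \<eta> T"
        proof (cases "1 \<le> T / 4")
          case True
          with False have "1 \<le> 4 * real k * \<eta> (T / 4)" by simp
          then show ?thesis using T by (simp add: \<eta>_quarter mult_ac)
        next
          case False
          have "1 \<le> 2 * (2 ^ g / sqrt T)"
          proof -
            have "sqrt T \<le> sqrt 4" using False by (intro real_sqrt_le_mono) simp
            then have "sqrt T \<le> 2 * 1" by simp
            also have "\<dots> \<le> 2 * (2 ^ g :: real)" by (intro mult_left_mono one_le_power) auto
            finally show ?thesis using T by (simp add: field_simps)
          qed
          then have "1 \<le> (2 * (2 ^ g / sqrt T)) ^ d" by (rule one_le_power)
          also have "\<dots> = 2 ^ d * 1 * \<eta> T" by (simp add: \<eta>_def power_mult_distrib power_divide)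
          also have "\<dots> \<le> 2 ^ d * (4 * real k) * \<eta> T"
            using k(1) \<eta>_pos[of T] T by (intro mult_right_mono mult_left_mono) auto
          finally show ?thesis .
        qed
        let ?R = "16 * (d + b)"
        have "\<Psi> j (?F (K * T)) \<le> \<Psi> j (?F (real ?R * (T + 1) + 0))"
        proof (rule Psi_flow_mono[OF s])
          have "real ?R * (T + 1) \<le> (16 * (real d + real b)) * (2 * T)"
            using T by (intro mult_mono) auto
          also have "\<dots> \<le> K * T"
            using T unfolding K_def mult.assoc[symmetric] by (intro mult_right_mono) auto
          finally show "real ?R * (T + 1) + 0 \<le> K * T" by simp
        qed (use T K in auto)
        also have "\<dots> \<le> (15 / 16) ^ ?R * \<Psi> j (?F 0) + 4 * \<eta> T"
          using T K \<eta>_pos[of T] by (intro rounds) auto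
        also have "(15 / 16) ^ ?R * \<Psi> j (?F 0) \<le> (1 / 2) ^ (d + b) * 1"
          by (intro mult_mono rate Psi_flow_le_1[OF s]) (auto simp: \<Psi>_def intro!: sum_nonneg divide_nonneg_nonneg)
        also have "(1 / 2) ^ (d + b) * 1 \<le> 4 * \<eta> T"
        proof -
          have "2 ^ d * (4 * real k) * \<eta> T \<le> 2 ^ d * (4 * 2 ^ b) * \<eta> T"
            using k(2) \<eta>_pos[of T] T by (intro mult_right_mono mult_left_mono) auto
          with lower show ?thesis by (simp add: power_add power_divide field_simps)
        qed
        finally show ?thesis by simp
      qed
    qed
  qed
  moreover obtain m :: nat where "T < 4 ^ m"
    using real_arch_pow[of 4 T] by auto
  ultimately have "\<Psi> j (?F (K * T)) \<le> 8 * \<eta> T"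
    using T by blast
  moreover have "\<Psi> j (?F t) \<le> \<Psi> j (?F (K * T))"
    using t T K by (intro Psi_flow_mono[OF s]) (auto simp: K_def)
  ultimately show ?thesis by linarith
qed

theorem mixing_time_bound:
  fixes b d g k :: nat and L t :: real
  assumes d: "d \<ge> 1" and L: "L \<ge> 1" "n = L ^ d"
    and bound: "\<And>T x y. 1 \<le> T \<Longrightarrow> T \<le> L\<^sup>2 \<Longrightarrow> x \<in> V \<Longrightarrow> y \<in> V \<Longrightarrow> p T x y \<le> (2 ^ g / sqrt T) ^ d"
    and global: "\<And>x y. x \<in> V \<Longrightarrow> y \<in> V \<Longrightarrow> p t x y \<le> 3 / (2 * n)" and t: "t > 0"
    and k: "1 \<le> k" "2 * real k \<le> n" "real k \<le> 2 ^ b"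
  shows "mixing_time V E k
    \<le> ereal (100 * (real d + real b) * L\<^sup>2 + 32 * (7 + real g * real d + 3 * real b) * (32 * t + 1))"
proof -
  define K where "K = 100 * (real d + real b) * L\<^sup>2"
  \<comment> \<open>\<open>3 + g * d + b\<close> halvings make up for the bound on
    \<open>n * \<Psi>\<close> after the local phases, and \<open>4 + 2 * b\<close> further ones lead
    to \<open>(1 / (4 * 2 ^ b))\<^sup>2\<close>.\<close>
  define r where "r = 7 + g * d + 3 * b"
  have K: "K \<ge> 0" by (simp add: K_def)
  have rate: "(31 / 32 :: real) ^ (32 * r) \<le> (1 / 2) ^ r"
  proof -
    have "(31 / 32 :: real) ^ 32 \<le> 1 / 2" by (simp add: power_divide)
    then show ?thesis unfolding power_mult by (rule power_mono) simp
  qed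
  have "(n - real j) * (\<Psi> j (marked.P (real (32 * r) * (32 * t + 1) + K) (indicator {s})) - 1 / (n - real j))
      \<le> (1 / (4 * real k))\<^sup>2" if j: "j < k" and s: "s \<in> \<M> j" for j s
  proof -
    let ?F = "\<lambda>t. marked.P t (indicator {s})"
    have N: "n - real j > 0" "n - real j \<le> n" using j k by auto
    have "\<Psi> j (?F (real (32 * r) * (32 * t + 1) + K)) - 1 / (n - real j)
        \<le> (31 / 32) ^ (32 * r) * (\<Psi> j (?F K) - 1 / (n - real j))"
      using j k t K by (intro global_rounds[OF s global]) auto
    also have "\<dots> \<le> (31 / 32) ^ (32 * r) * \<Psi> j (?F K)"
      using N by (intro mult_left_mono) auto
    also have "\<dots> \<le> (1 / 2) ^ r * \<Psi> j (?F K)"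
      by (intro mult_right_mono rate) (auto simp: \<Psi>_def intro!: sum_nonneg divide_nonneg_nonneg flow_nonneg[OF s K] simp: marked_configurations_def)
    finally have "(n - real j) * (\<Psi> j (?F (real (32 * r) * (32 * t + 1) + K)) - 1 / (n - real j))
       \<le> (n - real j) * ((1 / 2) ^ r * \<Psi> j (?F K))"
      using N by (intro mult_left_mono) auto
    also have "\<dots> \<le> n * ((1 / 2) ^ r * \<Psi> j (?F K))"
      using N by (intro mult_right_mono) (auto simp: \<Psi>_def intro!: sum_nonneg mult_nonneg_nonneg divide_nonneg_nonneg flow_nonneg[OF s K] simp: marked_configurations_def)
    also have "\<dots> = (1 / 2) ^ r * (n * \<Psi> j (?F K))" by simp
    also have "n * \<Psi> j (?F K) \<le> 2 ^ (3 + g * d + b)"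
    proof (cases "4 * real k * (2 ^ g / sqrt (L\<^sup>2)) ^ d \<le> 1")
      case True
      then have "\<Psi> j (?F K) \<le> 8 * (2 ^ g / sqrt (L\<^sup>2)) ^ d"
        using j k d L bound by (intro local_phases[OF s, where k = k and b = b and L = L]) (auto simp: K_def)
      also have "\<dots> = 8 * 2 ^ (g * d) / n"
        using L by (simp add: power_divide power_mult[symmetric])
      finally have "n * \<Psi> j (?F K) \<le> 8 * 2 ^ (g * d)"
        using n_pos by (simp add: field_simps)
      also have "\<dots> \<le> 8 * 2 ^ (g * d) * 2 ^ b" by simp
      finally show ?thesis by (simp add: power_add)
    next
      \<comment> \<open>If the balls are too dense even at scale \<open>L\<^sup>2\<close>, then
        \<open>n\<close> itself is at most of order \<open>k * 2 ^ (g * d)\<close>, and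
        \<open>\<Psi> \<le> 1\<close> is good enough.\<close>
      case False
      then have "n \<le> 4 * real k * 2 ^ (g * d)"
        using L by (simp add: power_divide power_mult[symmetric] field_simps)
      also have "\<dots> \<le> 4 * 2 ^ b * 2 ^ (g * d)"
        using k by (intro mult_right_mono mult_left_mono) auto
      finally have "n \<le> 2 ^ (3 + g * d + b)" by (simp add: power_add mult_ac)
      moreover have "n * \<Psi> j (?F K) \<le> n * 1"
        using n_pos by (intro mult_left_mono Psi_flow_le_1[OF s K]) auto
      ultimately show ?thesis by linarith
    qed
    also have "(1 / 2 :: real) ^ r * 2 ^ (3 + g * d + b) = (1 / (4 * 2 ^ b))\<^sup>2"
    proof -
      have "r = (3 + g * d + b) + (4 + 2 * b)" by (simp add: r_def)
      then have "(1 / 2 :: real) ^ r * 2 ^ (3 + g * d + b) = ((1 / 2) * 2) ^ (3 + g * d + b) * (1 / 2) ^ (4 + 2 * b)"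
        by (simp only: power_add power_mult_distrib mult_ac)
      also have "\<dots> = (1 / 2) ^ (2 * (2 + b))" by (simp add: power_add power_divide)
      also have "\<dots> = ((1 / 2) ^ (2 + b))\<^sup>2" by (simp only: power_mult mult.commute[of 2])
      also have "(1 / 2 :: real) ^ (2 + b) = 1 / (4 * 2 ^ b)" by (simp add: power_add power_divide)
      finally show ?thesis .
    qed
    also have "\<dots> \<le> (1 / (4 * real k))\<^sup>2"
      using k by (intro power_mono divide_left_mono mult_left_mono) auto
    finally show ?thesis by simp
  qed
  then have "mixing_time V E k \<le> ereal (real (32 * r) * (32 * t + 1) + K)"
    using t K k by (intro mixing_time_le) auto
  also have "real (32 * r) * (32 * t + 1) + K
     = 100 * (real d + real b) * L\<^sup>2 + 32 * (7 + real g * real d + 3 * real b) * (32 * t + 1)"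
    by (simp add: K_def r_def)
  finally show ?thesis .
qed

end

section \<open>The heat kernel of a cycle\<close>

text \<open>For \<open>x \<le> 2\<close> the cubic error term is at most
  \<open>4 * x / 6\<close>.\<close>

lemma sin_ge_third:
  fixes x :: real
  assumes "0 \<le> x" "x \<le> 2"
  shows "x / 3 \<le> sin x"
proof -
  have "\<bar>sin x - x\<bar> \<le> \<bar>x\<bar> ^ 3 / 6"
    using Maclaurin_sin_bound[of x 3] by (simp add: numeral_3_eq_3 sin_coeff_def)
  moreover have "\<bar>x\<bar> ^ 3 \<le> 4 * x"
  proof -
    have "x ^ 2 * x \<le> 2 ^ 2 * x" using assms by (intro mult_right_mono power_mono) auto
    then show ?thesis using assms by (simp add: power3_eq_cube power2_eq_square)
  qed
  ultimately show ?thesis by linarith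
qed

text \<open>The left side is twice the squared sine of half the angle, with \<open>m\<close>
  reflected to the nearer end of the circle. The bounds \<open>2 \<le> pi < 4\<close> keep that half
  angle between \<open>2 * i / L\<close> and 2.\<close>

lemma one_minus_cos_ge:
  assumes "m \<le> L" "0 < L"
  shows "8 / 9 * (real (min m (L - m)) / real L)\<^sup>2 \<le> 1 - cos (2 * pi * real m / real L)"
proof -
  define i where "i = min m (L - m)"
  define x where "x = pi * real i / real L"
  have i: "2 * i \<le> L" "i \<le> L" by (auto simp: i_def)
  have "cos (2 * pi * real m / real L) = cos (2 * x)"
  proof (cases "i = m")
    case False
    then have "i = L - m" by (auto simp: i_def min_def split: if_splits)
    then have "2 * pi * real m / real L = 2 * pi - 2 * x"
      using assms by (simp add: x_def of_nat_diff field_simps)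
    then show ?thesis by (simp add: cos_diff)
  qed (simp add: x_def mult.assoc)
  then have "1 - cos (2 * pi * real m / real L) = 2 * (sin x)\<^sup>2"
    by (simp add: cos_double sin_squared_eq)
  moreover have x: "2 * (real i / real L) \<le> x"
    using assms pi_ge_two by (simp add: x_def divide_right_mono mult_right_mono)
  moreover have "x \<le> 2"
  proof -
    have "pi * real i \<le> 4 * (real L / 2)"
      using i pi_less_4 by (intro mult_mono) (auto simp: field_simps)
    then show ?thesis using assms by (simp add: x_def field_simps)
  qed
  moreover have "0 \<le> real i / real L" by simp
  ultimately have "2 / 3 * (real i / real L) \<le> sin x"
    using sin_ge_third[of x] by linarith
  then have "(2 / 3 * (real i / real L))\<^sup>2 \<le> (sin x)\<^sup>2"
    by (intro power_mono) auto
  moreover have "(2 / 3 * (real i / real L))\<^sup>2 = 4 / 9 * (real i / real L)\<^sup>2"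
    by (simp add: power2_eq_square)
  ultimately show ?thesis
    unfolding \<open>1 - cos (2 * pi * real m / real L) = 2 * (sin x)\<^sup>2\<close> i_def[symmetric] by linarith
qed

text \<open>The real part of a geometric sum of roots of unity; it makes the Fourier formula below
  start from a point mass.\<close>

lemma sum_cos_roots:
  assumes "0 < L"
  shows "(\<Sum>m<L. cos (2 * pi * real m * of_int j / real L)) = (if int L dvd j then real L else 0)"
proof -
  let ?a = "\<lambda>m. (2 * pi * real m * of_int j / real L)"
  define z where "z = cis (2 * pi * of_int j / real L)"
  have z: "z ^ m = cis (?a m)" for m
  proof -
    have "real m * (2 * pi * of_int j / real L) = 2 * pi * real m * of_int j / real L" by simp
    then show ?thesis unfolding z_def Complex.DeMoivre by (simp only:)
  qed
  have "(\<Sum>m<L. cos (?a m)) = Re (\<Sum>m<L. z ^ m)"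
    by (simp add: z)
  also have "\<dots> = (if int L dvd j then real L else 0)"
  proof (cases "int L dvd j")
    case True
    then obtain r where "j = int L * r" by (auto simp: dvd_def)
    then have "z = 1"
      using assms cis_multiple_2pi[of "of_int r"] by (simp add: z_def mult.assoc)
    then show ?thesis using True by simp
  next
    case False
    have "z \<noteq> 1"
    proof
      assume "z = 1"
      then have "cos (2 * pi * of_int j / real L) = 1" by (simp add: z_def complex_eq_iff)
      then obtain r :: int where "2 * pi * of_int j / real L = of_int r * 2 * pi"
        by (auto simp: cos_one_2pi_int)
      then have "real_of_int j = real_of_int (r * int L)"
        using assms by (simp add: field_simps)
      then have "j = r * int L" by (simp only: of_int_eq_iff)
      then show False using False by simp
    qed
    moreover have "z ^ L = 1"
      using assms z[of L] cis_multiple_2pi[of "of_int j"] by (simp add: mult.assoc)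
    ultimately show ?thesis using False by (simp add: geometric_sum)
  qed
  finally show ?thesis .
qed

text \<open>In the cycle with two vertices both steps lead to the same neighbour along a single edge,
  so each of them gets the rate 1/2.\<close>

definition step_rate :: "nat \<Rightarrow> real" where
  "step_rate L = (if L = 2 then 1 / 2 else 1)"

text \<open>The eigenvalue of minus the generator of the walk on the cycle for the Fourier mode
  \<open>m\<close>.\<close>

definition cycle_rate :: "nat \<Rightarrow> nat \<Rightarrow> real" where
  "cycle_rate L m = 2 * step_rate L * (1 - cos (2 * pi * real m / real L))"

text \<open>The Fourier expansion of the heat kernel in terms of the displacement \<open>j\<close>.
  Taking \<open>j\<close> in the integers avoids wrapping around; periodicity restores the
  cycle.\<close>

definition cycle_kernel :: "nat \<Rightarrow> real \<Rightarrow> int \<Rightarrow> real" where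
  "cycle_kernel L t j =
     (\<Sum>m<L. exp (- cycle_rate L m * t) * cos (2 * pi * real m * of_int j / real L)) / real L"

lemma step_rate_ge: "1 / 2 \<le> step_rate L"
  by (simp add: step_rate_def)

lemma cycle_kernel_0:
  assumes "0 < L"
  shows "cycle_kernel L 0 j = of_bool (int L dvd j)"
  using assms by (simp add: cycle_kernel_def sum_cos_roots)

lemma cycle_kernel_periodic:
  assumes "0 < L" "j mod int L = j' mod int L"
  shows "cycle_kernel L t j = cycle_kernel L t j'"
proof -
  obtain r where "j = j' + int L * r"
    using assms(2) by (metis mod_eqE)
  then have "2 * pi * real m * of_int j / real L
     = 2 * pi * real m * of_int j' / real L + 2 * pi * of_int (int m * r)" for m
    using assms(1) by (simp add: field_simps)
  moreover have "cos (a + 2 * pi * of_int (int m * r)) = cos a" for a m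
    unfolding cos_add cos_int_2pin sin_int_2pin by simp
  ultimately show ?thesis by (simp add: cycle_kernel_def)
qed

lemma cycle_kernel_has_derivative:
  assumes "0 < L"
  shows "((\<lambda>t. cycle_kernel L t j) has_real_derivative
    step_rate L * ((cycle_kernel L t (j + 1) - cycle_kernel L t j) + (cycle_kernel L t (j - 1) - cycle_kernel L t j))) (at t)"
proof -
  let ?c = "\<lambda>m j. cos (2 * pi * real m * of_int j / real L)"
  let ?e = "\<lambda>m. exp (- cycle_rate L m * t)"
  have "((\<lambda>t. cycle_kernel L t j) has_real_derivative (\<Sum>m<L. - cycle_rate L m * ?e m * ?c m j) / real L) (at t)"
    unfolding cycle_kernel_def
    by (rule DERIV_cdivide, rule DERIV_sum) (auto intro!: derivative_eq_intros)
  moreover have "- cycle_rate L m * ?e m * ?c m j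
     = step_rate L * ((?e m * ?c m (j + 1) - ?e m * ?c m j) + (?e m * ?c m (j - 1) - ?e m * ?c m j))" for m
  proof -
    have "?c m (j + 1) + ?c m (j - 1) = 2 * cos (2 * pi * real m / real L) * ?c m j"
    proof -
      have "2 * pi * real m * of_int (j + 1) / real L = 2 * pi * real m * of_int j / real L + 2 * pi * real m / real L"
        "2 * pi * real m * of_int (j - 1) / real L = 2 * pi * real m * of_int j / real L - 2 * pi * real m / real L"
        by (simp_all add: algebra_simps add_divide_distrib diff_divide_distrib)
      then show ?thesis by (simp add: cos_add cos_diff)
    qed
    then have c1: "?c m (j + 1) = 2 * cos (2 * pi * real m / real L) * ?c m j - ?c m (j - 1)" by simp
    show ?thesis
      unfolding c1 cycle_rate_def by (simp add: algebra_simps)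
  qed
  moreover have "step_rate L * ((cycle_kernel L t (j + 1) - cycle_kernel L t j) + (cycle_kernel L t (j - 1) - cycle_kernel L t j))
     = (\<Sum>m<L. step_rate L * ((?e m * ?c m (j + 1) - ?e m * ?c m j) + (?e m * ?c m (j - 1) - ?e m * ?c m j))) / real L"
    unfolding cycle_kernel_def
    by (simp only: sum_distrib_left[symmetric] sum.distrib sum_subtractf)
       (simp add: divide_inverse algebra_simps)
  ultimately show ?thesis by (simp only:)
qed

section \<open>Bounds on the cycle kernel\<close>

lemma abs_cycle_kernel_le:
  assumes L: "2 \<le> L" and t: "0 \<le> t"
  shows "\<bar>cycle_kernel L t j\<bar> \<le> (1 + 2 * (\<Sum>i\<in>{1..<L}. exp (- (8 / 9 * t / (real L)\<^sup>2) * (real i)\<^sup>2))) / real L"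
    (is "_ \<le> (1 + 2 * (\<Sum>i\<in>_. ?g i)) / _")
proof -
  let ?e = "\<lambda>m. exp (- cycle_rate L m * t)"
  have "\<bar>cycle_kernel L t j\<bar> \<le> (\<Sum>m<L. (?e m)) / real L"
    unfolding cycle_kernel_def
    by (auto simp: abs_mult intro!: divide_right_mono order_trans[OF sum_abs] sum_mono mult_left_le)
  also have "(\<Sum>m<L. (?e m)) = 1 + (\<Sum>m\<in>{1..<L}. (?e m))"
  proof -
    have "{..<L} = insert 0 {1..<L}" using L by auto
    then show ?thesis by (simp add: cycle_rate_def)
  qed
  also have "(\<Sum>m\<in>{1..<L}. (?e m)) \<le> (\<Sum>m\<in>{1..<L}. ?g m + ?g (L - m))"
  proof (rule sum_mono)
    fix m assume m: "m \<in> {1..<L}"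
    have "2 * (1 / 2) * (8 / 9 * (real (min m (L - m)) / real L)\<^sup>2) \<le> cycle_rate L m"
      unfolding cycle_rate_def using m L step_rate_ge[of L]
      by (intro mult_mono one_minus_cos_ge) auto
    then have "8 / 9 * (real (min m (L - m)) / real L)\<^sup>2 * t \<le> cycle_rate L m * t"
      using t by (intro mult_right_mono) auto
    then have "(?e m) \<le> ?g (min m (L - m))"
      by (simp add: power_divide mult_ac)
    \<comment> \<open>Adding the terms of both ends removes the minimum, at the price of a factor 2
      in the sum.\<close>
    also have "\<dots> \<le> ?g m + ?g (L - m)" by (simp add: min_def)
    finally show "(?e m) \<le> ?g m + ?g (L - m)" .
  qed
  also have "\<dots> = 2 * (\<Sum>m\<in>{1..<L}. ?g m)"
  proof -
    have "(\<Sum>m\<in>{1..<L}. ?g (L - m)) = (\<Sum>m\<in>{1..<L}. ?g m)"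
      by (rule sum.reindex_bij_witness[where i = "\<lambda>m. L - m" and j = "\<lambda>m. L - m"]) auto
    then show ?thesis by (simp add: sum.distrib)
  qed
  finally show ?thesis by (simp add: divide_right_mono)
qed

lemma sum_exp_le:
  assumes "0 < a"
  shows "(\<Sum>i\<in>{1..<L}. exp (- a * real i)) \<le> 1 / (exp a - 1)"
proof -
  let ?s = "(\<Sum>i\<in>{1..<L}. exp (- a) ^ i)"
  have "(\<Sum>i\<in>{1..<L}. exp (- a * real i)) = ?s"
    by (simp add: exp_of_nat_mult[symmetric] mult.commute)
  also have "\<dots> \<le> exp (- a) / (1 - exp (- a))"
  proof -
    have "(1 - exp (- a)) * ?s \<le> exp (- a)"
    proof (cases "L = 0")
      case False
      have "(1 - exp (- a)) * (\<Sum>i<L. exp (- a) ^ i) = 1 - exp (- a) ^ L"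
        by (simp add: sum_gp_strict)
      moreover have "(\<Sum>i<L. exp (- a) ^ i) = 1 + ?s"
      proof -
        have "{..<L} = insert 0 {1..<L}" using False by auto
        then show ?thesis by simp
      qed
      ultimately have "(1 - exp (- a)) + (1 - exp (- a)) * ?s = 1 - exp (- a) ^ L"
        by (simp only: distrib_left mult_1_right)
      moreover have "0 \<le> exp (- a) ^ L" by simp
      ultimately show ?thesis by linarith
    qed simp
    then show ?thesis using assms by (simp add: field_simps)
  qed
  also have "\<dots> = 1 / (exp a - 1)"
    using assms by (simp add: exp_minus field_simps)
  finally show ?thesis .
qed

text \<open>The Gaussian sum is compared with a geometric one by
  \<open>(b * i - 1 / 2)\<^sup>2 \<ge> 0\<close>, which costs a factor \<open>exp 1 \<le> 3\<close>.
  For \<open>t \<le> L\<^sup>2\<close> the zero mode is absorbed as well. The 8 becomes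
  \<open>2 ^ 3\<close>, that is, \<open>g = 3\<close>, for the torus.\<close>

lemma cycle_kernel_le_sqrt:
  assumes L: "2 \<le> L" and t: "0 < t" "t \<le> (real L)\<^sup>2"
  shows "\<bar>cycle_kernel L t j\<bar> \<le> 8 / sqrt t"
proof -
  let ?S = "(\<Sum>i\<in>{1..<L}. exp (- (8 / 9 * t / (real L)\<^sup>2) * (real i)\<^sup>2))"
  define b where "b = sqrt (8 / 9 * t / (real L)\<^sup>2)"
  have b: "b > 0" "b\<^sup>2 = 8 / 9 * t / (real L)\<^sup>2" using t(1) L by (auto simp: b_def)
  have "exp (- (8 / 9 * t / (real L)\<^sup>2) * (real i)\<^sup>2) \<le> exp 1 * exp (- b * real i)" for i
  proof -
    have "- (b\<^sup>2) * (real i)\<^sup>2 \<le> 1 + - b * real i"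
      using zero_le_power2[of "b * real i - 1 / 2"] by (simp add: power2_eq_square algebra_simps)
    then show ?thesis unfolding b(2)[symmetric] exp_add[symmetric] by simp
  qed
  then have "?S \<le> exp 1 * (\<Sum>i\<in>{1..<L}. exp (- b * real i))"
    by (simp add: sum_distrib_left sum_mono)
  also have "\<dots> \<le> 3 * (1 / b)"
  proof (intro mult_mono)
    have "(\<Sum>i\<in>{1..<L}. exp (- b * real i)) \<le> 1 / (exp b - 1)" by (rule sum_exp_le[OF b(1)])
    also have "\<dots> \<le> 1 / b"
    proof -
      have "b \<le> exp b - 1" using exp_ge_add_one_self[of b] by linarith
      then show ?thesis using b(1) by (intro divide_left_mono) auto
    qed
    finally show "(\<Sum>i\<in>{1..<L}. exp (- b * real i)) \<le> 1 / b" .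
  qed (use exp_le b in \<open>auto intro: sum_nonneg\<close>)
  finally have S: "?S \<le> 3 / b" by simp
  \<comment> \<open>\<open>6 / 7\<close> is a rational lower bound for \<open>sqrt (8 / 9)\<close>,
    chosen so that \<open>1 + 2 * (7 / 2)\<close> is exactly 8.\<close>
  have "6 / 7 * (sqrt t / real L) \<le> b"
  proof -
    have "(6 / 7 * (sqrt t / real L))\<^sup>2 \<le> b\<^sup>2"
    proof -
      have "36 / 49 * (t / (real L)\<^sup>2) \<le> 8 / 9 * (t / (real L)\<^sup>2)"
        using t(1) by (intro mult_right_mono divide_nonneg_nonneg) simp_all
      moreover have "(6 / 7 * (sqrt t / real L))\<^sup>2 = 36 / 49 * (t / (real L)\<^sup>2)"
        using t(1) by (simp add: power_mult_distrib power_divide)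
      moreover have "b\<^sup>2 = 8 / 9 * (t / (real L)\<^sup>2)"
        unfolding b(2) by simp
      ultimately show ?thesis by (simp only:)
    qed
    then show ?thesis by (rule power2_le_imp_le) (simp add: b(1) less_imp_le)
  qed
  define y where "y = real L / sqrt t"
  have "3 / b \<le> 3 / (6 / 7 * (sqrt t / real L))"
    using \<open>6 / 7 * (sqrt t / real L) \<le> b\<close> t(1) L b(1) by (intro divide_left_mono mult_pos_pos divide_pos_pos) auto
  also have "\<dots> = 7 / 2 * y" by (simp add: y_def)
  finally have S': "?S \<le> 7 / 2 * y"
    using S by (rule order_trans[rotated])
  have "sqrt t \<le> real L" using real_sqrt_le_mono[OF t(2)] by simp
  then have "1 \<le> y" using t(1) by (simp add: y_def)
  with S' have "1 + 2 * ?S \<le> 8 * y"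
    by linarith
  then have "\<bar>cycle_kernel L t j\<bar> \<le> 8 * y / real L"
    using t(1) by (intro order_trans[OF abs_cycle_kernel_le[OF L]] divide_right_mono) auto
  also have "\<dots> = 8 / sqrt t" using L by (simp add: y_def)
  finally show ?thesis .
qed

lemma log_dim_pos:
  assumes "d \<ge> 1"
  shows "1 / 2 \<le> log_dim d"
proof (cases "d = 1")
  case False
  then have "ln 2 \<le> ln (real d)" using assms by simp
  then show ?thesis using False ln2_ge_two_thirds by (simp add: log_dim_def)
qed (simp add: log_dim_def)

text \<open>The 9 makes the exponent \<open>a\<close> equal to \<open>8 * log_dim d\<close>. Then
  \<open>exp a\<close>, which is \<open>d ^ 8\<close> for \<open>d \<ge> 2\<close>, is at least
  \<open>7 * d\<close>, and the nonconstant modes add up to at most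
  \<open>1 / (3 * d)\<close>.\<close>

lemma cycle_kernel_le_mixed:
  assumes L: "2 \<le> L" and d: "d \<ge> 1"
  shows "\<bar>cycle_kernel L (9 * (real L)\<^sup>2 * log_dim d) j\<bar> \<le> (1 + 1 / (3 * real d)) / real L"
proof -
  let ?t = "9 * (real L)\<^sup>2 * log_dim d"
  let ?S = "(\<Sum>i\<in>{1..<L}. exp (- (8 / 9 * ?t / (real L)\<^sup>2) * (real i)\<^sup>2))"
  define a where "a = 8 * log_dim d"
  have a: "a > 0" using log_dim_pos[OF d] by (simp add: a_def)
  have a_eq: "8 / 9 * ?t / (real L)\<^sup>2 = a" using L by (simp add: a_def)
  have "7 * real d \<le> exp a"
  proof (cases "d = 1")
    case True
    then show ?thesis using exp_ge_add_one_self[of 8] by (simp add: a_def log_dim_def)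
  next
    case False
    then have "exp a = exp (ln (real d)) ^ 8"
      unfolding a_def log_dim_def using exp_of_nat_mult[of 8 "ln (real d)"] by simp
    also have "\<dots> = real d ^ 7 * real d" using d by (simp add: power_Suc2[symmetric])
    also have "\<dots> \<ge> 2 ^ 7 * real d"
      using False d by (intro mult_right_mono power_mono) auto
    finally show ?thesis using d by simp
  qed
  then have e: "6 * real d \<le> exp a - 1" using d by simp
  have "?S \<le> (\<Sum>i\<in>{1..<L}. exp (- a * real i))"
    unfolding a_eq
  proof (rule sum_mono)
    fix i assume "i \<in> {1..<L}"
    then have "real i \<le> (real i)\<^sup>2" by (simp add: power2_eq_square)
    then show "exp (- a * (real i)\<^sup>2) \<le> exp (- a * real i)" using a by simp
  qed
  also have "\<dots> \<le> 1 / (exp a - 1)" by (rule sum_exp_le[OF a])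
  also have "\<dots> \<le> 1 / (6 * real d)"
  proof -
    have "0 < real d" using d by simp
    with e have "0 < 6 * real d" "0 < exp a - 1" by linarith+
    with e show ?thesis by (intro divide_left_mono mult_pos_pos) auto
  qed
  finally have "1 + 2 * ?S \<le> 1 + 1 / (3 * real d)"
    by simp
  moreover have "0 \<le> ?t" using log_dim_pos[OF d] by simp
  ultimately show ?thesis
    by (intro order_trans[OF abs_cycle_kernel_le[OF L]] divide_right_mono) auto
qed

section \<open>The torus\<close>

definition step_up :: "nat \<Rightarrow> (nat \<Rightarrow> nat) \<Rightarrow> nat \<Rightarrow> nat \<Rightarrow> nat" where
  "step_up L x i = x(i := (x i + 1) mod L)"

definition step_down :: "nat \<Rightarrow> (nat \<Rightarrow> nat) \<Rightarrow> nat \<Rightarrow> nat \<Rightarrow> nat" where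
  "step_down L x i = x(i := (x i + L - 1) mod L)"

definition torus_nbrs :: "nat \<Rightarrow> nat \<Rightarrow> (nat \<Rightarrow> nat) \<Rightarrow> (nat \<Rightarrow> nat) set" where
  "torus_nbrs d L x = step_up L x ` {..<d} \<union> step_down L x ` {..<d}"

text \<open>The target \<open>y\<close> precedes the start \<open>x\<close>, so that the partial
  application to \<open>y\<close> is a function on which the generator acts.\<close>

definition torus_kernel :: "nat \<Rightarrow> nat \<Rightarrow> real \<Rightarrow> (nat \<Rightarrow> nat) \<Rightarrow> (nat \<Rightarrow> nat) \<Rightarrow> real" where
  "torus_kernel d L t y x = (\<Prod>i<d. cycle_kernel L t (int (x i) - int (y i)))"

context
  fixes d L :: nat
  assumes d: "d \<ge> 1" and L: "L \<ge> 2"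
begin

abbreviation (input) "\<T> \<equiv> torus_vertices d L"
abbreviation (input) "\<E> \<equiv> torus_edges d L"
abbreviation (input) "\<N> \<equiv> torus_nbrs d L"
abbreviation (input) "\<K> \<equiv> torus_kernel d L"
abbreviation (input) "\<kappa> \<equiv> cycle_kernel L"

section \<open>Neighbours in the torus\<close>

lemma vertex_less: "x \<in> \<T> \<Longrightarrow> i < d \<Longrightarrow> x i < L"
  by (auto simp: torus_vertices_def PiE_iff)

lemma step_closed:
  assumes "x \<in> \<T>" "i < d"
  shows "step_up L x i \<in> \<T>" "step_down L x i \<in> \<T>"
  using assms L by (auto simp: torus_vertices_def step_up_def step_down_def PiE_iff extensional_def)

lemma step_down_up:
  assumes "x i < L"
  shows "step_down L (step_up L x i) i = x"
proof -
  have "((x i + 1) mod L + L - 1) mod L = x i"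
  proof (cases "x i + 1 = L")
    case False
    then have "(x i + 1) mod L = x i + 1" using assms by simp
    then show ?thesis using assms by simp
  qed (use assms in auto)
  then show ?thesis by (simp add: step_up_def step_down_def)
qed

lemma step_up_down:
  assumes "x i < L"
  shows "step_up L (step_down L x i) i = x"
proof -
  have "((x i + L - 1) mod L + 1) mod L = x i"
  proof (cases "x i = 0")
    case False
    then have "(x i + L - 1) mod L = x i - 1"
      using assms by (simp add: mod_if)
    then show ?thesis using assms False by simp
  qed (use L in auto)
  then show ?thesis by (simp add: step_up_def step_down_def)
qed

lemma step_neq:
  assumes "x i < L"
  shows "step_up L x i i \<noteq> x i" "step_down L x i i \<noteq> x i"
  using assms L by (auto simp: step_up_def step_down_def mod_if)

lemma incident_edges:
  assumes x: "x \<in> \<T>"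
  shows "{e \<in> \<E>. x \<in> e} = (\<lambda>y. {x, y}) ` \<N> x"
proof (intro set_eqI iffI)
  fix e assume "e \<in> {e \<in> \<E>. x \<in> e}"
  then obtain z i where e: "e = {z, step_up L z i}" "z \<in> \<T>" "i < d" "x \<in> e"
    by (auto simp: torus_edges_def step_up_def)
  then consider "x = z" | "x = step_up L z i" by auto
  then show "e \<in> (\<lambda>y. {x, y}) ` \<N> x"
  proof cases
    case 1
    then show ?thesis using e by (auto simp: torus_nbrs_def)
  next
    case 2
    then have "z = step_down L x i" using step_down_up[of z i] vertex_less e by simp
    then show ?thesis using e 2 by (auto simp: torus_nbrs_def insert_commute)
  qed
next
  fix e assume "e \<in> (\<lambda>y. {x, y}) ` \<N> x"
  then obtain i where i: "i < d" "e = {x, step_up L x i} \<or> e = {x, step_down L x i}"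
    by (auto simp: torus_nbrs_def)
  have "{x, step_down L x i} = {step_down L x i, step_up L (step_down L x i) i}"
    using step_up_down[of x i] vertex_less[OF x i(1)] by (simp add: insert_commute)
  then obtain z where "z \<in> \<T>" "e = {z, step_up L z i}"
    using i x step_closed[OF x i(1)] by metis
  then have "e \<in> \<E>"
    using i(1) by (auto simp: torus_edges_def step_up_def)
  then show "e \<in> {e \<in> \<E>. x \<in> e}" using i by auto
qed

text \<open>For \<open>L = 2\<close> the two steps in a direction coincide, and
  \<open>step_rate\<close> compensates the double counting; for larger \<open>L\<close> all
  \<open>2 * d\<close> steps lead to different vertices.\<close>

lemma sum_torus_nbrs:
  fixes f :: "(nat \<Rightarrow> nat) \<Rightarrow> real"
  assumes x: "x \<in> \<T>"
  shows "(\<Sum>y\<in>\<N> x. f y) = step_rate L * (\<Sum>i<d. f (step_up L x i) + f (step_down L x i))"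
proof -
  have inj: "inj_on (step_up L x) {..<d}" "inj_on (step_down L x) {..<d}"
  proof -
    show "inj_on (step_up L x) {..<d}"
    proof (rule inj_onI)
      fix i j assume ij: "i \<in> {..<d}" "j \<in> {..<d}" "step_up L x i = step_up L x j"
      then have "step_up L x j i \<noteq> x i" using step_neq(1)[of x i] vertex_less[OF x, of i] by simp
      then show "i = j" by (auto simp: step_up_def split: if_splits)
    qed
    show "inj_on (step_down L x) {..<d}"
    proof (rule inj_onI)
      fix i j assume ij: "i \<in> {..<d}" "j \<in> {..<d}" "step_down L x i = step_down L x j"
      then have "step_down L x j i \<noteq> x i" using step_neq(2)[of x i] vertex_less[OF x, of i] by simp
      then show "i = j" by (auto simp: step_down_def split: if_splits)
    qed
  qed
  show ?thesis
  proof (cases "L = 2")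
    case True
    have "step_up L x i = step_down L x i" for i
      by (simp add: step_up_def step_down_def True)
    then have "step_up L x = step_down L x" by blast
    then show ?thesis
      using inj by (simp add: torus_nbrs_def sum.reindex step_rate_def True sum_distrib_left)
  next
    case False
    have "step_up L x i \<noteq> step_down L x j" if "i < d" "j < d" for i j
    proof
      assume eq: "step_up L x i = step_down L x j"
      show False
      proof (cases "i = j")
        case True
        then have "(x i + 1) mod L = (x i + L - 1) mod L"
          using fun_cong[OF eq, of i] by (simp add: step_up_def step_down_def)
        then show False
          using vertex_less[OF x that(1)] L False by (auto simp: mod_if split: if_splits)
      next
        case False
        then have "step_up L x i i = x i" using fun_cong[OF eq, of i] by (simp add: step_down_def)
        then show False using step_neq(1)[of x i] vertex_less[OF x that(1)] by simp
      qed
    qed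
    then have "step_up L x ` {..<d} \<inter> step_down L x ` {..<d} = {}" by auto
    then show ?thesis
      using inj False by (simp add: torus_nbrs_def sum.union_disjoint sum.reindex step_rate_def sum.distrib)
  qed
qed

lemma nbr_neq: "x \<in> \<T> \<Longrightarrow> y \<in> \<N> x \<Longrightarrow> y \<in> \<T> \<and> y \<noteq> x"
proof -
  assume x: "x \<in> \<T>" and "y \<in> \<N> x"
  then obtain i where i: "i < d" "y = step_up L x i \<or> y = step_down L x i"
    by (auto simp: torus_nbrs_def)
  then have "y i \<noteq> x i" using step_neq[of x i] vertex_less[OF x i(1)] by auto
  then show ?thesis using i step_closed[OF x i(1)] by auto
qed

lemma card_torus_nbrs:
  assumes "x \<in> \<T>"
  shows "card (\<N> x) = (if L = 2 then d else 2 * d)"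
proof -
  have "real (card (\<N> x)) = real (if L = 2 then d else 2 * d)"
    using sum_torus_nbrs[OF assms, of "\<lambda>_. 1"] by (simp add: step_rate_def)
  then show ?thesis by (simp only: of_nat_eq_iff)
qed

lemma regular_graph_torus: "regular_graph (\<T>) (\<E>) (if L = 2 then d else 2 * d)"
proof
  show "finite (\<T>)"
    by (simp add: torus_vertices_def finite_PiE)
  show "\<T> \<noteq> {}"
    using L by (simp add: torus_vertices_def PiE_eq_empty_iff lessThan_empty_iff)
  show "1 \<le> (if L = 2 then d else 2 * d)" using d by simp
  show "e \<subseteq> \<T> \<and> card e = 2" if edge: "e \<in> \<E>" for e
  proof -
    obtain x i where e: "e = {x, step_up L x i}" "x \<in> \<T>" "i < d"
      using edge unfolding torus_edges_def step_up_def by blast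
    then have "step_up L x i \<in> \<N> x" by (simp add: torus_nbrs_def)
    from nbr_neq[OF e(2) this] show ?thesis using e by auto
  qed
  show "card {e \<in> \<E>. x \<in> e} = (if L = 2 then d else 2 * d)" if x: "x \<in> \<T>" for x
  proof -
    have "inj_on (\<lambda>y. {x, y}) (\<N> x)"
      using nbr_neq[OF x] by (auto intro!: inj_onI simp: doubleton_eq_iff)
    then show ?thesis unfolding incident_edges[OF x] by (simp add: card_image card_torus_nbrs[OF x])
  qed
qed

interpretation regular_graph "\<T>" "\<E>" "if L = 2 then d else 2 * d"
  by (rule regular_graph_torus)

lemma nbrs_eq:
  assumes x: "x \<in> \<T>"
  shows "nbrs x = \<N> x"
proof -
  have "y \<in> nbrs x \<longleftrightarrow> {x, y} \<in> {e \<in> \<E>. x \<in> e}" for y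
    by (simp add: nbrs_def)
  then show ?thesis
    unfolding incident_edges[OF x] using nbr_neq[OF x] by (auto simp: doubleton_eq_iff)
qed

lemma gen_torus:
  assumes x: "x \<in> \<T>"
  shows "gen (\<E>) flip f x
    = (\<Sum>i<d. step_rate L * ((f (step_up L x i) - f x) + (f (step_down L x i) - f x)))"
proof -
  have "gen (\<E>) flip f x = (\<Sum>y\<in>\<N> x. f y - f x)"
    unfolding gen_def nbrs_eq[OF x, symmetric] by (rule sum_edges_eq_sum_nbrs) simp
  also have "\<dots> = step_rate L * (\<Sum>i<d. (f (step_up L x i) - f x) + (f (step_down L x i) - f x))"
    by (rule sum_torus_nbrs[OF x])
  finally show ?thesis by (simp only: sum_distrib_left)
qed

section \<open>Product formula for the heat kernel of the torus\<close>

abbreviation "others t x y i \<equiv> \<Prod>k\<in>{..<d} - {i}. \<kappa> t (int (x k) - int (y k))"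

lemma torus_kernel_step:
  assumes x: "x \<in> \<T>" and i: "i < d"
  shows "\<K> t y (step_up L x i)
      = \<kappa> t (int (x i) - int (y i) + 1) * others t x y i"
    and "\<K> t y (step_down L x i)
      = \<kappa> t (int (x i) - int (y i) - 1) * others t x y i"
    and "\<K> t y x
      = \<kappa> t (int (x i) - int (y i)) * others t x y i"
proof -
  have split: "\<K> t y z = \<kappa> t (int (z i) - int (y i))
      * (\<Prod>k\<in>{..<d} - {i}. \<kappa> t (int (z k) - int (y k)))" for z
    unfolding torus_kernel_def using i by (intro prod.remove) auto
  show "\<K> t y x
      = \<kappa> t (int (x i) - int (y i)) * others t x y i"
    by (rule split)
  have "\<kappa> t (int ((x i + 1) mod L) - int (y i)) = \<kappa> t (int (x i) - int (y i) + 1)"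
    using L by (intro cycle_kernel_periodic) (auto simp: zmod_int mod_simps algebra_simps)
  then show "\<K> t y (step_up L x i)
      = \<kappa> t (int (x i) - int (y i) + 1) * others t x y i"
    unfolding split[of "step_up L x i"] by (simp add: step_up_def)
  have "\<kappa> t (int ((x i + L - 1) mod L) - int (y i)) = \<kappa> t (int (x i) - int (y i) - 1)"
  proof (rule cycle_kernel_periodic)
    have "(int ((x i + L - 1) mod L) - int (y i)) mod int L = (int (x i) + int L - 1 - int (y i)) mod int L"
      using L by (simp add: zmod_int of_nat_diff mod_simps)
    also have "int (x i) + int L - 1 - int (y i) = (int (x i) - int (y i) - 1) + int L" by simp
    finally show "(int ((x i + L - 1) mod L) - int (y i)) mod int L = (int (x i) - int (y i) - 1) mod int L"
      by simp
  qed (use L in auto)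
  then show "\<K> t y (step_down L x i)
      = \<kappa> t (int (x i) - int (y i) - 1) * others t x y i"
    unfolding split[of "step_down L x i"] by (simp add: step_down_def)
qed

text \<open>The generator is a sum over the coordinates and the product rule differentiates one
  factor at a time, so the product solves the backward equation; it starts from the indicator of
  \<open>y\<close>.\<close>

lemma p_eq_torus_kernel:
  assumes x: "x \<in> \<T>" and y: "y \<in> \<T>" and t: "t \<ge> 0"
  shows "p t x y = \<K> t y x"
proof -
  have "((\<lambda>t. \<K> t y x) has_real_derivative gen (\<E>) flip (\<K> t y) x) (at t)"
    if x: "x \<in> \<T>" for t x
  proof -
    let ?K = "\<lambda>j. \<kappa> t j" and ?j = "\<lambda>i. int (x i) - int (y i)"
    let ?slope = "\<lambda>i. ((?K (?j i + 1) - ?K (?j i)) + (?K (?j i - 1) - ?K (?j i)))"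
    let ?others = "\<lambda>i. (\<Prod>k\<in>{..<d} - {i}. ?K (?j k))"
    have "((\<lambda>t. \<K> t y x) has_real_derivative
      (\<Sum>i<d. step_rate L * (?slope i) * (?others i))) (at t)"
      unfolding torus_kernel_def using L by (intro has_field_derivative_prod cycle_kernel_has_derivative) auto
    also have "(\<Sum>i<d. step_rate L * (?slope i) * (?others i))
      = gen (\<E>) flip (\<K> t y) x"
      unfolding gen_torus[OF x]
    proof (rule sum.cong[OF refl])
      fix i assume "i \<in> {..<d}"
      then have i: "i < d" by simp
      show "step_rate L * (?slope i) * (?others i)
        = step_rate L * ((\<K> t y (step_up L x i) - \<K> t y x)
            + (\<K> t y (step_down L x i) - \<K> t y x))"
        unfolding torus_kernel_step[OF x i] by (simp add: algebra_simps)
    qed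
    finally show ?thesis .
  qed
  from vertex.heat_unique[of "\<lambda>t. \<K> t y", OF this t x]
  have "\<K> t y x = heat (\<E>) flip t (\<K> 0 y) x" .
  also have "\<dots> = heat (\<E>) flip t (indicator {y}) x"
  proof (rule vertex.heat_cong[OF _ x])
    fix x' assume x': "x' \<in> \<T>"
    have "int L dvd int (x' i) - int (y i) \<longleftrightarrow> x' i = y i" if "i < d" for i
    proof -
      have "\<bar>int (x' i) - int (y i)\<bar> < int L"
        using vertex_less[OF x' that] vertex_less[OF y that] by linarith
      then show ?thesis
        using dvd_imp_le_int[of "int (x' i) - int (y i)" "int L"] by auto
    qed
    then have "\<K> 0 y x' = (\<Prod>i<d. of_bool (x' i = y i))"
      unfolding torus_kernel_def using L by (intro prod.cong) (auto simp: cycle_kernel_0)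
    also have "\<dots> = of_bool (\<forall>i<d. x' i = y i)"
      by (auto simp: of_bool_def)
    also have "(\<forall>i<d. x' i = y i) \<longleftrightarrow> x' = y"
      using x' y PiE_ext[of x' "{..<d}" "\<lambda>_. {..<L}" y] by (auto simp: torus_vertices_def)
    finally show "\<K> 0 y x' = indicator {y} x'" by (simp add: indicator_def)
  qed
  finally show ?thesis by (simp add: p_def)
qed

lemma p_torus_le:
  assumes "x \<in> \<T>" "y \<in> \<T>" "t \<ge> 0" "\<And>j. \<bar>\<kappa> t j\<bar> \<le> c"
  shows "p t x y \<le> c ^ d"
proof -
  have "p t x y \<le> \<bar>\<Prod>i<d. \<kappa> t (int (x i) - int (y i))\<bar>"
    using p_eq_torus_kernel[OF assms(1-3)] by (simp add: torus_kernel_def)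
  also have "\<dots> = (\<Prod>i<d. \<bar>\<kappa> t (int (x i) - int (y i))\<bar>)"
    by (rule abs_prod)
  also have "\<dots> \<le> (\<Prod>i<d. c)"
    using assms(4) by (intro prod_mono) auto
  finally show ?thesis by simp
qed

section \<open>Mixing time on the torus\<close>

lemma card_torus_vertices: "real (card (\<T>)) = real L ^ d"
  by (simp add: torus_vertices_def card_PiE)

lemma mixing_time_torus_le:
  assumes k: "1 \<le> k" "real k \<le> 1 / 2 * real L ^ d"
  shows "mixing_time (\<T>) (\<E>) k
    \<le> ereal (121000 * (real d * log_dim d * (real L)\<^sup>2 + log_dim d * (real L)\<^sup>2 * ln (real k)))"
proof -
  \<comment> \<open>The factor 2 makes up for \<open>ln 2 \<ge> 1 / 2\<close>, so that
    \<open>k \<le> 2 ^ b\<close>.\<close>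
  define b where "b = nat \<lceil>2 * ln (real k)\<rceil>"
  define t where "t = 9 * (real L)\<^sup>2 * log_dim d"
  define X where "X = (real L)\<^sup>2 * log_dim d"
  define S where "S = real d + ln (real k)"
  have ln_k: "0 \<le> ln (real k)" using k by simp
  have b: "2 * ln (real k) \<le> real b" "real b \<le> 2 * ln (real k) + 1"
    using ln_k unfolding b_def by linarith+
  have k2: "real k \<le> 2 ^ b"
  proof -
    have "ln (real k) \<le> real b * (1 / 2)" using b by simp
    also have "\<dots> \<le> real b * ln 2" using ln2_ge_two_thirds by (intro mult_left_mono) auto
    also have "\<dots> = ln (2 ^ b)" by (simp add: ln_realpow)
    finally show ?thesis using k by simp
  qed
  have log_dim: "1 / 2 \<le> log_dim d" by (rule log_dim_pos[OF d])
  have L4: "4 \<le> (real L)\<^sup>2" using L power_mono[of 2 "real L" 2] by simp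
  have t_pos: "t > 0" using log_dim L by (simp add: t_def)
  have global: "p t x y \<le> 3 / (2 * real (card (\<T>)))"
    if "x \<in> \<T>" "y \<in> \<T>" for x y
  proof -
    \<comment> \<open>The \<open>d\<close> factors multiply to at most \<open>exp (1 / 3)\<close>,
      which is below 3/2 because \<open>exp 1 \<le> 3 < 27 / 8\<close>.\<close>
    have "p t x y \<le> ((1 + 1 / (3 * real d)) / real L) ^ d"
      using that t_pos unfolding t_def by (intro p_torus_le cycle_kernel_le_mixed L d) auto
    also have "\<dots> = (1 + (1 / 3) / real d) ^ d / real L ^ d"
      by (simp add: power_divide)
    also have "(1 + (1 / 3) / real d) ^ d \<le> exp (1 / 3)"
      using d by (intro exp_ge_one_plus_x_over_n_power_n) auto
    also have "exp (1 / 3) \<le> (3 / 2 :: real)"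
    proof -
      have "exp (1 / 3 :: real) ^ 3 = exp 1" by (simp add: exp_of_nat_mult[symmetric])
      also have "\<dots> \<le> (3 / 2) ^ 3" using exp_le by (simp add: power3_eq_cube)
      finally show ?thesis by (rule power_le_imp_le_base[where n = 2, simplified numeral_2_eq_2, folded numeral_3_eq_3]) simp
    qed
    finally show ?thesis by (simp add: card_torus_vertices divide_right_mono)
  qed
  have "mixing_time (\<T>) (\<E>) k
    \<le> ereal (100 * (real d + real b) * (real L)\<^sup>2 + 32 * (7 + real 3 * real d + 3 * real b) * (32 * t + 1))"
  proof (rule mixing_time_bound[OF d _ card_torus_vertices _ global t_pos k(1) _ k2])
    show "p T x y \<le> (2 ^ 3 / sqrt T) ^ d"
      if "1 \<le> T" "T \<le> (real L)\<^sup>2" "x \<in> \<T>" "y \<in> \<T>" for T x y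
      using that cycle_kernel_le_sqrt[OF L, of T] by (intro p_torus_le) auto
  qed (use L k card_torus_vertices in auto)
  \<comment> \<open>The two summands are at most 400 and \<open>416 * 289 = 120224\<close> times
    \<open>S * X\<close>; the constant is their sum rounded up.\<close>
  also have "100 * (real d + real b) * (real L)\<^sup>2 + 32 * (7 + real 3 * real d + 3 * real b) * (32 * t + 1) \<le> 121000 * (S * X)"
  proof -
    have S: "real d + real b \<le> 2 * S" "7 + real 3 * real d + 3 * real b \<le> 13 * S" "S \<ge> 0"
      using b d ln_k by (auto simp: S_def)
    have "(real L)\<^sup>2 * 1 \<le> (real L)\<^sup>2 * (2 * log_dim d)"
      using log_dim by (intro mult_left_mono) auto
    then have X: "(real L)\<^sup>2 \<le> 2 * X" by (simp add: X_def)
    then have "1 \<le> X" using L4 by linarith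
    moreover have "t = 9 * X" by (simp add: t_def X_def)
    ultimately have X1: "32 * t + 1 \<le> 289 * X" by linarith
    have "100 * (real d + real b) * (real L)\<^sup>2 \<le> (200 * S) * (2 * X)"
      by (rule mult_mono) (use S X in auto)
    moreover have "32 * (7 + real 3 * real d + 3 * real b) * (32 * t + 1) \<le> (416 * S) * (289 * X)"
      by (rule mult_mono) (use S X1 t_pos in auto)
    moreover have "0 \<le> S * X" using S \<open>1 \<le> X\<close> by (intro mult_nonneg_nonneg) auto
    moreover have "(200 * S) * (2 * X) = 400 * (S * X)" "(416 * S) * (289 * X) = 120224 * (S * X)" by simp_all
    ultimately show ?thesis by linarith
  qed
  also have "S * X = real d * log_dim d * (real L)\<^sup>2 + log_dim d * (real L)\<^sup>2 * ln (real k)"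
    by (simp add: S_def X_def algebra_simps)
  finally show ?thesis by simp
qed

end

theorem theorem7:
  "\<exists>C::real. C > 0 \<and> (\<forall>d L k :: nat. d \<ge> 1 \<longrightarrow> L \<ge> 2 \<longrightarrow> 1 \<le> k \<longrightarrow> real k \<le> 1 / 2 * real L ^ d \<longrightarrow>
     mixing_time (torus_vertices d L) (torus_edges d L) k
       \<le> ereal (C * (real d * log_dim d * (real L)\<^sup>2 + log_dim d * (real L)\<^sup>2 * ln (real k))))"
  by (intro exI[of _ 121000] conjI allI impI mixing_time_torus_le) auto

end
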